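(* Let $k\ge2$ and let $f,f_n\in\mathcal L_k$ with $I_k^e(f_n)<\infty$ a.s. for every $n\in\mathbb Z_+$. Suppose there exists a probability measure $m$ on $E$ equivalent to $\mu$, with $\psi=d\mu/dm\in(0,\infty)$ $m$-a.e., such that $$L^\alpha\ln^{k-1}L\bigl(|f_n-f|\cdot(\psi^{\otimes k})^{1/\alpha},\,m\bigr)\to0\qquad\text{as }n\to\infty .$$ Then $I_k^e(f)<\infty$ a.s., and $I_k^e(f_n)\to I_k^e(f)$ in probability as $n\to\infty$.
   Context: $\mathbb Z_+=\{1,2,\dots\}$, $\alpha\in(0,\infty)$, $\bigvee$ denotes supremum. $(E,\mathcal E)$ is a Borel space (there is a measurable bijection, with measurable inverse, onto a Borel subset of $[0,1]$) and $\mu$ is a nonzero $\sigma$-finite measure on it. Notation: $\ln_+x=\ln(x\vee1)$. For a measure $\nu$ on $E$ and measurable $h:E^k\to[0,\infty]$, $L^\alpha\ln^{k-1}L(h,\nu)=\int_{E^k}h^\alpha(\boldsymbol u)\bigl(1+(\ln_+h(\boldsymbol u))^{k-1}\bigr)\nu^k(d\boldsymbol u)$. $\psi^{\otimes k}(x_1,\dots,x_k)=\psi(x_1)\cdots\psi(x_k)$. $M_\alpha=(M_\alpha(A))_{A\in\mathcal E}$ is an independently scattered $\alpha$-Fréchet random sup measure with control measure $\mu$: $[0,\infty]$-valued random variables such that (i) $M_\alpha(A_1),\dots,M_\alpha(A_n)$ are independent for disjoint $A_i\in\mathcal E$; (ii) $\mathbb P(M_\alpha(A)\le x)=\exp\{-\mu(A)x^{-\alpha}\}$,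 $x\in(0,\infty)$ (so $M_\alpha(A)=\infty$ a.s. if $\mu(A)=\infty$); (iii) $M_\alpha(\bigcup_{j\ge1}A_j)=\bigvee_{j\ge1}M_\alpha(A_j)$ a.s. for $A_j\in\mathcal E$. Off-diagonal space: $D^{(k)}=\{(x_1,\dots,x_k)\in E^k:x_i=x_j\text{ for some }i\ne j\}$, $E^{(k)}=E^k\setminus D^{(k)}$, $\mathcal E^{(k)}=\{A\cap E^{(k)}:A\in\mathcal E^k\}$. $\mathcal L_k$ is the class of measurable $f:E^k\to[0,\infty]$ vanishing on $D^{(k)}$. Product random sup measure $M_\alpha^{(k)}$ on $\mathcal E^{(k)}$: when the control measure is finite, $M_\alpha^{(k)}(A_1\times\cdots\times A_k)=M_\alpha(A_1)\cdots M_\alpha(A_k)$ for pairwise disjoint $A_i\in\mathcal E$; $M_\alpha^{(k)}(\bigcup_{i=1}^mB_i)=\bigvee_{i=1}^mM_\alpha^{(k)}(B_i)$ for such off-diagonal rectangles $B_i$; and for $A\in\mathcal E^{(k)}$, $M_\alpha^{(k)}(A)$ is the $L^\gamma$-limit ($\gamma\in(0,\alpha)$) of $M_\alpha^{(k)}(A_n)$ for finite unions $A_n$ of off-diagonal rectangles with $\mu^k(A_n\Delta A)\to0$. For $\sigma$-finite $\mu$, take $E_n\uparrow E$ with $\mu(E_n)\in(0,\infty)$, let $M_{\alpha,E_n}(\cdot)=M_\alpha(\cdot\cap E_n)$ and $M_\alpha^{(k)}(A)=\bigvee_nM_{\alpha,E_n}^{(k)}(A)$. All of this is a.s. independent of choices.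 Multiple extremal integral: for simple $f=\sum_{i=1}^Na_i\mathbf 1_{A_i}$ with $a_i\in(0,\infty)$ and disjoint $A_i\in\mathcal E^{(k)}$, $I_k^e(f)=\bigvee_{i=1}^Na_iM_\alpha^{(k)}(A_i)$. For $f\in\mathcal L_k$, $I_k^e(f)$ is the a.s. limit of $I_k^e(f_n)$ for any such simple $f_n\le f_{n+1}$ with $f_n\to f$ $\mu^k$-a.e. (a.s. independent of the choice). Equivalently in law (LePage representation), jointly over $f\in\mathcal L_k$ and $k\in\mathbb Z_+$ and for any probability measure $m$ equivalent to $\mu$ with $\psi=d\mu/dm\in(0,\infty)$ $m$-a.e., $I_k^e(f)\overset d=\bigvee_{\boldsymbol j}f(T_{j_1},\dots,T_{j_k})\prod_{r=1}^k\Gamma_{j_r}^{-1/\alpha}\psi(T_{j_r})^{1/\alpha}$, the supremum being over $\boldsymbol j\in\mathbb Z_+^k$ with distinct entries, $(\Gamma_i)$ the arrival times of a standard Poisson process, and $(T_i)$ i.i.d. with law $m$ independent of $(\Gamma_i)$. *)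

theory Defs
  imports "HOL-Probability.Probability"
begin

section \<open>Arithmetic on \<open>[0,\<infinity>]\<close>\<close>

text \<open>The absolute difference \<open>|x - y|\<close>. In \<^typ>\<open>ennreal\<close> one has \<^prop>\<open>top - top = (top :: ennreal)\<close>;
  here \<open>|\<infinity> - \<infinity>| = 0\<close>.\<close>

definition ennreal_dist :: "ennreal \<Rightarrow> ennreal \<Rightarrow> ennreal" where
  "ennreal_dist x y = (if x = y then 0 else max x y - min x y)"

text \<open>The power \<open>x\<^sup>a\<close>, meant for real exponents \<open>a > 0\<close>.\<close>

definition ennreal_powr :: "ennreal \<Rightarrow> real \<Rightarrow> ennreal" where
  "ennreal_powr x a = (if x = \<infinity> then \<infinity> else ennreal (enn2real x powr a))"

definition ln_plus :: "ennreal \<Rightarrow> ennreal" where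
  "ln_plus x = (if x = \<infinity> then \<infinity> else ennreal (ln (max (enn2real x) 1)))"

definition tendsto_in_prob ::
  "'w measure \<Rightarrow> (nat \<Rightarrow> 'w \<Rightarrow> ennreal) \<Rightarrow> ('w \<Rightarrow> ennreal) \<Rightarrow> bool" where
  "tendsto_in_prob P X Y \<longleftrightarrow>
     (\<forall>\<epsilon>>0. (\<lambda>n. measure P {\<omega> \<in> space P. ennreal \<epsilon> < ennreal_dist (X n \<omega>) (Y \<omega>)}) \<longlonglongrightarrow> 0)"

definition tendsto_in_Lp ::
  "'w measure \<Rightarrow> real \<Rightarrow> (nat \<Rightarrow> 'w \<Rightarrow> ennreal) \<Rightarrow> ('w \<Rightarrow> ennreal) \<Rightarrow> bool" where
  "tendsto_in_Lp P p X Y \<longleftrightarrow>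
     (\<lambda>n. \<integral>\<^sup>+ \<omega>. ennreal_powr (ennreal_dist (X n \<omega>) (Y \<omega>)) p \<partial>P) \<longlonglongrightarrow> 0"

section \<open>Spaces\<close>

definition is_borel_space :: "'a measure \<Rightarrow> bool" where
  "is_borel_space M \<longleftrightarrow> (\<exists>B \<phi>. B \<in> sets (borel :: real measure) \<and> B \<subseteq> {0..1} \<and>
     bij_betw \<phi> (space M) B \<and> \<phi> \<in> measurable M (restrict_space borel B) \<and>
     the_inv_into (space M) \<phi> \<in> measurable (restrict_space borel B) M)"

text \<open>Points of \<open>E\<^sup>k\<close> are the extensional functions on \<open>{..<k}\<close>.\<close>

abbreviation power_measure :: "'a measure \<Rightarrow> nat \<Rightarrow> (nat \<Rightarrow> 'a) measure" where
  "power_measure \<mu> k \<equiv> Pi\<^sub>M {..<k} (\<lambda>_. \<mu>)"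

definition diagonal :: "'a measure \<Rightarrow> nat \<Rightarrow> (nat \<Rightarrow> 'a) set" where
  "diagonal \<mu> k = {x \<in> space (power_measure \<mu> k). \<exists>i<k. \<exists>j<k. i \<noteq> j \<and> x i = x j}"

definition offdiag :: "'a measure \<Rightarrow> nat \<Rightarrow> (nat \<Rightarrow> 'a) set" where
  "offdiag \<mu> k = space (power_measure \<mu> k) - diagonal \<mu> k"

definition offdiag_sets :: "'a measure \<Rightarrow> nat \<Rightarrow> (nat \<Rightarrow> 'a) set set" where
  "offdiag_sets \<mu> k = {A \<inter> offdiag \<mu> k | A. A \<in> sets (power_measure \<mu> k)}"

definition offdiag_funs :: "'a measure \<Rightarrow> nat \<Rightarrow> ((nat \<Rightarrow> 'a) \<Rightarrow> ennreal) set" where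
  "offdiag_funs \<mu> k = {f \<in> borel_measurable (power_measure \<mu> k). \<forall>x\<in>diagonal \<mu> k. f x = 0}"

definition offdiag_rects :: "'a measure \<Rightarrow> nat \<Rightarrow> (nat \<Rightarrow> 'a) set set" where
  "offdiag_rects \<mu> k =
     {Pi\<^sub>E {..<k} A | A. (\<forall>i<k. A i \<in> sets \<mu>) \<and> disjoint_family_on A {..<k}}"

definition offdiag_rect_unions :: "'a measure \<Rightarrow> nat \<Rightarrow> (nat \<Rightarrow> 'a) set set" where
  "offdiag_rect_unions \<mu> k = {\<Union>\<B> | \<B>. finite \<B> \<and> \<B> \<subseteq> offdiag_rects \<mu> k}"

definition L_ln_L :: "real \<Rightarrow> nat \<Rightarrow> ((nat \<Rightarrow> 'a) \<Rightarrow> ennreal) \<Rightarrow> 'a measure \<Rightarrow> ennreal" where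
  "L_ln_L \<alpha> k h \<nu> =
     (\<integral>\<^sup>+ u. ennreal_powr (h u) \<alpha> * (1 + ln_plus (h u) ^ (k - 1)) \<partial>power_measure \<nu> k)"

section \<open>Random sup measures\<close>

definition frechet_sup_measure ::
  "'w measure \<Rightarrow> 'a measure \<Rightarrow> real \<Rightarrow> ('a set \<Rightarrow> 'w \<Rightarrow> ennreal) \<Rightarrow> bool" where
  "frechet_sup_measure P \<mu> \<alpha> M \<longleftrightarrow>
     (\<forall>A\<in>sets \<mu>. M A \<in> borel_measurable P) \<and>
     (\<forall>n (A :: nat \<Rightarrow> 'a set). (\<forall>i<n. A i \<in> sets \<mu>) \<longrightarrow> disjoint_family_on A {..<n} \<longrightarrow>
        prob_space.indep_vars P (\<lambda>_. borel) (\<lambda>i. M (A i)) {..<n}) \<and>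
     (\<forall>A\<in>sets \<mu>. \<forall>x>0. measure P {\<omega> \<in> space P. M A \<omega> \<le> ennreal x} =
        (if emeasure \<mu> A = \<infinity> then 0 else exp (- measure \<mu> A * x powr (- \<alpha>)))) \<and>
     (\<forall>A :: nat \<Rightarrow> 'a set. (\<forall>j. A j \<in> sets \<mu>) \<longrightarrow>
        (AE \<omega> in P. M (\<Union>j. A j) \<omega> = (SUP j. M (A j) \<omega>)))"

text \<open>A family \<open>Mk\<close> of random variables is a version of the product of the random sup measure
  \<open>M\<close> with finite control measure \<open>\<nu>\<close>. Products and suprema of random variables
  are only determined up to null sets (for instance, the empty rectangle has many representations),
  so all identities hold almost surely. The limit defining \<open>Mk A\<close> does not depend on the
  approximating sequence, and it is taken along all of them.\<close>

definition finite_product_sup_measure ::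
  "'w measure \<Rightarrow> 'a measure \<Rightarrow> real \<Rightarrow> ('a set \<Rightarrow> 'w \<Rightarrow> ennreal) \<Rightarrow> nat \<Rightarrow>
   ((nat \<Rightarrow> 'a) set \<Rightarrow> 'w \<Rightarrow> ennreal) \<Rightarrow> bool" where
  "finite_product_sup_measure P \<nu> \<alpha> M k Mk \<longleftrightarrow>
     (\<forall>A\<in>offdiag_sets \<nu> k. Mk A \<in> borel_measurable P) \<and>
     (\<forall>A. (\<forall>i<k. A i \<in> sets \<nu>) \<longrightarrow> disjoint_family_on A {..<k} \<longrightarrow>
        (AE \<omega> in P. Mk (Pi\<^sub>E {..<k} A) \<omega> = (\<Prod>i<k. M (A i) \<omega>))) \<and>
     (\<forall>m B. (\<forall>i<m. B i \<in> offdiag_rects \<nu> k) \<longrightarrow>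
        (AE \<omega> in P. Mk (\<Union>i<m. B i) \<omega> = (SUP i\<in>{..<(m::nat)}. Mk (B i) \<omega>))) \<and>
     (\<forall>A\<in>offdiag_sets \<nu> k. \<forall>S. (\<forall>n. S n \<in> offdiag_rect_unions \<nu> k) \<longrightarrow>
        (\<lambda>n. emeasure (power_measure \<nu> k) (sym_diff (S n) A)) \<longlonglongrightarrow> 0 \<longrightarrow>
        (\<forall>\<gamma>. 0 < \<gamma> \<and> \<gamma> < \<alpha> \<longrightarrow> tendsto_in_Lp P \<gamma> (\<lambda>n. Mk (S n)) (Mk A)))"

text \<open>For \<open>\<sigma>\<close>-finite \<open>\<mu>\<close>; \<^term>\<open>density \<mu> (indicator F)\<close> is \<open>\<mu>(\<cdot> \<inter> F)\<close>, the control
  measure of \<open>M(\<cdot> \<inter> F)\<close>.\<close>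

definition product_sup_measure ::
  "'w measure \<Rightarrow> 'a measure \<Rightarrow> real \<Rightarrow> ('a set \<Rightarrow> 'w \<Rightarrow> ennreal) \<Rightarrow> nat \<Rightarrow>
   ((nat \<Rightarrow> 'a) set \<Rightarrow> 'w \<Rightarrow> ennreal) \<Rightarrow> bool" where
  "product_sup_measure P \<mu> \<alpha> M k Mk \<longleftrightarrow>
     (\<forall>A\<in>offdiag_sets \<mu> k. Mk A \<in> borel_measurable P) \<and>
     (\<exists>(F :: nat \<Rightarrow> 'a set) N.
        (\<forall>n. F n \<in> sets \<mu> \<and> 0 < emeasure \<mu> (F n) \<and> emeasure \<mu> (F n) < \<infinity>) \<and>
        incseq F \<and> (\<Union>n. F n) = space \<mu> \<and>
        (\<forall>n. finite_product_sup_measure P (density \<mu> (indicator (F n))) \<alpha>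
                (\<lambda>A. M (A \<inter> F n)) k (N n)) \<and>
        (\<forall>A\<in>offdiag_sets \<mu> k. AE \<omega> in P. Mk A \<omega> = (SUP n. N n A \<omega>)))"

section \<open>Multiple extremal integrals\<close>

definition simple_rep ::
  "'a measure \<Rightarrow> nat \<Rightarrow> nat \<Rightarrow> (nat \<Rightarrow> real) \<Rightarrow> (nat \<Rightarrow> (nat \<Rightarrow> 'a) set) \<Rightarrow> bool" where
  "simple_rep \<mu> k N a A \<longleftrightarrow>
     (\<forall>i<N. 0 < a i \<and> A i \<in> offdiag_sets \<mu> k) \<and> disjoint_family_on A {..<N}"

definition simple_fun ::
  "nat \<Rightarrow> (nat \<Rightarrow> real) \<Rightarrow> (nat \<Rightarrow> (nat \<Rightarrow> 'a) set) \<Rightarrow> (nat \<Rightarrow> 'a) \<Rightarrow> ennreal" where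
  "simple_fun N a A = (\<lambda>x. \<Sum>i<N. ennreal (a i) * indicator (A i) x)"

definition offdiag_simple :: "'a measure \<Rightarrow> nat \<Rightarrow> ((nat \<Rightarrow> 'a) \<Rightarrow> ennreal) set" where
  "offdiag_simple \<mu> k = {simple_fun N a A | N a A. simple_rep \<mu> k N a A}"

text \<open>\<open>I\<close> is a version of the \<open>k\<close>-fold extremal integral with respect to the product random sup
  measure \<open>Mk\<close>: every random variable \<open>I f\<close> is determined up to null sets, by the limit along any
  sequence of simple functions increasing to \<open>f\<close> almost everywhere.\<close>

definition extremal_integral ::
  "'w measure \<Rightarrow> 'a measure \<Rightarrow> nat \<Rightarrow> ((nat \<Rightarrow> 'a) set \<Rightarrow> 'w \<Rightarrow> ennreal) \<Rightarrow>
   (((nat \<Rightarrow> 'a) \<Rightarrow> ennreal) \<Rightarrow> 'w \<Rightarrow> ennreal) \<Rightarrow> bool" where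
  "extremal_integral P \<mu> k Mk I \<longleftrightarrow>
     (\<forall>f\<in>offdiag_funs \<mu> k. I f \<in> borel_measurable P) \<and>
     (\<forall>N a A. simple_rep \<mu> k N a A \<longrightarrow>
        (AE \<omega> in P. I (simple_fun N a A) \<omega> = (SUP i\<in>{..<N}. ennreal (a i) * Mk (A i) \<omega>))) \<and>
     (\<forall>f\<in>offdiag_funs \<mu> k. \<forall>g. (\<forall>n. g n \<in> offdiag_simple \<mu> k) \<longrightarrow>
        (\<forall>n. \<forall>x\<in>space (power_measure \<mu> k). g n x \<le> g (Suc n) x) \<longrightarrow>
        (AE x in power_measure \<mu> k. (\<lambda>n. g n x) \<longlonglongrightarrow> f x) \<longrightarrow>
        (AE \<omega> in P. (\<lambda>n. I (g n) \<omega>) \<longlonglongrightarrow> I f \<omega>))"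

end

theory Submission
  imports Defs
begin

text \<open>The extremal integral is subadditive: for simple functions over a common partition it is a maximum
  of terms \<open>c * Mk A\<close>, and a maximum of sums is at most the sum of the maxima
  (\<open>I_subadditive\<close>). With \<open>h\<^sub>n = |f\<^sub>n - f|\<close> this gives \<open>I f \<le> I f\<^sub>n + I h\<^sub>n\<close> and
  \<open>I f\<^sub>n \<le> I f + I h\<^sub>n\<close> almost surely, so both claims follow once \<open>I h\<^sub>n \<longrightarrow> 0\<close> in probability
  (\<open>I_convergence\<close>).

  For that, a tail bound is proved (\<open>I_tail\<close>): for all \<open>\<epsilon>, L > 0\<close>,
  \<open>P (I h > \<epsilon>) \<le> e / L + C * L_ln_L (h * (\<psi> \<otimes> \<dots> \<otimes> \<psi>)\<^sup>1\<^sup>/\<^sup>\<alpha>, m)\<close>, where \<open>C\<close> depends on \<open>L\<close>, \<open>\<epsilon>\<close>,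
  \<open>\<alpha>\<close>, \<open>k\<close> only; first \<open>n\<close> tends to infinity, then \<open>L\<close>. The bound comes from truncation. Cut \<open>E\<close> into the
  countably many sets \<open>{p \<le> \<psi> < e * p}\<close>, with \<open>p\<close> an integer power of \<open>e\<close>. Since \<open>m\<close> is a
  probability measure, all these sets satisfy \<open>M(\<cdot>)\<^sup>\<alpha> \<le> L * p\<close> outside an event of probability at most
  \<open>e / L\<close> (\<open>prob_not_good\<close>). On the remaining event a union bound is affordable: for independent
  \<open>X\<^sub>i\<close> with \<open>P (X\<^sub>i > x) \<le> v\<^sub>i * x\<^sup>-\<^sup>\<alpha>\<close>, the event that \<open>a * X\<^sub>1 * \<dots> * X\<^sub>k > 1\<close> while every
  \<open>X\<^sub>i \<le> K\<^sub>i\<close> has probability at most \<open>v\<^sub>1 * \<dots> * v\<^sub>k * a\<^sup>\<alpha>\<close> times the \<open>(k - 1)\<close>-st power of a logarithm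
  (\<open>truncated_product_tail\<close>); this is where the weight \<open>1 + ln\<^sub>+\<^sup>k\<^sup>-\<^sup>1\<close> originates.

  The bound for products \<open>M A\<^sub>1 * \<dots> * M A\<^sub>k\<close> with disjoint \<open>A\<^sub>i\<close> is transported to all off-diagonal sets.
  Finite unions of off-diagonal rectangles are finite disjoint unions, so the bound is additive on
  them, and they form a ring that approximates every off-diagonal set, because a Borel space admits
  a measurable real-valued injection, which separates the coordinates of an off-diagonal point
  (\<open>rect_ring_approximation\<close>, \<open>set_tail\<close>). Passing to the limit costs a factor \<open>2\<close>. A simple
  function subordinate to the partition is then treated by another union bound, and a general \<open>h\<close> by
  monotone approximation.\<close>

section \<open>Arithmetic and convergence in \<open>[0,\<infinity>]\<close>\<close>

lemma ennreal_dist_measurable [measurable]: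
  assumes [measurable]: "f \<in> borel_measurable N" "g \<in> borel_measurable N"
  shows "(\<lambda>x. ennreal_dist (f x) (g x)) \<in> borel_measurable N"
  unfolding ennreal_dist_def by measurable

lemma ennreal_powr_measurable [measurable]:
  assumes [measurable]: "f \<in> borel_measurable N"
  shows "(\<lambda>x. ennreal_powr (f x) a) \<in> borel_measurable N"
  unfolding ennreal_powr_def by measurable

lemma ln_plus_measurable [measurable]:
  assumes [measurable]: "f \<in> borel_measurable N"
  shows "(\<lambda>x. ln_plus (f x)) \<in> borel_measurable N"
  unfolding ln_plus_def by measurable

lemma ennreal_dist_commute: "ennreal_dist x y = ennreal_dist y x"
  by (auto simp: ennreal_dist_def max.commute min.commute)

lemma le_add_ennreal_dist: "x \<le> y + ennreal_dist x y"
proof (cases "x \<le> y")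
  case True
  then show ?thesis by (simp add: add_increasing2)
next
  case False
  then show ?thesis
    by (auto simp: ennreal_dist_def max_def min_def add_diff_inverse_ennreal)
qed

lemma ennreal_dist_le:
  assumes "x \<le> y + z" "y \<le> x + z" "x < \<infinity>" "y < \<infinity>"
  shows "ennreal_dist x y \<le> z"
  using assms by (auto simp: ennreal_dist_def max_def min_def ennreal_minus_le_iff)

text \<open>The separation used to turn closeness in probability into a comparison of tail events.\<close>

lemma less_ennreal_dist:
  assumes "ennreal s < x" "y \<le> ennreal r" "0 \<le> r" "r \<le> s"
  shows "ennreal (s - r) < ennreal_dist x y"
proof -
  have yx: "y < x" using assms by (meson ennreal_leI le_less_trans order_trans)
  have "ennreal (s - r) = ennreal s - ennreal r" using assms by (simp add: ennreal_minus)
  also have "\<dots> < x - y"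
  proof (cases x)
    case top
    then show ?thesis using assms by (auto simp: ennreal_minus neq_top_trans)
  next
    case (real x')
    obtain y' where y: "y = ennreal y'" "0 \<le> y'" using assms by (cases y) (auto simp: top_unique)
    show ?thesis using real y assms by (auto simp: ennreal_minus ennreal_less_iff)
  qed
  also have "\<dots> = ennreal_dist x y" using yx by (auto simp: ennreal_dist_def max_def min_def)
  finally show ?thesis .
qed

lemma ennreal_powr_mono: "0 < a \<Longrightarrow> x \<le> y \<Longrightarrow> ennreal_powr x a \<le> ennreal_powr y a"
  by (cases x; cases y) (auto simp: ennreal_powr_def top_unique intro!: powr_mono2)

lemma ln_plus_mono: "x \<le> y \<Longrightarrow> ln_plus x \<le> ln_plus y"
  by (cases x; cases y) (auto simp: ln_plus_def top_unique intro!: ennreal_leI)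

text \<open>Markov's inequality applied to the \<open>p\<close>-th power of the distance.\<close>

lemma (in prob_space) tendsto_in_Lp_imp_prob:
  assumes p: "0 < p" and d: "0 < \<delta>"
    and [measurable]: "\<And>n. X n \<in> borel_measurable M" "Y \<in> borel_measurable M"
    and lim: "tendsto_in_Lp M p X Y"
  shows "(\<lambda>n. emeasure M {\<omega>\<in>space M. ennreal \<delta> < ennreal_dist (X n \<omega>) (Y \<omega>)}) \<longlonglongrightarrow> 0"
proof (rule tendsto_sandwich[where f="\<lambda>_. 0"])
  let ?D = "\<lambda>n \<omega>. ennreal_powr (ennreal_dist (X n \<omega>) (Y \<omega>)) p"
  let ?c = "ennreal (1 / \<delta> powr p)"
  show "(\<lambda>n. ?c * (\<integral>\<^sup>+\<omega>. ?D n \<omega> \<partial>M)) \<longlonglongrightarrow> 0"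
    using lim ennreal_tendsto_cmult[of ?c "\<lambda>n. \<integral>\<^sup>+\<omega>. ?D n \<omega> \<partial>M" 0 sequentially]
    unfolding tendsto_in_Lp_def by simp
  have "emeasure M {\<omega>\<in>space M. ennreal \<delta> < ennreal_dist (X n \<omega>) (Y \<omega>)}
      \<le> ?c * (\<integral>\<^sup>+\<omega>. ?D n \<omega> \<partial>M)" for n
  proof -
    have *: "1 \<le> ?c * ?D n \<omega>" if "ennreal \<delta> < ennreal_dist (X n \<omega>) (Y \<omega>)" for \<omega>
    proof -
      have "1 = ?c * ennreal_powr (ennreal \<delta>) p"
        using d by (simp add: ennreal_powr_def flip: ennreal_mult)
      also have "\<dots> \<le> ?c * ?D n \<omega>"
        using that p by (intro mult_left_mono ennreal_powr_mono) auto
      finally show ?thesis .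
    qed
    have "emeasure M {\<omega>\<in>space M. ennreal \<delta> < ennreal_dist (X n \<omega>) (Y \<omega>)}
       \<le> emeasure M ({\<omega>\<in>space M. 1 \<le> ?c * ?D n \<omega>} \<inter> space M)"
      using * by (intro emeasure_mono) auto
    also have "\<dots> \<le> ?c * (\<integral>\<^sup>+\<omega>. ?D n \<omega> * indicator (space M) \<omega> \<partial>M)"
      using nn_integral_Markov_inequality[of "?D n" "space M" M ?c] by (simp add: Int_def conj_commute)
    also have "\<dots> = ?c * (\<integral>\<^sup>+\<omega>. ?D n \<omega> \<partial>M)"
      by (intro arg_cong2[where f="(*)"] nn_integral_cong refl) auto
    finally show ?thesis .
  qed
  then show "eventually (\<lambda>n. emeasure M {\<omega>\<in>space M. ennreal \<delta> < ennreal_dist (X n \<omega>) (Y \<omega>)}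
      \<le> ?c * (\<integral>\<^sup>+\<omega>. ?D n \<omega> \<partial>M)) sequentially" by simp
qed auto

text \<open>If \<open>Y' < X'\<close> with positive probability, then two rationals separate the two limits on an event of
  positive probability. There \<open>X n \<le> Y n\<close> forces one of \<open>X n\<close> and \<open>Y n\<close> to stay at least a
  third of the gap away from its limit.\<close>

lemma (in prob_space) AE_le_of_limits_in_probability:
  assumes [measurable]: "\<And>n. X n \<in> borel_measurable M" "X' \<in> borel_measurable M"
    "\<And>n. Y n \<in> borel_measurable M" "Y' \<in> borel_measurable M"
    and le: "\<And>n. AE \<omega> in M. X n \<omega> \<le> Y n \<omega>"
    and X: "\<And>\<delta>. 0 < \<delta> \<Longrightarrow> (\<lambda>n. emeasure M {\<omega>\<in>space M. ennreal \<delta> < ennreal_dist (X n \<omega>) (X' \<omega>)}) \<longlonglongrightarrow> 0"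
    and Y: "\<And>\<delta>. 0 < \<delta> \<Longrightarrow> (\<lambda>n. emeasure M {\<omega>\<in>space M. ennreal \<delta> < ennreal_dist (Y n \<omega>) (Y' \<omega>)}) \<longlonglongrightarrow> 0"
  shows "AE \<omega> in M. X' \<omega> \<le> Y' \<omega>"
proof -
  have null: "AE \<omega> in M. \<not> (Y' \<omega> \<le> ennreal (of_rat q) \<and> ennreal (of_rat r) < X' \<omega>)"
    if qr: "0 \<le> q" "q < r" for q r :: rat
  proof -
    define q' r' where "q' = real_of_rat q" "r' = real_of_rat r"
    have qr': "0 \<le> q'" "q' < r'" using qr by (auto simp: q'_r'_def of_rat_less)
    define d where "d = (r' - q') / 3"
    have d: "0 < d" using qr' by (simp add: d_def)
    have d3: "q' + d \<le> r'" using qr' by (simp add: d_def field_simps)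
    let ?B = "{\<omega>\<in>space M. Y' \<omega> \<le> ennreal q' \<and> ennreal r' < X' \<omega>}"
    let ?X = "\<lambda>n. {\<omega>\<in>space M. ennreal d < ennreal_dist (X n \<omega>) (X' \<omega>)}"
    let ?Y = "\<lambda>n. {\<omega>\<in>space M. ennreal d < ennreal_dist (Y n \<omega>) (Y' \<omega>)}"
    \<comment> \<open>Were both distances at most \<open>d\<close>, then \<open>Y n \<le> q' + d < r' - d \<le> X n\<close>.\<close>
    have "emeasure M ?B \<le> emeasure M (?X n) + emeasure M (?Y n)" for n
    proof -
      have "AE \<omega> in M. \<omega> \<in> ?B \<longrightarrow> \<omega> \<in> ?X n \<union> ?Y n"
        using le[of n]
      proof eventually_elim
        case (elim \<omega>)
        show ?case
        proof (safe)
          assume w: "\<omega> \<in> space M" "Y' \<omega> \<le> ennreal q'" "ennreal r' < X' \<omega>"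
            "\<omega> \<in> space M" "\<not> ennreal d < ennreal_dist (Y n \<omega>) (Y' \<omega>)"
          have "Y n \<omega> \<le> ennreal (q' + d)"
          proof (rule ccontr)
            assume "\<not> ?thesis"
            then have "ennreal (q' + d - q') < ennreal_dist (Y n \<omega>) (Y' \<omega>)"
              using w d qr' by (intro less_ennreal_dist) auto
            then show False using w by simp
          qed
          then have "X n \<omega> \<le> ennreal (q' + d)" using elim by (rule order_trans[rotated])
          have "ennreal (r' - (q' + d)) < ennreal_dist (X' \<omega>) (X n \<omega>)"
            using w(3) \<open>X n \<omega> \<le> ennreal (q' + d)\<close> qr'(1) d d3 by (intro less_ennreal_dist) simp_all
          moreover have "d \<le> r' - (q' + d)" using qr' by (simp add: d_def field_simps)
          ultimately show "ennreal d < ennreal_dist (X n \<omega>) (X' \<omega>)"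
            unfolding ennreal_dist_commute[of "X n \<omega>"] by (meson ennreal_leI le_less_trans)
        qed
      qed
      then have "emeasure M ?B \<le> emeasure M (?X n \<union> ?Y n)"
        by (intro emeasure_mono_AE) auto
      also have "\<dots> \<le> emeasure M (?X n) + emeasure M (?Y n)"
        by (intro emeasure_subadditive) auto
      finally show ?thesis .
    qed
    moreover have "(\<lambda>n. emeasure M (?X n) + emeasure M (?Y n)) \<longlonglongrightarrow> 0 + 0"
      by (intro tendsto_add X Y d)
    ultimately have "emeasure M ?B \<le> 0"
      by (intro tendsto_lowerbound[of "\<lambda>n. emeasure M (?X n) + emeasure M (?Y n)" 0 sequentially]) auto
    then have "AE \<omega> in M. \<not> (Y' \<omega> \<le> ennreal q' \<and> ennreal r' < X' \<omega>)"
      by (intro AE_I[of _ _ ?B]) auto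
    then show ?thesis by (simp add: q'_r'_def)
  qed
  have "AE \<omega> in M. \<forall>q r :: rat. 0 \<le> q \<and> q < r \<longrightarrow>
      \<not> (Y' \<omega> \<le> ennreal (of_rat q) \<and> ennreal (of_rat r) < X' \<omega>)"
    using null by (simp add: AE_all_countable del: not_le de_Morgan_conj)
  then show ?thesis
  proof eventually_elim
    case (elim \<omega>)
    show ?case
    proof (rule ccontr)
      assume "\<not> X' \<omega> \<le> Y' \<omega>"
      then have "Y' \<omega> < X' \<omega>" by simp
      then obtain v where v: "Y' \<omega> < v" "v < X' \<omega>" using dense by blast
      then obtain y where y: "Y' \<omega> = ennreal y" "0 \<le> y" by (cases "Y' \<omega>") auto
      obtain u where u: "v = ennreal u" "0 \<le> u" using v by (cases v) auto
      define t where "t = (y + u) / 2"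
      have t: "y < t" "t < u" using v y u by (auto simp: t_def ennreal_less_iff)
      obtain q where q: "y < of_rat q" "of_rat q < t" using t of_rat_dense by blast
      obtain r where r: "t < of_rat r" "of_rat r < u" using t of_rat_dense by blast
      have "0 < real_of_rat q" using y q by linarith
      then have "0 \<le> q" by simp
      moreover have "real_of_rat q < real_of_rat r" using q r by linarith
      then have "q < r" by (simp add: of_rat_less)
      moreover have "Y' \<omega> \<le> ennreal (of_rat q)" using y q by (auto intro!: ennreal_leI)
      moreover have "ennreal (of_rat r) < X' \<omega>"
        using r v u by (auto intro: le_less_trans[OF ennreal_leI, of _ u])
      ultimately show False using elim by blast
    qed
  qed
qed

section \<open>Product measures with densities\<close>

text \<open>Both sides agree on rectangles, and \<open>\<sigma>\<close>-finiteness of the density makes rectangles determine the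
  product. It relates \<open>\<mu>\<^sup>k\<close> to \<open>m\<^sup>k\<close> and the powers of the restricted measures
  \<open>\<mu>(\<cdot> \<inter> F)\<close> to \<open>\<mu>\<^sup>k\<close>.\<close>

lemma PiM_density:
  fixes \<psi> :: "'a \<Rightarrow> ennreal"
  assumes I: "finite I" and m: "sigma_finite_measure m"
    and d: "sigma_finite_measure (density m \<psi>)" and [measurable]: "\<psi> \<in> borel_measurable m"
  shows "(\<Pi>\<^sub>M i\<in>I. density m \<psi>) = density (\<Pi>\<^sub>M i\<in>I. m) (\<lambda>u. \<Prod>i\<in>I. \<psi> (u i))"
proof -
  interpret m: product_sigma_finite "\<lambda>_. m" by standard (use m in \<open>auto simp: sigma_finite_measure_def\<close>)
  interpret d: product_sigma_finite "\<lambda>_. density m \<psi>"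
    by standard (use d in \<open>auto simp: sigma_finite_measure_def\<close>)
  show ?thesis
  proof (rule d.PiM_eqI[symmetric])
    show "sets (density (Pi\<^sub>M I (\<lambda>_. m)) (\<lambda>u. \<Prod>i\<in>I. \<psi> (u i))) = sets (Pi\<^sub>M I (\<lambda>_. density m \<psi>))"
      by (simp cong: sets_PiM_cong)
    fix A assume "\<And>i. i \<in> I \<Longrightarrow> A i \<in> sets (density m \<psi>)"
    then have A[measurable]: "\<And>i. i \<in> I \<Longrightarrow> A i \<in> sets m" by simp
    have AP[measurable]: "Pi\<^sub>E I A \<in> sets (Pi\<^sub>M I (\<lambda>_. m))" using I A by (intro sets_PiM_I_finite) auto
    have "emeasure (density (Pi\<^sub>M I (\<lambda>_. m)) (\<lambda>u. \<Prod>i\<in>I. \<psi> (u i))) (Pi\<^sub>E I A) =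
        (\<integral>\<^sup>+u. (\<Prod>i\<in>I. \<psi> (u i)) * indicator (Pi\<^sub>E I A) u \<partial>Pi\<^sub>M I (\<lambda>_. m))"
      by (intro emeasure_density) measurable
    also have "\<dots> = (\<integral>\<^sup>+u. (\<Prod>i\<in>I. \<psi> (u i) * indicator (A i) (u i)) \<partial>Pi\<^sub>M I (\<lambda>_. m))"
    proof (intro nn_integral_cong)
      fix u assume u: "u \<in> space (Pi\<^sub>M I (\<lambda>_. m))"
      show "(\<Prod>i\<in>I. \<psi> (u i)) * indicator (Pi\<^sub>E I A) u = (\<Prod>i\<in>I. \<psi> (u i) * indicator (A i) (u i))"
      proof (cases "u \<in> Pi\<^sub>E I A")
        case True
        then show ?thesis by (auto intro!: prod.cong simp: PiE_mem)
      next
        case False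
        then obtain i where "i \<in> I" "u i \<notin> A i" using u by (auto simp: space_PiM PiE_iff)
        then show ?thesis using False I by (auto simp: prod_zero_iff intro!: bexI[of _ i])
      qed
    qed
    also have "\<dots> = (\<Prod>i\<in>I. emeasure (density m \<psi>) (A i))"
      using I A by (subst m.product_nn_integral_prod) (auto simp: emeasure_density intro!: prod.cong)
    finally show "emeasure (density (Pi\<^sub>M I (\<lambda>_. m)) (\<lambda>u. \<Prod>i\<in>I. \<psi> (u i))) (Pi\<^sub>E I A) =
        (\<Prod>i\<in>I. emeasure (density m \<psi>) (A i))" .
  qed (rule I)
qed

section \<open>Approximation by off-diagonal rectangles\<close>

text \<open>The sets approximable from a ring are closed under differences and, by continuity from below of a
  finite measure, under countable unions. The ring has no unit in the application: the union \<open>D\<close> of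
  its members plays that role, and the hypothesis on \<open>D\<close> itself is what gives complements.\<close>

lemma (in finite_measure) ring_approximation:
  assumes ring: "ring_of_sets \<Omega> R" and R: "R \<subseteq> sets M"
    and G: "sets M = sigma_sets (space M) G" and D: "D \<in> sets M"
    and base: "\<And>X. X \<in> insert (space M) G \<Longrightarrow> \<exists>Q. range Q \<subseteq> R \<and> X \<inter> D = (\<Union>n::nat. Q n)"
    and A: "A \<in> sets M" and e: "0 < e"
  shows "\<exists>S\<in>R. measure M (sym_diff S (A \<inter> D)) < e"
proof -
  interpret ring_of_sets \<Omega> R by fact
  define ap where "ap A \<longleftrightarrow> A \<in> sets M \<and> (\<forall>e>0. \<exists>S\<in>R. measure M (sym_diff S A) < e)" for A
  have cover: "measure M A \<le> measure M B + measure M C"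
    if "A \<subseteq> B \<union> C" "A \<in> sets M" "B \<in> sets M" "C \<in> sets M" for A B C
    using order_trans[OF finite_measure_mono[of A "B \<union> C"] measure_Un_le[of B M C]] that by simp
  have ap_R: "ap S" if "S \<in> R" for S
    using that R by (auto simp: ap_def intro!: bexI[of _ S])
  have ap_diff: "ap (A - B)" if ab: "ap A" "ap B" for A B
    unfolding ap_def
  proof (intro conjI allI impI)
    show AB: "A - B \<in> sets M" using that by (auto simp: ap_def)
    fix e :: real assume "0 < e"
    then have e2: "0 < e / 2" by simp
    obtain S where S: "S \<in> R" "measure M (sym_diff S A) < e / 2"
      using ab(1) e2 unfolding ap_def by blast
    obtain T where T: "T \<in> R" "measure M (sym_diff T B) < e / 2"
      using ab(2) e2 unfolding ap_def by blast
    have "measure M (sym_diff (S - T) (A - B)) \<le> measure M (sym_diff S A) + measure M (sym_diff T B)"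
    proof (rule cover)
      show "sym_diff (S - T) (A - B) \<subseteq> sym_diff S A \<union> sym_diff T B" by blast
    qed (use S T R ab AB in \<open>auto simp: ap_def\<close>)
    then show "\<exists>S\<in>R. measure M (sym_diff S (A - B)) < e"
      using S T by (intro bexI[of _ "S - T"]) auto
  qed
  have ap_un: "ap (A \<union> B)" if ab: "ap A" "ap B" for A B
    unfolding ap_def
  proof (intro conjI allI impI)
    show AB: "A \<union> B \<in> sets M" using that by (auto simp: ap_def)
    fix e :: real assume "0 < e"
    then have e2: "0 < e / 2" by simp
    obtain S where S: "S \<in> R" "measure M (sym_diff S A) < e / 2"
      using ab(1) e2 unfolding ap_def by blast
    obtain T where T: "T \<in> R" "measure M (sym_diff T B) < e / 2"
      using ab(2) e2 unfolding ap_def by blast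
    have "measure M (sym_diff (S \<union> T) (A \<union> B)) \<le> measure M (sym_diff S A) + measure M (sym_diff T B)"
    proof (rule cover)
      show "sym_diff (S \<union> T) (A \<union> B) \<subseteq> sym_diff S A \<union> sym_diff T B" by blast
    qed (use S T R ab AB in \<open>auto simp: ap_def\<close>)
    then show "\<exists>S\<in>R. measure M (sym_diff S (A \<union> B)) < e"
      using S T by (intro bexI[of _ "S \<union> T"]) auto
  qed
  have ap_UN: "ap (\<Union>n. A n)" if A: "\<And>n. ap (A n)" for A :: "nat \<Rightarrow> 'a set"
    unfolding ap_def
  proof (intro conjI allI impI)
    have [measurable]: "A n \<in> sets M" for n using A by (auto simp: ap_def)
    show U: "(\<Union>n. A n) \<in> sets M" by measurable
    fix e :: real assume e: "0 < e"
    define V where "V n = (\<Union>i\<le>n. A i)" for n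
    have V: "ap (V n)" for n
    proof (induction n)
      case 0
      then show ?case using A by (simp add: V_def)
    next
      case (Suc n)
      have "V (Suc n) = V n \<union> A (Suc n)" by (auto simp: V_def le_Suc_eq)
      then show ?case using ap_un[OF Suc A] by simp
    qed
    have "(\<lambda>n. measure M (V n)) \<longlonglongrightarrow> measure M (\<Union>n. V n)"
    proof (rule finite_Lim_measure_incseq)
      show "range V \<subseteq> sets M" using V by (auto simp: ap_def)
      show "incseq V" unfolding V_def incseq_def by (meson UN_mono atMost_subset_iff subset_refl)
    qed
    moreover have "(\<Union>n. V n) = (\<Union>n. A n)" by (auto simp: V_def)
    ultimately have "eventually (\<lambda>n. measure M (\<Union>n. A n) - e / 2 < measure M (V n)) sequentially"
      using e by (intro order_tendstoD) auto
    then obtain n where n: "measure M (\<Union>n. A n) - e / 2 < measure M (V n)"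
      by (auto simp: eventually_sequentially)
    have sub: "V n \<subseteq> (\<Union>n. A n)" by (auto simp: V_def)
    have Vn: "V n \<in> sets M" using V by (auto simp: ap_def)
    have dif: "measure M ((\<Union>n. A n) - V n) < e / 2"
      using n finite_measure_Diff[OF U Vn sub] by simp
    obtain S where S: "S \<in> R" "measure M (sym_diff S (V n)) < e / 2"
      using V[of n] half_gt_zero[OF e] unfolding ap_def by blast
    have "measure M (sym_diff S (\<Union>n. A n)) \<le> measure M (sym_diff S (V n)) + measure M ((\<Union>n. A n) - V n)"
    proof (rule cover)
      show "sym_diff S (\<Union>n. A n) \<subseteq> sym_diff S (V n) \<union> ((\<Union>n. A n) - V n)" using sub by blast
    qed (use S R Vn U in auto)
    then show "\<exists>S\<in>R. measure M (sym_diff S (\<Union>n. A n)) < e"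
      using S dif by (intro bexI[of _ S]) auto
  qed
  have ap_base: "ap (X \<inter> D)" if XG: "X \<in> insert (space M) G" for X
  proof -
    obtain Q where "range Q \<subseteq> R" "X \<inter> D = (\<Union>n::nat. Q n)" using base[OF XG] by blast
    then show ?thesis using ap_UN[of Q] ap_R by auto
  qed
  have "A \<in> sigma_sets (space M) G" using A G by simp
  then have "ap (A \<inter> D)"
  proof induction
    case (Basic a)
    then show ?case using ap_base by auto
  next
    case Empty
    then show ?case using ap_R[of "{}"] by simp
  next
    case (Compl a)
    have "(space M - a) \<inter> D = (space M \<inter> D) - (a \<inter> D)" by auto
    then show ?case using ap_diff[OF ap_base Compl.IH, of "space M"] by simp
  next
    case (Union a)
    then have "ap (\<Union>i. a i \<inter> D)" by (intro ap_UN)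
    then show ?case by simp
  qed
  then show ?thesis using e by (auto simp: ap_def)
qed

text \<open>Off-diagonal rectangles inside the box with sides \<open>E i\<close>. Keeping the approximation of a set inside a
  prescribed box is what lets the truncation \<open>M (E i) \<le> K i\<close> control every rectangle used.\<close>

definition rects_within :: "'a measure \<Rightarrow> nat \<Rightarrow> (nat \<Rightarrow> 'a set) \<Rightarrow> (nat \<Rightarrow> 'a) set set" where
  "rects_within \<mu> k E =
     {Pi\<^sub>E {..<k} A | A. (\<forall>i<k. A i \<in> sets \<mu> \<and> A i \<subseteq> E i) \<and> disjoint_family_on A {..<k}}"

lemma rects_withinI:
  "(\<And>i. i < k \<Longrightarrow> A i \<in> sets \<mu> \<and> A i \<subseteq> E i) \<Longrightarrow> disjoint_family_on A {..<k} \<Longrightarrow>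
    Pi\<^sub>E {..<k} A \<in> rects_within \<mu> k E"
  by (auto simp: rects_within_def)

lemma rects_within_measurable: "rects_within \<mu> k E \<subseteq> sets (power_measure \<mu> k)"
  by (auto simp: rects_within_def intro!: sets_PiM_I_finite)

text \<open>For the difference of two rectangles, sort the points of the first by the least coordinate in which
  they leave the second: this gives \<open>k\<close> disjoint rectangles, whose sides shrink those of the
  first and hence stay pairwise disjoint.\<close>

lemma semiring_rects_within:
  assumes k: "0 < k"
  shows "semiring_of_sets (Pi\<^sub>E {..<k} E) (rects_within \<mu> k E)"
proof
  show "rects_within \<mu> k E \<subseteq> Pow (Pi\<^sub>E {..<k} E)"
    unfolding rects_within_def by (auto simp: PiE_iff)
  have "Pi\<^sub>E {..<k} (\<lambda>_. {}) \<in> rects_within \<mu> k E"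
    by (intro rects_withinI) (auto simp: disjoint_family_on_def)
  also have "Pi\<^sub>E {..<k} (\<lambda>_. {} :: 'a set) = {}" using k by (auto simp: PiE_eq_empty_iff)
  finally show "{} \<in> rects_within \<mu> k E" .
next
  fix a b assume "a \<in> rects_within \<mu> k E" "b \<in> rects_within \<mu> k E"
  then obtain A B where A: "a = Pi\<^sub>E {..<k} A" "\<And>i. i < k \<Longrightarrow> A i \<in> sets \<mu> \<and> A i \<subseteq> E i"
      "disjoint_family_on A {..<k}"
    and B: "b = Pi\<^sub>E {..<k} B" "\<And>i. i < k \<Longrightarrow> B i \<in> sets \<mu> \<and> B i \<subseteq> E i"
      "disjoint_family_on B {..<k}"
    unfolding rects_within_def by blast
  show "a \<inter> b \<in> rects_within \<mu> k E"
  proof -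
    have "a \<inter> b = Pi\<^sub>E {..<k} (\<lambda>i. A i \<inter> B i)" by (auto simp: A B PiE_iff)
    also have "\<dots> \<in> rects_within \<mu> k E"
    proof (intro rects_withinI conjI)
      show "disjoint_family_on (\<lambda>i. A i \<inter> B i) {..<k}"
        using A(3) unfolding disjoint_family_on_def by blast
      fix i assume "i < k"
      then show "A i \<inter> B i \<in> sets \<mu>" "A i \<inter> B i \<subseteq> E i" using A(2)[of i] B(2)[of i] by auto
    qed
    finally show ?thesis .
  qed
  define S where "S r i = (if i < r then A i \<inter> B i else if i = r then A i - B i else A i)" for r i
  define D where "D r = Pi\<^sub>E {..<k} (S r)" for r
  have SA: "S r i \<subseteq> A i" for r i by (auto simp: S_def)
  have "D ` {..<k} \<subseteq> rects_within \<mu> k E"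
  proof safe
    fix r show "D r \<in> rects_within \<mu> k E"
      unfolding D_def
    proof (intro rects_withinI conjI)
      fix i assume "i < k"
      then show "S r i \<in> sets \<mu>" using A B by (auto simp: S_def)
      show "S r i \<subseteq> E i" using \<open>i < k\<close> A(2) SA by blast
    qed (use A(3) SA in \<open>unfold disjoint_family_on_def, blast\<close>)
  qed
  moreover have "disjoint (D ` {..<k})"
  proof (rule disjoint_family_on_disjoint_image)
    show "disjoint_family_on D {..<k}"
      unfolding disjoint_family_on_def
    proof (intro ballI impI)
      have *: "D r \<inter> D s = {}" if rs: "r < s" "s < k" for r s
      proof -
        have "False" if u: "u \<in> D r" "u \<in> D s" for u
        proof -
          have "u r \<in> S r r" "u r \<in> S s r" using u rs by (auto simp: D_def PiE_iff)
          then show False using rs by (simp add: S_def)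
        qed
        then show ?thesis by blast
      qed
      fix r s assume "r \<in> {..<k}" "s \<in> {..<k}" "r \<noteq> s"
      then show "D r \<inter> D s = {}" using *[of r s] *[of s r] by (cases "r < s") auto
    qed
  qed
  moreover have "a - b = \<Union>(D ` {..<k})"
  proof safe
    fix u assume u: "u \<in> a" "u \<notin> b"
    then have ex: "\<exists>i. i < k \<and> u i \<notin> B i" by (auto simp: A B PiE_iff)
    define r where "r = (LEAST i. i < k \<and> u i \<notin> B i)"
    have r: "r < k" "u r \<notin> B r" using LeastI_ex[OF ex] by (auto simp: r_def)
    have "u i \<in> B i" if "i < r" for i
      using not_less_Least[of i "\<lambda>i. i < k \<and> u i \<notin> B i"] that r unfolding r_def[symmetric] by auto
    then have "u \<in> D r" using u r by (auto simp: D_def S_def A PiE_iff)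
    then show "u \<in> \<Union>(D ` {..<k})" using r by blast
  next
    fix u r assume "r < k" "u \<in> D r"
    then show "u \<in> a" using SA by (auto simp: D_def A PiE_iff)
  next
    fix u r assume r: "r < k" "u \<in> D r" "u \<in> b"
    then have "u r \<in> S r r" "u r \<in> B r" by (auto simp: D_def B PiE_iff)
    then show False by (simp add: S_def)
  qed
  ultimately show "\<exists>C\<subseteq>rects_within \<mu> k E. finite C \<and> disjoint C \<and> a - b = \<Union>C"
    by (intro exI[of _ "D ` {..<k}"]) auto
qed

text \<open>Disjoint unions, so that measures of the pieces add up; by the semiring property every finite union
  of such rectangles is of this form.\<close>

definition rect_ring :: "'a measure \<Rightarrow> nat \<Rightarrow> (nat \<Rightarrow> 'a set) \<Rightarrow> (nat \<Rightarrow> 'a) set set" where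
  "rect_ring \<mu> k E = {\<Union>C | C. C \<subseteq> rects_within \<mu> k E \<and> finite C \<and> disjoint C}"

lemma ring_rect_ring:
  assumes k: "0 < k"
  shows "ring_of_sets (Pi\<^sub>E {..<k} E) (rect_ring \<mu> k E)"
proof -
  interpret semiring_of_sets "Pi\<^sub>E {..<k} E" "rects_within \<mu> k E"
    by (rule semiring_rects_within[OF k])
  show ?thesis using generating_ring by (simp add: rect_ring_def generated_ring_def)
qed

lemma is_borel_space_separation:
  assumes "is_borel_space \<mu>"
  obtains \<phi> :: "'a \<Rightarrow> real" where "\<phi> \<in> borel_measurable \<mu>" "inj_on \<phi> (space \<mu>)"
    "\<And>x. x \<in> space \<mu> \<Longrightarrow> 0 \<le> \<phi> x \<and> \<phi> x \<le> 1"
proof -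
  obtain B \<phi> where B: "B \<subseteq> {0..1::real}" "bij_betw \<phi> (space \<mu>) B"
    "\<phi> \<in> measurable \<mu> (restrict_space borel B)"
    using assms unfolding is_borel_space_def by blast
  show thesis
  proof (rule that[of \<phi>])
    show "\<phi> \<in> borel_measurable \<mu>" using B(3) by (simp add: measurable_restrict_space2_iff)
    show "inj_on \<phi> (space \<mu>)" using B(2) by (simp add: bij_betw_def)
    show "0 \<le> \<phi> x \<and> \<phi> x \<le> 1" if "x \<in> space \<mu>" for x
      using B(1,2) that by (force simp: bij_betw_def)
  qed
qed

text \<open>Let \<open>\<phi>\<close> embed \<open>E\<close> into \<open>[0, 1]\<close>. A point with distinct coordinates has some \<open>n\<close> such that the numbers
  \<open>n * \<phi> (u i)\<close> have different integer parts. For fixed \<open>n\<close>, the points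
  with this property form the finite union, over injective assignments of integer parts, of rectangles
  with disjoint sides.\<close>

lemma rect_offdiag_exhaustion:
  assumes k: "0 < k" and bs: "is_borel_space \<mu>"
    and X: "\<And>i. i < k \<Longrightarrow> X i \<in> sets \<mu> \<and> X i \<subseteq> E i"
  shows "\<exists>Q. range Q \<subseteq> rect_ring \<mu> k E \<and> Pi\<^sub>E {..<k} X \<inter> offdiag \<mu> k = (\<Union>n::nat. Q n)"
proof -
  obtain \<phi> :: "'a \<Rightarrow> real" where \<phi>[measurable]: "\<phi> \<in> borel_measurable \<mu>" "inj_on \<phi> (space \<mu>)"
    "\<And>x. x \<in> space \<mu> \<Longrightarrow> 0 \<le> \<phi> x \<and> \<phi> x \<le> 1"
    using is_borel_space_separation[OF bs] by blast
  interpret ring_of_sets "Pi\<^sub>E {..<k} E" "rect_ring \<mu> k E" by (rule ring_rect_ring[OF k])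
  have Xs: "X i \<subseteq> space \<mu>" if "i < k" for i using X[OF that] sets.sets_into_space by blast
  define cell where "cell n x = nat \<lfloor>real n * \<phi> x\<rfloor>" for n x
  have [measurable]: "cell n \<in> measurable \<mu> (count_space UNIV)" for n unfolding cell_def by measurable
  have cell_le: "cell n x \<le> n" if "x \<in> space \<mu>" for n x
  proof -
    have "real n * \<phi> x \<le> real n" using \<phi>(3)[OF that] by (simp add: mult_left_le)
    then show ?thesis unfolding cell_def by linarith
  qed
  define Q where "Q n = {u \<in> Pi\<^sub>E {..<k} X. inj_on (\<lambda>i. cell n (u i)) {..<k}}" for n
  define J where "J n = {c \<in> Pi\<^sub>E {..<k} (\<lambda>_. {..n}). inj_on c {..<k}}" for n :: nat
  have J: "finite (J n)" for n
    using finite_PiE[of "{..<k}" "\<lambda>_. {..n}"] by (auto simp: J_def)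
  define Rc where "Rc n c = Pi\<^sub>E {..<k} (\<lambda>i. {x \<in> X i. cell n x = c i})" for n and c :: "nat \<Rightarrow> nat"
  have "Q n = (\<Union>c\<in>J n. Rc n c)" for n
  proof safe
    fix u assume u: "u \<in> Q n"
    define c where "c = (\<lambda>i\<in>{..<k}. cell n (u i))"
    have "c \<in> J n"
      using u Xs cell_le by (auto simp: J_def c_def Q_def PiE_iff inj_on_def) blast
    moreover have "u \<in> Rc n c" using u by (auto simp: Q_def Rc_def c_def PiE_iff)
    ultimately show "u \<in> (\<Union>c\<in>J n. Rc n c)" by blast
  next
    fix u c assume "c \<in> J n" "u \<in> Rc n c"
    then show "u \<in> Q n" by (auto simp: Q_def Rc_def J_def PiE_iff inj_on_def)
  qed
  moreover have "Rc n c \<in> rect_ring \<mu> k E" if c: "c \<in> J n" for n c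
  proof -
    have "Rc n c \<in> rects_within \<mu> k E"
      unfolding Rc_def
    proof (intro rects_withinI conjI)
      fix i assume i: "i < k"
      have [measurable]: "X i \<in> sets \<mu>" using X i by blast
      have "{x \<in> X i. cell n x = c i} = {x \<in> space \<mu>. x \<in> X i \<and> cell n x = c i}" using Xs[OF i] by auto
      also have "\<dots> \<in> sets \<mu>" by measurable
      finally show "{x \<in> X i. cell n x = c i} \<in> sets \<mu>" .
      show "{x \<in> X i. cell n x = c i} \<subseteq> E i" using X[OF i] by blast
    qed (use c in \<open>auto simp: disjoint_family_on_def J_def inj_on_def\<close>)
    then show ?thesis unfolding rect_ring_def by (auto intro!: exI[of _ "{Rc n c}"])
  qed
  ultimately have "Q n \<in> rect_ring \<mu> k E" for n using J by auto
  moreover have "Pi\<^sub>E {..<k} X \<inter> offdiag \<mu> k = (\<Union>n. Q n)"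
  proof (intro equalityI subsetI)
    fix u assume "u \<in> Pi\<^sub>E {..<k} X \<inter> offdiag \<mu> k"
    then have u: "u \<in> Pi\<^sub>E {..<k} X" "u \<in> offdiag \<mu> k" by auto
    have us: "u i \<in> space \<mu>" if "i < k" for i using u(1) Xs that by (auto simp: PiE_iff)
    \<comment> \<open>The \<open>1\<close> only keeps the set of distances nonempty when \<open>k = 1\<close>.\<close>
    define W where "W = insert 1 {\<bar>\<phi> (u i) - \<phi> (u j)\<bar> | i j. i < k \<and> j < k \<and> i \<noteq> j}"
    have "W \<subseteq> insert 1 ((\<lambda>(i,j). \<bar>\<phi> (u i) - \<phi> (u j)\<bar>) ` ({..<k} \<times> {..<k}))" unfolding W_def by auto
    then have finW: "finite W" by (rule finite_subset) auto
    have posW: "0 < w" if wW: "w \<in> W" for w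
    proof (cases "w = 1")
      case False
      then obtain i j where ij: "w = \<bar>\<phi> (u i) - \<phi> (u j)\<bar>" "i < k" "j < k" "i \<noteq> j"
        using False wW by (auto simp: W_def)
      have "u i \<noteq> u j" using u(2) ij unfolding offdiag_def diagonal_def by blast
      then have "\<phi> (u i) \<noteq> \<phi> (u j)" using \<phi>(2) us ij by (auto simp: inj_on_def)
      then show ?thesis using ij by simp
    qed simp
    have "0 < Min W" using finW posW by (subst Min_gr_iff) (auto simp: W_def)
    then obtain n where n: "1 < real n * Min W" using reals_Archimedean3[of "Min W"] by auto
    have "inj_on (\<lambda>i. cell n (u i)) {..<k}"
    proof (rule inj_onI, rule ccontr)
      fix i j assume ij: "i \<in> {..<k}" "j \<in> {..<k}" "cell n (u i) = cell n (u j)" "i \<noteq> j"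
      have "\<bar>\<phi> (u i) - \<phi> (u j)\<bar> \<in> W" using ij by (auto simp: W_def)
      then have "Min W \<le> \<bar>\<phi> (u i) - \<phi> (u j)\<bar>" using finW by simp
      then have "real n * Min W \<le> real n * \<bar>\<phi> (u i) - \<phi> (u j)\<bar>" by (intro mult_left_mono) auto
      then have "1 < \<bar>real n * \<phi> (u i) - real n * \<phi> (u j)\<bar>"
        using n by (simp add: abs_mult right_diff_distrib[symmetric])
      moreover have "\<lfloor>real n * \<phi> (u i)\<rfloor> = \<lfloor>real n * \<phi> (u j)\<rfloor>"
        using ij \<phi>(3)[OF us] unfolding cell_def
        by (simp add: eq_nat_nat_iff)
      ultimately show False by linarith
    qed
    then show "u \<in> (\<Union>n. Q n)" using u by (auto simp: Q_def)
  next
    fix u assume "u \<in> (\<Union>n. Q n)"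
    then obtain n where u: "u \<in> Q n" by blast
    then have "u \<in> space (power_measure \<mu> k)" using Xs by (auto simp: Q_def space_PiM PiE_iff)
    moreover have "u i \<noteq> u j" if "i < k" "j < k" "i \<noteq> j" for i j
      using u that by (auto simp: Q_def inj_on_def)
    ultimately have "u \<in> offdiag \<mu> k" by (auto simp: offdiag_def diagonal_def)
    then show "u \<in> Pi\<^sub>E {..<k} X \<inter> offdiag \<mu> k" using u by (simp add: Q_def)
  qed
  ultimately show ?thesis by blast
qed

lemma offdiag_measurable:
  assumes "0 < k" "is_borel_space \<mu>"
  shows "offdiag \<mu> k \<in> sets (power_measure \<mu> k)"
proof -
  obtain Q where Q: "range Q \<subseteq> rect_ring \<mu> k (\<lambda>_. space \<mu>)"
    "Pi\<^sub>E {..<k} (\<lambda>_. space \<mu>) \<inter> offdiag \<mu> k = (\<Union>n::nat. Q n)"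
    using rect_offdiag_exhaustion[OF assms, of "\<lambda>_. space \<mu>" "\<lambda>_. space \<mu>"] by auto
  have "rect_ring \<mu> k (\<lambda>_. space \<mu>) \<subseteq> sets (power_measure \<mu> k)"
    using rects_within_measurable unfolding rect_ring_def by fastforce
  then have "(\<Union>n. Q n) \<in> sets (power_measure \<mu> k)" using Q(1) by blast
  moreover have "(\<Union>n. Q n) = offdiag \<mu> k"
    using Q(2) by (auto simp: offdiag_def space_PiM)
  ultimately show ?thesis by simp
qed

lemma rect_ring_measurable: "rect_ring \<mu> k E \<subseteq> sets (power_measure \<mu> k)"
  using rects_within_measurable unfolding rect_ring_def by fastforce

lemma offdiag_sets_iff:
  assumes "0 < k" "is_borel_space \<mu>"
  shows "A \<in> offdiag_sets \<mu> k \<longleftrightarrow> A \<in> sets (power_measure \<mu> k) \<and> A \<subseteq> offdiag \<mu> k"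
proof
  assume "A \<in> offdiag_sets \<mu> k"
  then obtain B where B: "A = B \<inter> offdiag \<mu> k" "B \<in> sets (power_measure \<mu> k)"
    unfolding offdiag_sets_def by blast
  then show "A \<in> sets (power_measure \<mu> k) \<and> A \<subseteq> offdiag \<mu> k"
    using sets.Int[OF B(2) offdiag_measurable[OF assms]] by simp
next
  assume A: "A \<in> sets (power_measure \<mu> k) \<and> A \<subseteq> offdiag \<mu> k"
  then have "A = A \<inter> offdiag \<mu> k" by blast
  then show "A \<in> offdiag_sets \<mu> k" using A unfolding offdiag_sets_def by blast
qed

lemma rect_ring_approximation:
  assumes k: "0 < k" and bs: "is_borel_space \<mu>" and fin: "emeasure (power_measure \<mu> k) (space (power_measure \<mu> k)) \<noteq> \<infinity>"
    and E: "\<And>i. i < k \<Longrightarrow> E i \<in> sets \<mu>"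
    and A: "A \<in> offdiag_sets \<mu> k" "A \<subseteq> Pi\<^sub>E {..<k} E"
  shows "\<exists>S. (\<forall>n. S n \<in> rect_ring \<mu> k E) \<and>
    (\<lambda>n. emeasure (power_measure \<mu> k) (sym_diff (S n) A)) \<longlonglongrightarrow> 0"
proof -
  let ?N = "power_measure \<mu> k" and ?D = "Pi\<^sub>E {..<k} E \<inter> offdiag \<mu> k"
  let ?G = "{Pi\<^sub>E {..<k} X | X. \<forall>i<k. X i \<in> sets \<mu>}"
  interpret finite_measure ?N using fin by (rule finite_measureI)
  have PE: "Pi\<^sub>E {..<k} E \<in> sets ?N" using E by (intro sets_PiM_I_finite) auto
  have G: "sets ?N = sigma_sets (space ?N) ?G"
  proof -
    have "prod_algebra {..<k} (\<lambda>_. \<mu>) = ?G"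
      using prod_algebra_eq_finite[of "{..<k}" "\<lambda>_. \<mu>"] by (simp add: Pi_iff Ball_def)
    then show ?thesis by (simp add: sets_PiM space_PiM)
  qed
  have base: "\<exists>Q. range Q \<subseteq> rect_ring \<mu> k E \<and> Pi\<^sub>E {..<k} X \<inter> ?D = (\<Union>n::nat. Q n)"
    if X: "\<forall>i<k. X i \<in> sets \<mu>" for X
  proof -
    have "\<exists>Q. range Q \<subseteq> rect_ring \<mu> k E \<and>
        Pi\<^sub>E {..<k} (\<lambda>i. X i \<inter> E i) \<inter> offdiag \<mu> k = (\<Union>n::nat. Q n)"
    proof (rule rect_offdiag_exhaustion[OF k bs])
      show "X i \<inter> E i \<in> sets \<mu> \<and> X i \<inter> E i \<subseteq> E i" if "i < k" for i
        using sets.Int[OF _ E[OF that], of "X i"] X that by blast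
    qed
    then show ?thesis unfolding Int_assoc[symmetric] PiE_Int .
  qed
  have "\<exists>S\<in>rect_ring \<mu> k E. measure ?N (sym_diff S (A \<inter> ?D)) < inverse (real (Suc n))" for n
  proof (rule ring_approximation[OF ring_rect_ring[OF k] rect_ring_measurable G])
    show "?D \<in> sets ?N" by (rule sets.Int[OF PE offdiag_measurable[OF k bs]])
    show "A \<in> sets ?N" using A(1) by (simp only: offdiag_sets_iff[OF k bs])
    show "\<exists>Q. range Q \<subseteq> rect_ring \<mu> k E \<and> Y \<inter> ?D = (\<Union>n::nat. Q n)"
      if "Y \<in> insert (space ?N) ?G" for Y
      using that
    proof
      assume "Y = space ?N"
      then have Y: "Y = Pi\<^sub>E {..<k} (\<lambda>_. space \<mu>)" by (simp only: space_PiM)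
      show ?thesis unfolding Y by (rule base) simp
    next
      assume "Y \<in> ?G"
      then obtain X where Y: "Y = Pi\<^sub>E {..<k} X" and X: "\<forall>i<k. X i \<in> sets \<mu>" by blast
      show ?thesis unfolding Y by (rule base[OF X])
    qed
    show "0 < inverse (real (Suc n))" by simp
  qed
  then have "\<forall>n. \<exists>S. S \<in> rect_ring \<mu> k E \<and> measure ?N (sym_diff S (A \<inter> ?D)) < inverse (real (Suc n))"
    by blast
  then obtain S where "\<forall>n. S n \<in> rect_ring \<mu> k E \<and> measure ?N (sym_diff (S n) (A \<inter> ?D)) < inverse (real (Suc n))"
    by (rule exE[OF choice])
  then have S: "S n \<in> rect_ring \<mu> k E" "measure ?N (sym_diff (S n) (A \<inter> ?D)) < inverse (real (Suc n))" for n
    by auto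
  have "A \<subseteq> offdiag \<mu> k" using A(1) by (simp only: offdiag_sets_iff[OF k bs])
  then have AD: "A \<inter> ?D = A" using A(2) by (simp only: Int_absorb2 Int_greatest)
  have le: "emeasure ?N (sym_diff (S n) A) \<le> ennreal (inverse (real (Suc n)))" for n
    unfolding emeasure_eq_measure by (rule ennreal_leI[OF less_imp_le[OF S(2)[of n, unfolded AD]]])
  have "(\<lambda>n. ennreal (inverse (real (Suc n)))) \<longlonglongrightarrow> 0"
    using LIMSEQ_inverse_real_of_nat by (simp add: ennreal_tendsto_0_iff)
  then have "(\<lambda>n. emeasure ?N (sym_diff (S n) A)) \<longlonglongrightarrow> 0"
    by (rule tendsto_sandwich[OF always_eventually always_eventually tendsto_const, rotated 2]) (simp_all only: le zero_le simp_thms)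
  then show ?thesis using S(1) by (intro exI[of _ S] conjI allI)
qed

section \<open>Products of independent heavy-tailed variables\<close>

text \<open>Record each \<open>x i\<close> with \<open>i < j\<close> on the scale \<open>K i * exp (- s / \<alpha>)\<close>, \<open>s = 0, 1, 2, \<dots>\<close>, and leave the last
  factor unrecorded: the product condition bounds it from below in terms of the record. Since every factor
  is at most \<open>K i\<close>, the product condition also bounds each record by \<open>\<alpha> * ln (a * \<Prod>K)\<close>.\<close>

lemma log_scale_discretisation:
  fixes x K :: "nat \<Rightarrow> real"
  assumes \<alpha>: "0 < \<alpha>" and a: "0 < a"
    and x: "\<And>i. i \<le> j \<Longrightarrow> 0 < x i \<and> x i \<le> K i" and prod: "1 < a * (\<Prod>i\<le>j. x i)"
  shows "\<exists>s \<in> Pi\<^sub>E {..<j} (\<lambda>_. {..<nat \<lceil>\<alpha> * ln (a * (\<Prod>i\<le>j. K i))\<rceil>}).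
      (\<forall>i<j. K i * exp (- (real (s i) + 1) / \<alpha>) < x i) \<and>
      1 / (a * (\<Prod>i<j. K i * exp (- real (s i) / \<alpha>))) < x j"
proof -
  define s where "s = (\<lambda>i\<in>{..<j}. nat \<lfloor>\<alpha> * ln (K i / x i)\<rfloor>)"
  have K: "0 < K i" if "i \<le> j" for i using x[OF that] by linarith
  have s: "real (s i) \<le> \<alpha> * ln (K i / x i)" "\<alpha> * ln (K i / x i) < real (s i) + 1" if i: "i < j" for i
  proof -
    have "1 \<le> K i / x i" using x[of i] i by (simp add: le_divide_eq)
    then have "0 \<le> \<alpha> * ln (K i / x i)" using \<alpha> by simp
    then show "real (s i) \<le> \<alpha> * ln (K i / x i)" "\<alpha> * ln (K i / x i) < real (s i) + 1"
      using i by (auto simp: s_def)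
  qed
  have le: "x i \<le> K i * exp (- real (s i) / \<alpha>)" if i: "i < j" for i
  proof -
    have "real (s i) / \<alpha> \<le> ln (K i / x i)" using s(1)[OF i] \<alpha> by (simp add: field_simps)
    then have "exp (real (s i) / \<alpha>) \<le> K i / x i"
      using x[of i] K[of i] i by (subst ln_ge_iff[symmetric]) auto
    then show ?thesis using x[of i] i by (simp add: exp_minus field_simps)
  qed
  have gt: "K i * exp (- (real (s i) + 1) / \<alpha>) < x i" if i: "i < j" for i
  proof -
    have "ln (K i / x i) < (real (s i) + 1) / \<alpha>" using s(2)[OF i] \<alpha> by (simp add: field_simps)
    moreover define e where "e = exp ((real (s i) + 1) / \<alpha>)"
    ultimately have "K i / x i < e"
      using x[of i] K[of i] i by (metis exp_less_mono exp_ln divide_pos_pos less_imp_le_nat)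
    moreover have eq: "exp (- (real (s i) + 1) / \<alpha>) = inverse e"
      unfolding e_def by (metis exp_minus minus_divide_left)
    moreover have "0 < e" by (simp add: e_def)
    ultimately show ?thesis using x[of i] i unfolding eq by (simp add: field_simps)
  qed
  have prodle: "(\<Prod>i<j. x i) \<le> (\<Prod>i<j. K i * exp (- real (s i) / \<alpha>))"
    using le x by (intro prod_mono) (auto simp: less_imp_le)
  have split: "(\<Prod>i\<le>j. g i) = (\<Prod>i<j. g i) * g j" for g :: "nat \<Rightarrow> real"
    by (simp add: lessThan_Suc_atMost[symmetric])
  have last: "1 / (a * (\<Prod>i<j. K i * exp (- real (s i) / \<alpha>))) < x j"
  proof -
    have pos: "0 < (\<Prod>i<j. K i * exp (- real (s i) / \<alpha>))" using K by (intro prod_pos) auto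
    have "1 < a * ((\<Prod>i<j. x i) * x j)" using prod split by simp
    also have "\<dots> \<le> a * ((\<Prod>i<j. K i * exp (- real (s i) / \<alpha>)) * x j)"
      using prodle a x[of j] by (intro mult_left_mono mult_right_mono) auto
    finally show ?thesis using pos a by (simp add: divide_less_eq mult.assoc mult.commute mult.left_commute)
  qed
  have "s \<in> Pi\<^sub>E {..<j} (\<lambda>_. {..<nat \<lceil>\<alpha> * ln (a * (\<Prod>i\<le>j. K i))\<rceil>})"
  proof (rule PiE_I)
    fix i assume i: "i \<in> {..<j}"
    have "(\<Prod>l\<le>j. x l) \<le> (\<Prod>l\<le>j. K l * (if l = i then exp (- real (s i) / \<alpha>) else 1))"
      using x le i by (intro prod_mono) (auto simp: less_imp_le)
    also have "\<dots> = (\<Prod>l\<le>j. K l) * exp (- real (s i) / \<alpha>)"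
      using i by (simp add: prod.distrib)
    finally have "1 < a * ((\<Prod>l\<le>j. K l) * exp (- real (s i) / \<alpha>))"
      using prod a by (meson less_le_trans mult_left_mono less_imp_le)
    then have "exp (real (s i) / \<alpha>) < a * (\<Prod>l\<le>j. K l)"
      by (simp add: exp_minus field_simps)
    moreover have "0 < a * (\<Prod>l\<le>j. K l)" using K a by (intro mult_pos_pos prod_pos) auto
    ultimately have "real (s i) / \<alpha> < ln (a * (\<Prod>l\<le>j. K l))" by (metis exp_less_cancel_iff exp_ln)
    then have "real (s i) < \<alpha> * ln (a * (\<Prod>l\<le>j. K l))" using \<alpha> by (simp add: field_simps)
    then show "s i \<in> {..<nat \<lceil>\<alpha> * ln (a * (\<Prod>i\<le>j. K i))\<rceil>}" by simp linarith
  qed (simp add: s_def)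
  then show ?thesis using gt last by blast
qed

text \<open>The exponent \<open>k - 1\<close> counts the factors whose order of magnitude is recorded, and the integer
  ceiling counts the possible records of one factor. It is \<open>0\<close> when \<open>a * \<Prod>K \<le> 1\<close>
  and \<open>k \<ge> 2\<close>, as then no factors \<open>x\<^sub>i \<le> K i\<close> can have \<open>a * \<Prod>x > 1\<close>.\<close>

definition log_factor :: "real \<Rightarrow> nat \<Rightarrow> (nat \<Rightarrow> real) \<Rightarrow> real \<Rightarrow> real" where
  "log_factor \<alpha> k K a = a powr \<alpha> * (exp 1 * real (nat \<lceil>\<alpha> * ln (a * (\<Prod>i<k. K i))\<rceil>)) ^ (k - 1)"

lemma log_factor_nonneg: "0 \<le> log_factor \<alpha> k K a"
  by (simp add: log_factor_def)

text \<open>Union bound over the records of the preceding discretisation. For a fixed record independence gives the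
  product of the tails, in which the factors \<open>K i\<close> and \<open>exp (- s i)\<close> from the first \<open>k - 1\<close>
  variables cancel against those in the threshold of the last one. Every record thus contributes at most
  \<open>a powr \<alpha> * exp 1 ^ (k - 1) * \<Prod>v\<close>, and only their number matters.\<close>

lemma (in prob_space) truncated_product_tail:
  fixes X :: "nat \<Rightarrow> 'a \<Rightarrow> ennreal" and v K :: "nat \<Rightarrow> real"
  assumes \<alpha>: "0 < \<alpha>" and a: "0 < a" and k: "0 < k"
    and ind: "indep_vars (\<lambda>_. borel) X {..<k}"
    and tail: "\<And>i x. i < k \<Longrightarrow> 0 < x \<Longrightarrow> prob {\<omega>\<in>space M. ennreal x < X i \<omega>} \<le> v i * x powr (- \<alpha>)"
    and v: "\<And>i. i < k \<Longrightarrow> 0 \<le> v i" and K: "\<And>i. i < k \<Longrightarrow> 0 < K i"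
  shows "prob {\<omega>\<in>space M. 1 < ennreal a * (\<Prod>i<k. X i \<omega>) \<and> (\<forall>i<k. X i \<omega> \<le> ennreal (K i))}
     \<le> log_factor \<alpha> k K a * (\<Prod>i<k. v i)"
proof -
  obtain j where kj: "k = Suc j" using k by (cases k) auto
  define n where "n = nat \<lceil>\<alpha> * ln (a * (\<Prod>i\<le>j. K i))\<rceil>"
  define S where "S = Pi\<^sub>E {..<j} (\<lambda>_. {..<n})"
  define y where "y s i = (if i < j then K i * exp (- (real (s i) + 1) / \<alpha>)
      else 1 / (a * (\<Prod>i<j. K i * exp (- real (s i) / \<alpha>))))" for s :: "nat \<Rightarrow> nat" and i
  define B where "B s = (\<Inter>i\<in>{..<k}. X i -` {ennreal (y s i)<..} \<inter> space M)" for s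
  have [measurable]: "X i \<in> borel_measurable M" if "i < k" for i
    using ind that by (auto simp: indep_vars_def)
  have finS: "finite S" unfolding S_def by (intro finite_PiE) auto
  have cardS: "card S = n ^ j" unfolding S_def by (subst card_PiE) auto
  have pos: "0 < (\<Prod>i<j. K i * exp (- real (s i) / \<alpha>))" for s :: "nat \<Rightarrow> nat"
    using K kj by (intro prod_pos) auto
  have y: "0 < y s i" if "i < k" for s i
    using K[OF that] a pos by (auto simp: y_def)
  have sub: "{\<omega>\<in>space M. 1 < ennreal a * (\<Prod>i<k. X i \<omega>) \<and> (\<forall>i<k. X i \<omega> \<le> ennreal (K i))} \<subseteq> (\<Union>s\<in>S. B s)"
  proof
    fix \<omega> assume w: "\<omega> \<in> {\<omega>\<in>space M. 1 < ennreal a * (\<Prod>i<k. X i \<omega>) \<and> (\<forall>i<k. X i \<omega> \<le> ennreal (K i))}"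
    define x where "x i = enn2real (X i \<omega>)" for i
    have x: "X i \<omega> = ennreal (x i)" "x i \<le> K i" if i: "i < k" for i
    proof -
      have "X i \<omega> \<le> ennreal (K i)" using w i by auto
      then have "X i \<omega> < top" using le_less_trans ennreal_less_top by blast
      then show "X i \<omega> = ennreal (x i)" by (simp add: x_def)
      with \<open>X i \<omega> \<le> ennreal (K i)\<close> show "x i \<le> K i" using K[OF i] by (simp add: ennreal_le_iff2)
    qed
    have x0: "0 \<le> x i" for i by (simp add: x_def)
    have "(\<Prod>i<k. X i \<omega>) = ennreal (\<Prod>i<k. x i)"
      using x x0 by (simp add: prod_ennreal[symmetric])
    then have "ennreal 1 < ennreal (a * (\<Prod>i<k. x i))"
      using w a by (simp add: ennreal_mult')
    then have p: "1 < a * (\<Prod>i<k. x i)" by (subst (asm) ennreal_less_iff) auto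
    have xpos: "0 < x i" if "i < k" for i
    proof (rule ccontr)
      assume "\<not> 0 < x i"
      then have "(\<Prod>i<k. x i) = 0" using x0[of i] that by (intro prod_zero) (auto intro!: bexI[of _ i])
      then have "a * (\<Prod>i<k. x i) = 0" by (simp only: mult_zero_right)
      then show False using p by linarith
    qed
    have "\<exists>s \<in> Pi\<^sub>E {..<j} (\<lambda>_. {..<nat \<lceil>\<alpha> * ln (a * (\<Prod>i\<le>j. K i))\<rceil>}).
      (\<forall>i<j. K i * exp (- (real (s i) + 1) / \<alpha>) < x i) \<and>
      1 / (a * (\<Prod>i<j. K i * exp (- real (s i) / \<alpha>))) < x j"
      using p x xpos kj by (intro log_scale_discretisation[OF \<alpha> a]) (auto simp: lessThan_Suc_atMost)
    then obtain s where s: "s \<in> S" "\<And>i. i < j \<Longrightarrow> K i * exp (- (real (s i) + 1) / \<alpha>) < x i"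
      "1 / (a * (\<Prod>i<j. K i * exp (- real (s i) / \<alpha>))) < x j" unfolding S_def n_def by blast
    have "\<omega> \<in> B s"
    proof -
      have "ennreal (y s i) < X i \<omega>" if i: "i < k" for i
      proof -
        have "y s i < x i" using s(2)[of i] s(3) i kj by (cases "i < j") (auto simp: y_def less_Suc_eq)
        then show ?thesis using x[OF i] y[OF i, of s] by (simp add: ennreal_less_iff)
      qed
      then show ?thesis using w by (auto simp: B_def)
    qed
    then show "\<omega> \<in> (\<Union>s\<in>S. B s)" using s(1) by blast
  qed
  have B: "B s \<in> events" for s
    unfolding B_def using k by (intro sets.finite_INT) (auto intro!: measurable_sets)
  have PB: "prob (B s) \<le> a powr \<alpha> * exp 1 ^ j * (\<Prod>i<k. v i)" for s
  proof -
    have "prob (B s) = (\<Prod>i\<in>{..<k}. prob (X i -` {ennreal (y s i)<..} \<inter> space M))"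
      unfolding B_def using k by (intro indep_varsD[OF ind]) auto
    also have "\<dots> \<le> (\<Prod>i<k. v i * y s i powr (- \<alpha>))"
    proof (intro prod_mono conjI)
      fix i assume "i \<in> {..<k}"
      then have i: "i < k" by simp
      have "X i -` {ennreal (y s i)<..} \<inter> space M = {\<omega>\<in>space M. ennreal (y s i) < X i \<omega>}" by auto
      then show "prob (X i -` {ennreal (y s i)<..} \<inter> space M) \<le> v i * y s i powr (- \<alpha>)"
        using tail[OF i y[OF i]] by simp
    qed simp
    also have "\<dots> = (\<Prod>i<k. v i) * (\<Prod>i<k. y s i powr (- \<alpha>))" by (rule prod.distrib)
    also have "(\<Prod>i<k. y s i powr (- \<alpha>)) = a powr \<alpha> * exp 1 ^ j"
    proof -
      have 1: "(\<Prod>i<k. y s i powr (- \<alpha>)) = (\<Prod>i<j. y s i powr (- \<alpha>)) * y s j powr (- \<alpha>)"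
        by (simp add: kj)
      have 2: "y s j powr (- \<alpha>) = a powr \<alpha> * (\<Prod>i<j. (K i * exp (- real (s i) / \<alpha>)) powr \<alpha>)"
      proof -
        have "y s j powr (- \<alpha>) = (a * (\<Prod>i<j. K i * exp (- real (s i) / \<alpha>))) powr \<alpha>"
          using a pos[of s] by (simp add: y_def powr_minus powr_divide)
        also have "\<dots> = a powr \<alpha> * (\<Prod>i<j. K i * exp (- real (s i) / \<alpha>)) powr \<alpha>"
          using a pos[of s] by (simp add: powr_mult)
        also have "(\<Prod>i<j. K i * exp (- real (s i) / \<alpha>)) powr \<alpha> = (\<Prod>i<j. (K i * exp (- real (s i) / \<alpha>)) powr \<alpha>)"
          using K kj by (intro prod_powr_distrib)
        finally show ?thesis .
      qed
      \<comment> \<open>The cancellation: one recorded factor and its share of the last threshold leave exactly \<open>e\<close>.\<close>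
      have 3: "y s i powr (- \<alpha>) * (K i * exp (- real (s i) / \<alpha>)) powr \<alpha> = exp 1" if i: "i < j" for i
      proof -
        have Ki: "0 < K i" using K[of i] i kj by simp
        have "y s i powr (- \<alpha>) = K i powr (- \<alpha>) * exp (real (s i) + 1)"
          using Ki i \<alpha> by (simp add: y_def powr_mult powr_def[of "exp _"])
        moreover have "(K i * exp (- real (s i) / \<alpha>)) powr \<alpha> = K i powr \<alpha> * exp (- real (s i))"
          using Ki \<alpha> by (simp add: powr_mult powr_def[of "exp _"])
        ultimately have "y s i powr (- \<alpha>) * (K i * exp (- real (s i) / \<alpha>)) powr \<alpha> =
            (K i powr (- \<alpha>) * K i powr \<alpha>) * (exp (real (s i) + 1) * exp (- real (s i)))"
          by (simp only: mult_ac)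
        also have "\<dots> = exp 1" using Ki by (simp flip: powr_add exp_add)
        finally show ?thesis .
      qed
      have "(\<Prod>i<k. y s i powr (- \<alpha>)) =
          a powr \<alpha> * (\<Prod>i<j. y s i powr (- \<alpha>) * (K i * exp (- real (s i) / \<alpha>)) powr \<alpha>)"
        unfolding 1 2 by (simp add: prod.distrib)
      also have "(\<Prod>i<j. y s i powr (- \<alpha>) * (K i * exp (- real (s i) / \<alpha>)) powr \<alpha>) = exp 1 ^ j"
        using 3 by simp
      finally show ?thesis .
    qed
    finally show ?thesis by (simp add: mult_ac)
  qed
  have "prob {\<omega>\<in>space M. 1 < ennreal a * (\<Prod>i<k. X i \<omega>) \<and> (\<forall>i<k. X i \<omega> \<le> ennreal (K i))}
      \<le> prob (\<Union>s\<in>S. B s)"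
    using sub B finS by (intro finite_measure_mono) auto
  also have "\<dots> \<le> (\<Sum>s\<in>S. prob (B s))"
    using B finS by (intro finite_measure_subadditive_finite) auto
  also have "\<dots> \<le> (\<Sum>s\<in>S. a powr \<alpha> * exp 1 ^ j * (\<Prod>i<k. v i))"
    by (intro sum_mono PB)
  also have "\<dots> = log_factor \<alpha> k K a * (\<Prod>i<k. v i)"
    by (simp add: cardS log_factor_def kj n_def power_mult_distrib lessThan_Suc_atMost)
  finally show ?thesis .
qed

section \<open>Tail bound for the product random sup measure\<close>

lemma is_borel_space_cong:
  assumes "sets \<mu> = sets \<nu>"
  shows "is_borel_space \<mu> \<longleftrightarrow> is_borel_space \<nu>"
  using sets_eq_imp_space_eq[OF assms] unfolding is_borel_space_def
  by (simp add: measurable_cong_sets[OF assms refl] measurable_cong_sets[OF refl assms])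

text \<open>All off-diagonal notions depend on the \<open>\<sigma>\<close>-algebra only, so they are shared by \<open>\<mu>\<close> and its restrictions.\<close>

lemma offdiag_cong:
  assumes "sets \<mu> = sets \<nu>"
  shows "offdiag \<mu> k = offdiag \<nu> k" "offdiag_sets \<mu> k = offdiag_sets \<nu> k"
    "rects_within \<mu> k E = rects_within \<nu> k E" "rect_ring \<mu> k E = rect_ring \<nu> k E"
    "offdiag_rects \<mu> k = offdiag_rects \<nu> k"
proof -
  have s: "sets (power_measure \<mu> k) = sets (power_measure \<nu> k)"
    using assms by (intro sets_PiM_cong) auto
  show 1: "offdiag \<mu> k = offdiag \<nu> k"
    unfolding offdiag_def diagonal_def sets_eq_imp_space_eq[OF s] ..
  show "offdiag_sets \<mu> k = offdiag_sets \<nu> k" unfolding offdiag_sets_def 1 s ..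
  show 2: "rects_within \<mu> k E = rects_within \<nu> k E" unfolding rects_within_def assms ..
  show "rect_ring \<mu> k E = rect_ring \<nu> k E" unfolding rect_ring_def 2 ..
  show "offdiag_rects \<mu> k = offdiag_rects \<nu> k" unfolding offdiag_rects_def assms ..
qed

lemma rects_within_offdiag_rects: "rects_within \<mu> k E \<subseteq> offdiag_rects \<mu> k"
  unfolding rects_within_def offdiag_rects_def by blast

lemma rects_within_offdiag: "R \<in> rects_within \<mu> k E \<Longrightarrow> R \<subseteq> offdiag \<mu> k"
proof
  fix u assume "R \<in> rects_within \<mu> k E" "u \<in> R"
  then obtain A where A: "\<And>i. i < k \<Longrightarrow> A i \<in> sets \<mu>" "disjoint_family_on A {..<k}"
    "u \<in> Pi\<^sub>E {..<k} A" unfolding rects_within_def by blast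
  have "u \<in> space (power_measure \<mu> k)"
    using A(1,3) sets.sets_into_space unfolding space_PiM PiE_iff by blast
  moreover have "u i \<noteq> u j" if "i < k" "j < k" "i \<noteq> j" for i j
    using A(2,3) that unfolding disjoint_family_on_def PiE_iff by (metis disjoint_iff lessThan_iff)
  ultimately show "u \<in> offdiag \<mu> k" by (auto simp: offdiag_def diagonal_def)
qed

locale frechet_field = prob_space P + sigma_finite_measure \<mu>
  for P :: "'w measure" and \<mu> :: "'a measure" +
  fixes \<alpha> :: real and M :: "'a set \<Rightarrow> 'w \<Rightarrow> ennreal"
  assumes alpha: "0 < \<alpha>" and frechet: "frechet_sup_measure P \<mu> \<alpha> M"
begin

lemma M_measurable: "A \<in> sets \<mu> \<Longrightarrow> M A \<in> borel_measurable P"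
  using frechet by (auto simp: frechet_sup_measure_def)

lemma M_indep:
  fixes n :: nat
  shows "(\<And>i. i < n \<Longrightarrow> A i \<in> sets \<mu>) \<Longrightarrow> disjoint_family_on A {..<n} \<Longrightarrow>
    indep_vars (\<lambda>_. borel) (\<lambda>i. M (A i)) {..<n}"
  using frechet by (auto simp: frechet_sup_measure_def)

lemma M_tail:
  assumes A: "A \<in> sets \<mu>" "emeasure \<mu> A < \<infinity>" and x: "0 < x"
  shows "prob {\<omega>\<in>space P. ennreal x < M A \<omega>} \<le> measure \<mu> A * x powr (- \<alpha>)"
proof -
  note [measurable] = M_measurable[OF A(1)]
  let ?t = "measure \<mu> A * x powr (- \<alpha>)"
  have "{\<omega>\<in>space P. ennreal x < M A \<omega>} = space P - {\<omega>\<in>space P. M A \<omega> \<le> ennreal x}" by auto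
  then have "prob {\<omega>\<in>space P. ennreal x < M A \<omega>} = 1 - prob {\<omega>\<in>space P. M A \<omega> \<le> ennreal x}"
    by (simp add: prob_compl)
  also have "prob {\<omega>\<in>space P. M A \<omega> \<le> ennreal x} = exp (- ?t)"
    using frechet A x unfolding frechet_sup_measure_def by auto
  also have "1 - exp (- ?t) \<le> ?t" using exp_ge_add_one_self[of "- ?t"] by simp
  finally show ?thesis .
qed

text \<open>Apply countable maxitivity to \<open>A, B, B, \<dots>\<close>, whose union is \<open>B\<close>.\<close>

lemma M_mono:
  assumes A: "A \<in> sets \<mu>" "B \<in> sets \<mu>" "A \<subseteq> B"
  shows "AE \<omega> in P. M A \<omega> \<le> M B \<omega>"
proof -
  define C where "C j = (if j = 0 then A else B)" for j :: nat
  have C: "C j \<in> sets \<mu>" for j using A by (simp add: C_def)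
  have "C 0 = A" "C 1 = B" by (simp_all add: C_def)
  moreover have "(\<Union>j. C j) = B" using A(3) by (auto simp: C_def split: if_splits)
  moreover have "AE \<omega> in P. M (\<Union>j. C j) \<omega> = (SUP j. M (C j) \<omega>)"
    using frechet C unfolding frechet_sup_measure_def by blast
  ultimately show ?thesis
    by (auto elim!: eventually_mono) (metis SUP_upper UNIV_I)
qed

end

text \<open>The product random sup measure of \<open>M(\<cdot> \<inter> F)\<close> for a set \<open>F\<close> of finite control measure: the building block of
  the \<open>\<sigma>\<close>-finite construction.\<close>

locale truncated_product = frechet_field P \<mu> \<alpha> M
  for P :: "'w measure" and \<mu> :: "'a measure" and \<alpha> :: real and M :: "'a set \<Rightarrow> 'w \<Rightarrow> ennreal" +
  fixes k :: nat and F :: "'a set" and N :: "(nat \<Rightarrow> 'a) set \<Rightarrow> 'w \<Rightarrow> ennreal"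
  assumes bs: "is_borel_space \<mu>" and k: "0 < k"
    and F: "F \<in> sets \<mu>" "emeasure \<mu> F < \<infinity>"
    and N: "finite_product_sup_measure P (density \<mu> (indicator F)) \<alpha> (\<lambda>A. M (A \<inter> F)) k N"
begin

abbreviation "\<nu> \<equiv> density \<mu> (indicator F)"

lemma sets_nu: "sets \<nu> = sets \<mu>" by simp

lemma emeasure_nu: "A \<in> sets \<mu> \<Longrightarrow> emeasure \<nu> A = emeasure \<mu> (A \<inter> F)"
proof -
  assume A: "A \<in> sets \<mu>"
  have "emeasure \<nu> A = (\<integral>\<^sup>+x. indicator F x * indicator A x \<partial>\<mu>)"
    using A F(1) by (intro emeasure_density) auto
  also have "\<dots> = (\<integral>\<^sup>+x. indicator (A \<inter> F) x \<partial>\<mu>)"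
    by (intro nn_integral_cong) (auto simp: indicator_def)
  also have "\<dots> = emeasure \<mu> (A \<inter> F)" using A F(1) by (intro nn_integral_indicator) auto
  finally show ?thesis .
qed

lemma finite_nu: "finite_measure \<nu>"
proof (rule finite_measureI)
  have "emeasure \<nu> (space \<mu>) = emeasure \<mu> F"
    unfolding emeasure_nu[OF sets.top] Int_absorb1[OF sets.sets_into_space[OF F(1)]] ..
  then show "emeasure \<nu> (space \<nu>) \<noteq> \<infinity>" using F(2) by (simp only: space_density)
qed

lemma sigma_finite_nu: "sigma_finite_measure \<nu>"
  using finite_nu by (rule finite_measure.axioms(1))

sublocale nu: product_sigma_finite "\<lambda>_ :: nat. \<nu>"
  by (rule product_sigma_finite.intro) (rule sigma_finite_nu)

lemma finite_power_nu: "emeasure (power_measure \<nu> k) (space (power_measure \<nu> k)) \<noteq> \<infinity>"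
proof -
  have "emeasure (power_measure \<nu> k) (Pi\<^sub>E {..<k} (\<lambda>_. space \<nu>)) = (\<Prod>i<k. emeasure \<nu> (space \<nu>))"
    by (rule nu.emeasure_PiM) auto
  then show ?thesis using finite_measure.emeasure_finite[OF finite_nu, of "space \<nu>"]
    by (simp add: space_PiM power_eq_top_ennreal)
qed

lemma sets_power_nu: "sets (power_measure \<nu> k) = sets (power_measure \<mu> k)"
  by (intro sets_PiM_cong) auto

lemmas cong_nu = offdiag_cong[OF sets_nu] is_borel_space_cong[OF sets_nu]

lemma power_nu: "power_measure \<nu> k = density (power_measure \<mu> k) (\<lambda>u. \<Prod>i<k. indicator F (u i))"
proof (rule PiM_density)
  show "sigma_finite_measure \<mu>" by (rule sigma_finite_measure_axioms)
  show "sigma_finite_measure \<nu>" by (rule sigma_finite_nu)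
qed (use F(1) in auto)

lemma N_measurable: "A \<in> offdiag_sets \<mu> k \<Longrightarrow> N A \<in> borel_measurable P"
  using N unfolding finite_product_sup_measure_def cong_nu by blast

lemma N_rect:
  assumes "\<And>i. i < k \<Longrightarrow> A i \<in> sets \<mu>" "disjoint_family_on A {..<k}"
  shows "AE \<omega> in P. N (Pi\<^sub>E {..<k} A) \<omega> = (\<Prod>i<k. M (A i \<inter> F) \<omega>)"
proof -
  have "\<forall>A. (\<forall>i<k. A i \<in> sets \<mu>) \<longrightarrow> disjoint_family_on A {..<k} \<longrightarrow>
        (AE \<omega> in P. N (Pi\<^sub>E {..<k} A) \<omega> = (\<Prod>i<k. M (A i \<inter> F) \<omega>))"
    using N unfolding finite_product_sup_measure_def sets_nu by (elim conjE)
  with assms show ?thesis by simp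
qed

lemma N_Union:
  assumes C: "C \<subseteq> rects_within \<mu> k E" "finite C"
  shows "AE \<omega> in P. N (\<Union>C) \<omega> = (SUP R\<in>C. N R \<omega>)"
proof -
  obtain n and B :: "nat \<Rightarrow> (nat \<Rightarrow> 'a) set" where B: "C = B ` {..<n}"
    using ex_bij_betw_nat_finite[OF C(2)] by (metis bij_betw_imp_surj_on lessThan_atLeast0)
  have "\<forall>i<n. B i \<in> offdiag_rects \<nu> k"
    unfolding cong_nu using C(1)[unfolded B] rects_within_offdiag_rects by fast
  then have "AE \<omega> in P. N (\<Union>i<n. B i) \<omega> = (SUP i\<in>{..<n}. N (B i) \<omega>)"
    using N unfolding finite_product_sup_measure_def by blast
  then show ?thesis unfolding B image_image .
qed

lemma rects_within_offdiag_sets: "rects_within \<mu> k E \<subseteq> offdiag_sets \<mu> k"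
proof
  fix R assume R: "R \<in> rects_within \<mu> k E"
  show "R \<in> offdiag_sets \<mu> k"
    unfolding offdiag_sets_iff[OF k bs]
    using subsetD[OF rects_within_measurable R] rects_within_offdiag[OF R] by (rule conjI)
qed

lemma rect_ring_offdiag_sets: "rect_ring \<mu> k E \<subseteq> offdiag_sets \<mu> k"
proof
  fix S assume S: "S \<in> rect_ring \<mu> k E"
  then obtain C where C: "S = \<Union>C" "C \<subseteq> rects_within \<mu> k E" unfolding rect_ring_def by blast
  have "S \<subseteq> offdiag \<mu> k"
    unfolding C(1) using C(2) by (intro Union_least rects_within_offdiag) (rule subsetD)
  then show "S \<in> offdiag_sets \<mu> k"
    unfolding offdiag_sets_iff[OF k bs] using subsetD[OF rect_ring_measurable S] by (intro conjI)
qed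

lemma N_limit:
  assumes A: "A \<in> offdiag_sets \<mu> k" and S: "\<And>n. S n \<in> rect_ring \<mu> k E"
    and lim: "(\<lambda>n. emeasure (power_measure \<nu> k) (sym_diff (S n) A)) \<longlonglongrightarrow> 0" and d: "0 < \<delta>"
  shows "(\<lambda>n. emeasure P {\<omega>\<in>space P. ennreal \<delta> < ennreal_dist (N (S n) \<omega>) (N A \<omega>)}) \<longlonglongrightarrow> 0"
proof (rule tendsto_in_Lp_imp_prob[where p="\<alpha>/2"])
  have "S n \<in> offdiag_rect_unions \<nu> k" for n
  proof -
    obtain C where "S n = \<Union>C" "C \<subseteq> rects_within \<mu> k E" "finite C"
      using S[of n] unfolding rect_ring_def by blast
    moreover from this(2) have "C \<subseteq> offdiag_rects \<nu> k"
      unfolding cong_nu using rects_within_offdiag_rects by (rule subset_trans)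
    ultimately show ?thesis unfolding offdiag_rect_unions_def by blast
  qed
  then have "\<forall>\<gamma>. 0 < \<gamma> \<and> \<gamma> < \<alpha> \<longrightarrow> tendsto_in_Lp P \<gamma> (\<lambda>n. N (S n)) (N A)"
    using N[unfolded finite_product_sup_measure_def cong_nu, THEN conjunct2, THEN conjunct2, THEN conjunct2]
      A lim by simp
  then show "tendsto_in_Lp P (\<alpha>/2) (\<lambda>n. N (S n)) (N A)" using alpha by simp
  show "N (S n) \<in> borel_measurable P" for n
    by (rule N_measurable[OF subsetD[OF rect_ring_offdiag_sets S]])
  show "N A \<in> borel_measurable P" by (rule N_measurable[OF A])
qed (use alpha d in auto)

lemma rect_tail:
  assumes a: "0 < a" and E: "\<And>i. i < k \<Longrightarrow> E i \<in> sets \<mu>" and K: "\<And>i. i < k \<Longrightarrow> 0 < K i"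
    and R: "R \<in> rects_within \<mu> k E"
  shows "emeasure P {\<omega>\<in>space P. 1 < ennreal a * N R \<omega> \<and> (\<forall>i<k. M (E i) \<omega> \<le> ennreal (K i))}
    \<le> ennreal (log_factor \<alpha> k K a) * emeasure (power_measure \<nu> k) R"
proof -
  obtain A where RA: "R = Pi\<^sub>E {..<k} A" and A: "\<And>i. i < k \<Longrightarrow> A i \<in> sets \<mu>" "\<And>i. i < k \<Longrightarrow> A i \<subseteq> E i"
    and disj: "disjoint_family_on A {..<k}"
    using R unfolding rects_within_def by blast
  have AF: "A i \<inter> F \<in> sets \<mu>" if "i < k" for i using A(1)[OF that] F(1) by blast
  have AFfin: "emeasure \<mu> (A i \<inter> F) < \<infinity>" if "i < k" for i
    using emeasure_mono[of "A i \<inter> F" F \<mu>] F by (simp add: le_less_trans)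
  have NR: "AE \<omega> in P. N (Pi\<^sub>E {..<k} A) \<omega> = (\<Prod>i<k. M (A i \<inter> F) \<omega>)"
    by (rule N_rect[OF _ disj]) (rule A(1))
  let ?B = "{\<omega>\<in>space P. 1 < ennreal a * (\<Prod>i<k. M (A i \<inter> F) \<omega>) \<and> (\<forall>i<k. M (A i \<inter> F) \<omega> \<le> ennreal (K i))}"
  note [measurable] = M_measurable[OF AF]
  have "AE \<omega> in P. \<forall>i\<in>{..<k}. M (A i \<inter> F) \<omega> \<le> M (E i) \<omega>"
    using AF E A(2) by (intro AE_finite_allI M_mono) auto
  then have "emeasure P {\<omega>\<in>space P. 1 < ennreal a * N R \<omega> \<and> (\<forall>i<k. M (E i) \<omega> \<le> ennreal (K i))} \<le> emeasure P ?B"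
  proof (intro emeasure_mono_AE)
    assume le: "AE \<omega> in P. \<forall>i\<in>{..<k}. M (A i \<inter> F) \<omega> \<le> M (E i) \<omega>"
    show "AE \<omega> in P. \<omega> \<in> {\<omega>\<in>space P. 1 < ennreal a * N R \<omega> \<and> (\<forall>i<k. M (E i) \<omega> \<le> ennreal (K i))} \<longrightarrow> \<omega> \<in> ?B"
      using NR le unfolding RA
    proof eventually_elim
      case (elim \<omega>)
      have "M (A i \<inter> F) \<omega> \<le> ennreal (K i)" if "i < k" "M (E i) \<omega> \<le> ennreal (K i)" for i
        using elim(2) that by (meson lessThan_iff order_trans)
      then show ?case using elim(1) by simp
    qed
    show "?B \<in> sets P" by measurable
  qed
  also have "\<dots> = ennreal (prob ?B)" by (rule emeasure_eq_measure)
  also have "\<dots> \<le> ennreal (log_factor \<alpha> k K a * (\<Prod>i<k. measure \<mu> (A i \<inter> F)))"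
  proof (intro ennreal_leI truncated_product_tail alpha a k K)
    show "indep_vars (\<lambda>_. borel) (\<lambda>i. M (A i \<inter> F)) {..<k}"
    proof (rule M_indep)
      show "disjoint_family_on (\<lambda>i. A i \<inter> F) {..<k}"
        using disj unfolding disjoint_family_on_def by blast
    qed (rule AF)
  qed (use AF AFfin M_tail in auto)
  also have "\<dots> = ennreal (log_factor \<alpha> k K a) * (\<Prod>i<k. emeasure \<nu> (A i))"
  proof -
    have "(\<Prod>i<k. emeasure \<nu> (A i)) = (\<Prod>i<k. ennreal (measure \<mu> (A i \<inter> F)))"
    proof (rule prod.cong[OF refl])
      fix i assume "i \<in> {..<k}"
      then have i: "i < k" by simp
      show "emeasure \<nu> (A i) = ennreal (measure \<mu> (A i \<inter> F))"
        unfolding emeasure_nu[OF A(1)[OF i]] using AFfin[OF i]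
        by (intro emeasure_eq_ennreal_measure) simp
    qed
    then show ?thesis by (simp add: prod_ennreal ennreal_mult' log_factor_nonneg)
  qed
  also have "(\<Prod>i<k. emeasure \<nu> (A i)) = emeasure (power_measure \<nu> k) R"
    unfolding RA using A(1) by (subst nu.emeasure_PiM) auto
  finally show ?thesis .
qed

text \<open>On a disjoint union of rectangles the product sup measure is the maximum over the rectangles, while their
  measures add up: the union bound loses nothing in the measure.\<close>

lemma ring_tail:
  assumes a: "0 < a" and E: "\<And>i. i < k \<Longrightarrow> E i \<in> sets \<mu>" and K: "\<And>i. i < k \<Longrightarrow> 0 < K i"
    and S: "S \<in> rect_ring \<mu> k E"
  shows "emeasure P {\<omega>\<in>space P. 1 < ennreal a * N S \<omega> \<and> (\<forall>i<k. M (E i) \<omega> \<le> ennreal (K i))}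
    \<le> ennreal (log_factor \<alpha> k K a) * emeasure (power_measure \<nu> k) S"
proof -
  obtain C where C: "S = \<Union>C" "C \<subseteq> rects_within \<mu> k E" "finite C" "disjoint C"
    using S unfolding rect_ring_def by blast
  let ?B = "\<lambda>R. {\<omega>\<in>space P. 1 < ennreal a * N R \<omega> \<and> (\<forall>i<k. M (E i) \<omega> \<le> ennreal (K i))}"
  have [measurable]: "M (E i) \<in> borel_measurable P" if "i < k" for i using M_measurable E that by blast
  have B: "?B R \<in> sets P" if R: "R \<in> C" for R
  proof -
    have [measurable]: "N R \<in> borel_measurable P"
      by (rule N_measurable[OF subsetD[OF rects_within_offdiag_sets subsetD[OF C(2) R]]])
    show ?thesis by measurable
  qed
  have "emeasure P (?B S) \<le> emeasure P (\<Union>R\<in>C. ?B R)"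
  proof (rule emeasure_mono_AE)
    show "AE \<omega> in P. \<omega> \<in> ?B S \<longrightarrow> \<omega> \<in> (\<Union>R\<in>C. ?B R)"
      using N_Union[OF C(2,3)]
    proof eventually_elim
      case (elim \<omega>)
      show ?case
      proof
        assume w: "\<omega> \<in> ?B S"
        then have "1 < (SUP R\<in>C. ennreal a * N R \<omega>)"
          using elim C(1) by (cases "C = {}") (auto simp: SUP_mult_left_ennreal bot_ennreal)
        then obtain R where "R \<in> C" "1 < ennreal a * N R \<omega>" by (auto simp: less_SUP_iff)
        then show "\<omega> \<in> (\<Union>R\<in>C. ?B R)" using w by auto
      qed
    qed
    show "(\<Union>R\<in>C. ?B R) \<in> sets P" using B C(3) by auto
  qed
  also have "\<dots> \<le> (\<Sum>R\<in>C. emeasure P (?B R))"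
    using B C(3) by (intro emeasure_subadditive_finite) auto
  also have "\<dots> \<le> (\<Sum>R\<in>C. ennreal (log_factor \<alpha> k K a) * emeasure (power_measure \<nu> k) R)"
    using C(2) by (intro sum_mono rect_tail a E K) auto
  also have "\<dots> = ennreal (log_factor \<alpha> k K a) * (\<Sum>R\<in>C. emeasure (power_measure \<nu> k) R)"
    by (rule sum_distrib_left[symmetric])
  also have "(\<Sum>R\<in>C. emeasure (power_measure \<nu> k) R) = emeasure (power_measure \<nu> k) (\<Union>R\<in>C. R)"
  proof (rule sum_emeasure)
    show "(\<lambda>R. R) ` C \<subseteq> sets (power_measure \<nu> k)"
      using C(2) rects_within_measurable unfolding sets_power_nu by fastforce
    show "disjoint_family_on (\<lambda>R. R) C" using C(4) by (auto simp: disjoint_def disjoint_family_on_def)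
  qed (rule C(3))
  finally show ?thesis using C(1) by simp
qed

text \<open>Approximate \<open>A\<close> by members \<open>S n\<close> of the ring inside the same box. If \<open>N A > 1 / a\<close>, then either
  \<open>N (S n) > 1 / (2 * a)\<close>, which the preceding bound covers with \<open>2 * a\<close> for \<open>a\<close>, or \<open>N (S n)\<close> is far from \<open>N A\<close>,
  which has vanishing probability.\<close>

lemma set_tail:
  assumes a: "0 < a" and E: "\<And>i. i < k \<Longrightarrow> E i \<in> sets \<mu>" and K: "\<And>i. i < k \<Longrightarrow> 0 < K i"
    and A: "A \<in> offdiag_sets \<mu> k" "A \<subseteq> Pi\<^sub>E {..<k} E"
  shows "emeasure P {\<omega>\<in>space P. 1 < ennreal a * N A \<omega> \<and> (\<forall>i<k. M (E i) \<omega> \<le> ennreal (K i))}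
    \<le> ennreal (log_factor \<alpha> k K (2 * a)) * emeasure (power_measure \<nu> k) A"
proof -
  let ?N = "power_measure \<nu> k" and ?c = "ennreal (log_factor \<alpha> k K (2 * a))"
  let ?B = "\<lambda>a R. {\<omega>\<in>space P. 1 < ennreal a * N R \<omega> \<and> (\<forall>i<k. M (E i) \<omega> \<le> ennreal (K i))}"
  obtain S where S: "\<And>n. S n \<in> rect_ring \<mu> k E" "(\<lambda>n. emeasure ?N (sym_diff (S n) A)) \<longlonglongrightarrow> 0"
    using rect_ring_approximation[of k \<nu> E A] k bs finite_power_nu E A unfolding cong_nu sets_nu by blast
  \<comment> \<open>Any positive number below the gap \<open>1 / a - 1 / (2 * a)\<close> serves.\<close>
  define \<delta> where "\<delta> = 1 / (4 * a)"
  have d: "0 < \<delta>" using a by (simp add: \<delta>_def)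
  let ?D = "\<lambda>n. {\<omega>\<in>space P. ennreal \<delta> < ennreal_dist (N (S n) \<omega>) (N A \<omega>)}"
  have SA: "S n \<in> offdiag_sets \<mu> k" for n by (rule subsetD[OF rect_ring_offdiag_sets S(1)])
  have [measurable]: "M (E i) \<in> borel_measurable P" if "i < k" for i using M_measurable E that by blast
  have [measurable]: "N A \<in> borel_measurable P" "N (S n) \<in> borel_measurable P" for n
    by (rule N_measurable[OF A(1)], rule N_measurable[OF SA])
  have AN: "A \<in> sets ?N" "S n \<in> sets ?N" for n
    using A(1) SA[of n] unfolding sets_power_nu offdiag_sets_iff[OF k bs] by simp_all
  have "emeasure P (?B a A) \<le> ?c * (emeasure ?N A + emeasure ?N (sym_diff (S n) A)) + emeasure P (?D n)" for n
  proof -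
    have "?B a A \<subseteq> ?B (2 * a) (S n) \<union> ?D n"
    proof
      fix \<omega> assume w: "\<omega> \<in> ?B a A"
      show "\<omega> \<in> ?B (2 * a) (S n) \<union> ?D n"
      proof (rule ccontr)
        assume n: "\<omega> \<notin> ?B (2 * a) (S n) \<union> ?D n"
        have "ennreal (2 * a) * N (S n) \<omega> \<le> 1" using n w by (auto simp: not_less)
        then have "ennreal (1 / (2 * a)) * (ennreal (2 * a) * N (S n) \<omega>) \<le> ennreal (1 / (2 * a)) * 1"
          by (rule mult_left_mono) simp
        then have 1: "N (S n) \<omega> \<le> ennreal (1 / (2 * a))"
          using a by (simp add: mult.assoc[symmetric] ennreal_mult'[symmetric])
        have 2: "ennreal (1 / a) < N A \<omega>"
        proof (rule ccontr)
          assume "\<not> ?thesis"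
          then have "ennreal a * N A \<omega> \<le> ennreal a * ennreal (1 / a)"
            by (intro mult_left_mono) (auto simp: not_less)
          then show False using w a by (simp add: ennreal_mult'[symmetric] not_less[symmetric])
        qed
        have "ennreal (1 / a - 1 / (2 * a)) < ennreal_dist (N A \<omega>) (N (S n) \<omega>)"
          using a by (intro less_ennreal_dist 1 2) (auto simp: field_simps)
        moreover have "ennreal \<delta> \<le> ennreal (1 / a - 1 / (2 * a))"
          using a by (intro ennreal_leI) (simp add: \<delta>_def field_simps)
        ultimately have "ennreal \<delta> < ennreal_dist (N (S n) \<omega>) (N A \<omega>)"
          unfolding ennreal_dist_commute[of "N (S n) \<omega>"] by (rule le_less_trans[rotated])
        then show False using n w by simp
      qed
    qed
    then have "emeasure P (?B a A) \<le> emeasure P (?B (2 * a) (S n) \<union> ?D n)"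
      by (rule emeasure_mono) measurable
    also have "\<dots> \<le> emeasure P (?B (2 * a) (S n)) + emeasure P (?D n)"
      by (rule emeasure_subadditive) measurable
    also have "emeasure P (?B (2 * a) (S n)) \<le> ?c * emeasure ?N (S n)"
      using a by (intro ring_tail E K S) auto
    also have "emeasure ?N (S n) \<le> emeasure ?N A + emeasure ?N (sym_diff (S n) A)"
      using emeasure_mono[of "S n" "A \<union> sym_diff (S n) A" ?N] emeasure_subadditive[of A ?N "sym_diff (S n) A"] AN
      by (meson order_trans sets.Un sets.Diff subsetI UnCI DiffI)
    finally show ?thesis by (simp add: add_mono mult_left_mono)
  qed
  then have le: "eventually (\<lambda>n. emeasure P (?B a A) \<le>
      ?c * (emeasure ?N A + emeasure ?N (sym_diff (S n) A)) + emeasure P (?D n)) sequentially"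
    by (rule always_eventually[OF allI])
  have lim: "(\<lambda>n. ?c * (emeasure ?N A + emeasure ?N (sym_diff (S n) A)) + emeasure P (?D n))
      \<longlonglongrightarrow> ?c * (emeasure ?N A + 0) + 0"
    by (intro tendsto_add ennreal_tendsto_cmult tendsto_const S(2) N_limit[OF A(1) S d]) simp
  show ?thesis using tendsto_lowerbound[OF lim le] by simp
qed

end

text \<open>For rectangles this is monotonicity of \<open>M\<close>. One sequence of ring members approximates \<open>A\<close> for both control
  measures, the smaller being dominated by the larger, so the inequality passes to the limits.\<close>

lemma truncated_product_mono:
  assumes 1: "truncated_product P \<mu> \<alpha> M k F N" and 2: "truncated_product P \<mu> \<alpha> M k F' N'"
    and FF: "F \<subseteq> F'" and A: "A \<in> offdiag_sets \<mu> k"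
  shows "AE \<omega> in P. N A \<omega> \<le> N' A \<omega>"
proof -
  interpret t: truncated_product P \<mu> \<alpha> M k F N by (rule 1)
  interpret t': truncated_product P \<mu> \<alpha> M k F' N' by (rule 2)
  let ?E = "\<lambda>_ :: nat. space \<mu>"
  have "A \<subseteq> Pi\<^sub>E {..<k} ?E"
    using A unfolding offdiag_sets_iff[OF t.k t.bs] offdiag_def space_PiM by blast
  then obtain S where S: "\<And>n. S n \<in> rect_ring \<mu> k ?E"
    "(\<lambda>n. emeasure (power_measure t'.\<nu> k) (sym_diff (S n) A)) \<longlonglongrightarrow> 0"
    using rect_ring_approximation[of k t'.\<nu> ?E A] t'.k t'.bs t'.finite_power_nu A
    unfolding t'.cong_nu t'.sets_nu by blast
  have SA: "S n \<in> offdiag_sets \<mu> k" for n by (rule subsetD[OF t.rect_ring_offdiag_sets S(1)])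
  have le: "emeasure (power_measure t.\<nu> k) B \<le> emeasure (power_measure t'.\<nu> k) B"
    if B: "B \<in> sets (power_measure \<mu> k)" for B
  proof -
    have [measurable]: "F \<in> sets \<mu>" "F' \<in> sets \<mu>" "B \<in> sets (power_measure \<mu> k)"
      using t.F t'.F B by auto
    have "(\<Prod>i<k. indicator F (u i)) \<le> ((\<Prod>i<k. indicator F' (u i)) :: ennreal)" for u
      using FF by (intro prod_mono_ennreal) (auto simp: indicator_def)
    then show ?thesis unfolding t.power_nu t'.power_nu
      by (auto simp: emeasure_density intro!: nn_integral_mono mult_right_mono)
  qed
  have SAm: "sym_diff (S n) A \<in> sets (power_measure \<mu> k)" for n
    using A SA[of n] unfolding offdiag_sets_iff[OF t.k t.bs] by (intro sets.Un sets.Diff) simp_all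
  have lim: "(\<lambda>n. emeasure (power_measure t.\<nu> k) (sym_diff (S n) A)) \<longlonglongrightarrow> 0"
    by (rule tendsto_sandwich[OF always_eventually always_eventually tendsto_const S(2)])
      (simp_all add: le SAm)
  have rect: "AE \<omega> in P. N R \<omega> \<le> N' R \<omega>" if R: "R \<in> rects_within \<mu> k ?E" for R
  proof -
    obtain A where RA: "R = Pi\<^sub>E {..<k} A" and A: "\<And>i. i < k \<Longrightarrow> A i \<in> sets \<mu>"
      and disj: "disjoint_family_on A {..<k}"
      using R unfolding rects_within_def by blast
    have "AE \<omega> in P. \<forall>i\<in>{..<k}. M (A i \<inter> F) \<omega> \<le> M (A i \<inter> F') \<omega>"
      using A t.F t'.F FF by (intro AE_finite_allI t.M_mono) auto
    moreover have "AE \<omega> in P. N (Pi\<^sub>E {..<k} A) \<omega> = (\<Prod>i<k. M (A i \<inter> F) \<omega>)"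
      by (rule t.N_rect[OF _ disj]) (rule A)
    moreover have "AE \<omega> in P. N' (Pi\<^sub>E {..<k} A) \<omega> = (\<Prod>i<k. M (A i \<inter> F') \<omega>)"
      by (rule t'.N_rect[OF _ disj]) (rule A)
    ultimately show ?thesis
      unfolding RA
      by eventually_elim (auto intro!: prod_mono_ennreal)
  qed
  have "AE \<omega> in P. N (S n) \<omega> \<le> N' (S n) \<omega>" for n
  proof -
    obtain C where C: "S n = \<Union>C" "C \<subseteq> rects_within \<mu> k ?E" "finite C"
      using S(1)[of n] unfolding rect_ring_def by blast
    have "AE \<omega> in P. \<forall>R\<in>C. N R \<omega> \<le> N' R \<omega>"
      using C rect by (intro AE_finite_allI) auto
    then show ?thesis
      using t.N_Union[OF C(2,3)] t'.N_Union[OF C(2,3)] unfolding C(1)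
    proof eventually_elim
      case (elim \<omega>)
      have "(SUP R\<in>C. N R \<omega>) \<le> (SUP R\<in>C. N' R \<omega>)"
        using elim(1) by (intro SUP_mono) blast
      then show ?case by (simp only: elim)
    qed
  qed
  then show ?thesis
  proof (rule t.AE_le_of_limits_in_probability[OF t.N_measurable[OF SA] t.N_measurable[OF A]
          t'.N_measurable[OF SA] t'.N_measurable[OF A]])
    fix \<delta> :: real assume d: "0 < \<delta>"
    show "(\<lambda>n. emeasure P {\<omega>\<in>space P. ennreal \<delta> < ennreal_dist (N (S n) \<omega>) (N A \<omega>)}) \<longlonglongrightarrow> 0"
      by (rule t.N_limit[OF A S(1) lim d])
    show "(\<lambda>n. emeasure P {\<omega>\<in>space P. ennreal \<delta> < ennreal_dist (N' (S n) \<omega>) (N' A \<omega>)}) \<longlonglongrightarrow> 0"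
      by (rule t'.N_limit[OF A S d])
  qed
qed

locale product_field = frechet_field P \<mu> \<alpha> M
  for P :: "'w measure" and \<mu> :: "'a measure" and \<alpha> :: real and M :: "'a set \<Rightarrow> 'w \<Rightarrow> ennreal" +
  fixes k :: nat and Mk :: "(nat \<Rightarrow> 'a) set \<Rightarrow> 'w \<Rightarrow> ennreal"
  assumes bs: "is_borel_space \<mu>" and k: "0 < k"
    and Mk: "product_sup_measure P \<mu> \<alpha> M k Mk"
begin

lemma Mk_measurable: "A \<in> offdiag_sets \<mu> k \<Longrightarrow> Mk A \<in> borel_measurable P"
  using Mk unfolding product_sup_measure_def by blast

text \<open>By monotonicity in \<open>n\<close> the supremum defining \<open>Mk A\<close> is an increasing limit of the truncated products, so their
  uniform bound survives; the restricted powers are dominated by \<open>\<mu>\<^sup>k\<close>.\<close>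

lemma Mk_tail:
  assumes a: "0 < a" and E: "\<And>i. i < k \<Longrightarrow> E i \<in> sets \<mu>" and K: "\<And>i. i < k \<Longrightarrow> 0 < K i"
    and A: "A \<in> offdiag_sets \<mu> k" "A \<subseteq> Pi\<^sub>E {..<k} E"
  shows "emeasure P {\<omega>\<in>space P. 1 < ennreal a * Mk A \<omega> \<and> (\<forall>i<k. M (E i) \<omega> \<le> ennreal (K i))}
    \<le> ennreal (log_factor \<alpha> k K (2 * a)) * emeasure (power_measure \<mu> k) A"
proof -
  obtain F :: "nat \<Rightarrow> 'a set" and N where
    F': "\<forall>n. F n \<in> sets \<mu> \<and> 0 < emeasure \<mu> (F n) \<and> emeasure \<mu> (F n) < \<infinity>" and "incseq F"
    and N': "\<forall>n. finite_product_sup_measure P (density \<mu> (indicator (F n))) \<alpha> (\<lambda>A. M (A \<inter> F n)) k (N n)"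
    and sup': "\<forall>A\<in>offdiag_sets \<mu> k. AE \<omega> in P. Mk A \<omega> = (SUP n. N n A \<omega>)"
    using Mk[unfolded product_sup_measure_def, THEN conjunct2] by (elim exE conjE)
  have F: "\<And>n. F n \<in> sets \<mu>" "\<And>n. emeasure \<mu> (F n) < \<infinity>" "incseq F"
    using F' \<open>incseq F\<close> by simp_all
  have N: "finite_product_sup_measure P (density \<mu> (indicator (F n))) \<alpha> (\<lambda>A. M (A \<inter> F n)) k (N n)" for n
    using N' by (rule spec)
  have sup: "AE \<omega> in P. Mk A \<omega> = (SUP n. N n A \<omega>)" using sup' A(1) by (rule bspec)
  have t: "truncated_product P \<mu> \<alpha> M k (F n) (N n)" for n
    by (intro truncated_product.intro frechet_field_axioms truncated_product_axioms.intro bs k F N)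
  let ?c = "ennreal (log_factor \<alpha> k K (2 * a))"
  let ?B = "\<lambda>X. {\<omega>\<in>space P. 1 < ennreal a * X \<omega> \<and> (\<forall>i<k. M (E i) \<omega> \<le> ennreal (K i))}"
  have [measurable]: "M (E i) \<in> borel_measurable P" if "i < k" for i by (rule M_measurable[OF E[OF that]])
  have [measurable]: "N n A \<in> borel_measurable P" for n
    by (rule truncated_product.N_measurable[OF t A(1)])
  have bound: "emeasure P (?B (N n A)) \<le> ?c * emeasure (power_measure \<mu> k) A" for n
  proof -
    interpret t: truncated_product P \<mu> \<alpha> M k "F n" "N n" by (rule t)
    have A': "A \<in> sets (power_measure \<mu> k)" using A(1) unfolding offdiag_sets_iff[OF k bs] by simp
    have [measurable]: "F n \<in> sets \<mu>" by (rule F)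
    have "emeasure (power_measure t.\<nu> k) A =
        (\<integral>\<^sup>+u. (\<Prod>i<k. indicator (F n) (u i)) * indicator A u \<partial>power_measure \<mu> k)"
      unfolding t.power_nu using A' by (intro emeasure_density) measurable
    also have "\<dots> \<le> (\<integral>\<^sup>+u. indicator A u \<partial>power_measure \<mu> k)"
    proof (rule nn_integral_mono)
      fix u
      have "(\<Prod>i<k. indicator (F n) (u i)) \<le> (\<Prod>i<k. 1 :: ennreal)"
        by (intro prod_mono_ennreal) (simp add: indicator_def)
      then show "(\<Prod>i<k. indicator (F n) (u i)) * indicator A u \<le> (indicator A u :: ennreal)"
        by (auto simp: indicator_def)
    qed
    also have "\<dots> = emeasure (power_measure \<mu> k) A" using A' by simp
    finally have le: "emeasure (power_measure t.\<nu> k) A \<le> emeasure (power_measure \<mu> k) A" .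
    have "emeasure P (?B (N n A)) \<le> ?c * emeasure (power_measure t.\<nu> k) A"
      by (rule t.set_tail[OF a E K A])
    also have "\<dots> \<le> ?c * emeasure (power_measure \<mu> k) A" using le by (rule mult_left_mono) simp
    finally show ?thesis .
  qed
  \<comment> \<open>The monotonicity in \<open>n\<close> holds almost surely only; finite unions make the events increase everywhere.\<close>
  define U where "U n = (\<Union>j\<le>n. ?B (N j A))" for n
  have [measurable]: "U n \<in> sets P" for n unfolding U_def by measurable
  have "emeasure P (U n) \<le> emeasure P (?B (N n A))" for n
  proof (rule emeasure_mono_AE)
    have "AE \<omega> in P. \<forall>j\<in>{..n}. N j A \<omega> \<le> N n A \<omega>"
    proof (rule AE_finite_allI)
      fix j assume "j \<in> {..n}"
      then have "F j \<subseteq> F n" using F(3) by (simp add: incseq_def)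
      then show "AE \<omega> in P. N j A \<omega> \<le> N n A \<omega>" by (rule truncated_product_mono[OF t t _ A(1)])
    qed simp
    then show "AE \<omega> in P. \<omega> \<in> U n \<longrightarrow> \<omega> \<in> ?B (N n A)"
    proof eventually_elim
      case (elim \<omega>)
      show ?case
      proof
        assume "\<omega> \<in> U n"
        then obtain j where j: "j \<le> n" "\<omega> \<in> ?B (N j A)" unfolding U_def by blast
        have "ennreal a * N j A \<omega> \<le> ennreal a * N n A \<omega>"
          using elim j(1) by (intro mult_left_mono) auto
        then show "\<omega> \<in> ?B (N n A)" using j(2) by (auto intro: less_le_trans)
      qed
    qed
  qed measurable
  then have U: "emeasure P (U n) \<le> ?c * emeasure (power_measure \<mu> k) A" for n
    using bound by (rule order_trans)
  have "emeasure P (?B (Mk A)) \<le> emeasure P (\<Union>n. U n)"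
  proof (rule emeasure_mono_AE)
    show "AE \<omega> in P. \<omega> \<in> ?B (Mk A) \<longrightarrow> \<omega> \<in> (\<Union>n. U n)"
      using sup
    proof eventually_elim
      case (elim \<omega>)
      show ?case
      proof
        assume w: "\<omega> \<in> ?B (Mk A)"
        then have "1 < (SUP n. ennreal a * N n A \<omega>)"
          by (simp add: elim SUP_mult_left_ennreal)
        then obtain n where "1 < ennreal a * N n A \<omega>" unfolding less_SUP_iff by blast
        then have "\<omega> \<in> U n" using w unfolding U_def by blast
        then show "\<omega> \<in> (\<Union>n. U n)" by blast
      qed
    qed
  qed measurable
  also have "\<dots> = (SUP n. emeasure P (U n))"
    by (rule SUP_emeasure_incseq[symmetric]) (auto simp: incseq_def U_def intro: order_trans)
  also have "\<dots> \<le> ?c * emeasure (power_measure \<mu> k) A" by (rule SUP_least) (rule U)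
  finally show ?thesis .
qed

end

section \<open>The multiple extremal integral\<close>

lemma increasing_simple_approximation:
  assumes h: "h \<in> borel_measurable N"
  obtains s :: "nat \<Rightarrow> 'b \<Rightarrow> ennreal" where
    "\<And>n. simple_function N (s n)" "\<And>n x. s n x < \<infinity>" "\<And>n x. s n x \<le> h x"
    "\<And>m n x. m \<le> n \<Longrightarrow> s m x \<le> s n x" "\<And>x. (\<lambda>n. s n x) \<longlonglongrightarrow> h x"
proof -
  obtain s :: "nat \<Rightarrow> 'b \<Rightarrow> ennreal" where s: "\<And>n. simple_function N (s n)" "incseq s"
    "\<And>n x. s n x < top" "\<And>x. (SUP n. s n x) = h x"
    using borel_measurable_implies_simple_function_sequence'[OF h] by blast
  have inc: "m \<le> n \<Longrightarrow> s m x \<le> s n x" for m n x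
    using s(2) unfolding incseq_def le_fun_def by blast
  show thesis
  proof (rule that[of s])
    show "s n x \<le> h x" for n x unfolding s(4)[symmetric] by (rule SUP_upper) simp
    show "(\<lambda>n. s n x) \<longlonglongrightarrow> h x" for x
      unfolding s(4)[symmetric] by (rule LIMSEQ_SUP) (simp add: incseq_def inc)
  qed (use s inc in auto)
qed

locale extremal = product_field P \<mu> \<alpha> M k Mk
  for P :: "'w measure" and \<mu> :: "'a measure" and \<alpha> :: real and M :: "'a set \<Rightarrow> 'w \<Rightarrow> ennreal"
    and k :: nat and Mk :: "(nat \<Rightarrow> 'a) set \<Rightarrow> 'w \<Rightarrow> ennreal" +
  fixes I :: "((nat \<Rightarrow> 'a) \<Rightarrow> ennreal) \<Rightarrow> 'w \<Rightarrow> ennreal"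
  assumes I: "extremal_integral P \<mu> k Mk I"
begin

abbreviation "E\<^sub>k \<equiv> power_measure \<mu> k"

lemma I_measurable: "f \<in> offdiag_funs \<mu> k \<Longrightarrow> I f \<in> borel_measurable P"
  using I unfolding extremal_integral_def by blast

lemma I_limit:
  assumes "f \<in> offdiag_funs \<mu> k" "\<And>n. g n \<in> offdiag_simple \<mu> k"
    "\<And>n x. x \<in> space E\<^sub>k \<Longrightarrow> g n x \<le> g (Suc n) x" "\<And>x. x \<in> space E\<^sub>k \<Longrightarrow> (\<lambda>n. g n x) \<longlonglongrightarrow> f x"
  shows "AE \<omega> in P. (\<lambda>n. I (g n) \<omega>) \<longlonglongrightarrow> I f \<omega>"
  using I[unfolded extremal_integral_def, THEN conjunct2, THEN conjunct2] assms by simp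

text \<open>Reduction to the enumerated form with positive real coefficients: coefficients \<open>0\<close> contribute neither to
  the sum nor to the supremum, as \<open>0 * \<infinity> = 0\<close>.\<close>

lemma I_step:
  assumes J: "finite J" and A: "\<And>j. j \<in> J \<Longrightarrow> A j \<in> offdiag_sets \<mu> k"
    and disj: "disjoint_family_on A J" and c: "\<And>j. j \<in> J \<Longrightarrow> c j < \<infinity>"
  defines "\<sigma> \<equiv> \<lambda>x. \<Sum>j\<in>J. c j * indicator (A j) x"
  shows "\<sigma> \<in> offdiag_simple \<mu> k" "AE \<omega> in P. I \<sigma> \<omega> = (SUP j\<in>J. c j * Mk (A j) \<omega>)"
proof -
  define J' where "J' = {j \<in> J. 0 < c j}"
  have "finite J'" using J by (simp add: J'_def)
  then obtain b n where b: "bij_betw b {..<n :: nat} J'"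
    using ex_bij_betw_nat_finite[of J'] unfolding atLeast0LessThan by blast
  define a B where "a i = enn2real (c (b i))" and "B i = A (b i)" for i
  have bJ: "b i \<in> J" "0 < c (b i)" if "i < n" for i
    using bij_betwE[OF b] that unfolding J'_def by auto
  have ac: "ennreal (a i) = c (b i)" if "i < n" for i
    using c[OF bJ(1)[OF that]] by (simp add: a_def)
  have rep: "simple_rep \<mu> k n a B"
    unfolding simple_rep_def
  proof (intro conjI allI impI)
    fix i assume i: "i < n"
    show "0 < a i" using ac[OF i] bJ(2)[OF i] by (metis ennreal_less_zero_iff)
    show "B i \<in> offdiag_sets \<mu> k" unfolding a_def B_def by (rule A[OF bJ(1)[OF i]])
  next
    show "disjoint_family_on B {..<n}"
      unfolding disjoint_family_on_def
    proof (intro ballI impI)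
      fix i j assume ij: "i \<in> {..<n}" "j \<in> {..<n}" "i \<noteq> j"
      then have "b i \<noteq> b j" using bij_betw_imp_inj_on[OF b] by (simp add: inj_on_eq_iff)
      moreover have "b i \<in> J" "b j \<in> J" using bJ(1) ij by auto
      ultimately show "B i \<inter> B j = {}" using disj unfolding disjoint_family_on_def a_def B_def by blast
    qed
  qed
  have "simple_fun n a B x = \<sigma> x" for x
  proof -
    have "simple_fun n a B x = (\<Sum>i<n. c (b i) * indicator (A (b i)) x)"
      unfolding simple_fun_def by (intro sum.cong refl) (simp add: ac, simp add: a_def B_def)
    also have "\<dots> = (\<Sum>j\<in>J'. c j * indicator (A j) x)" by (rule sum.reindex_bij_betw[OF b])
    also have "\<dots> = \<sigma> x" unfolding \<sigma>_def J'_def using J by (intro sum.mono_neutral_left) auto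
    finally show ?thesis .
  qed
  then have \<sigma>: "\<sigma> = simple_fun n a B" by (intro ext) simp
  show "\<sigma> \<in> offdiag_simple \<mu> k" unfolding \<sigma> offdiag_simple_def using rep by blast
  have "AE \<omega> in P. I (simple_fun n a B) \<omega> = (SUP i\<in>{..<n}. ennreal (a i) * Mk (B i) \<omega>)"
    using I[unfolded extremal_integral_def, THEN conjunct2, THEN conjunct1] rep by blast
  moreover have "(SUP i\<in>{..<n}. ennreal (a i) * Mk (B i) \<omega>) = (SUP j\<in>J. c j * Mk (A j) \<omega>)" for \<omega>
  proof -
    have "(SUP i\<in>{..<n}. ennreal (a i) * Mk (B i) \<omega>) = (SUP i\<in>{..<n}. c (b i) * Mk (A (b i)) \<omega>)"
      by (intro SUP_cong refl) (simp add: ac, simp add: a_def B_def)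
    also have "\<dots> = (SUP j\<in>b ` {..<n}. c j * Mk (A j) \<omega>)" by (simp only: image_image)
    also have "\<dots> = (SUP j\<in>J'. c j * Mk (A j) \<omega>)" by (simp only: bij_betw_imp_surj_on[OF b])
    also have "\<dots> = (SUP j\<in>J. c j * Mk (A j) \<omega>)"
    proof (rule antisym)
      show "(SUP j\<in>J'. c j * Mk (A j) \<omega>) \<le> (SUP j\<in>J. c j * Mk (A j) \<omega>)"
        by (rule SUP_subset_mono) (auto simp: J'_def)
      show "(SUP j\<in>J. c j * Mk (A j) \<omega>) \<le> (SUP j\<in>J'. c j * Mk (A j) \<omega>)"
      proof (rule SUP_least)
        fix j assume j: "j \<in> J"
        show "c j * Mk (A j) \<omega> \<le> (SUP j\<in>J'. c j * Mk (A j) \<omega>)"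
        proof (cases "c j = 0")
          case False
          then have "j \<in> J'" using j by (simp add: J'_def zero_less_iff_neq_zero)
          then show ?thesis by (rule SUP_upper)
        qed simp
      qed
    qed
    finally show ?thesis .
  qed
  ultimately show "AE \<omega> in P. I \<sigma> \<omega> = (SUP j\<in>J. c j * Mk (A j) \<omega>)" unfolding \<sigma> by simp
qed

text \<open>The partition is given by the values of a map \<open>T\<close>; different coefficient functions \<open>c\<close> on the same values
  yield several simple functions over one common partition. Values taken on the diagonal must be left out of \<open>J\<close>.\<close>

lemma I_fibres:
  assumes J: "finite J" and T: "\<And>j. j \<in> J \<Longrightarrow> {u \<in> space E\<^sub>k. T u = j} \<in> sets E\<^sub>k"
    and diag: "\<And>u. u \<in> diagonal \<mu> k \<Longrightarrow> T u \<notin> J" and c: "\<And>j. j \<in> J \<Longrightarrow> c j < \<infinity>"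
  defines "\<sigma> \<equiv> \<lambda>x. \<Sum>j\<in>J. c j * indicator {u \<in> space E\<^sub>k. T u = j} x"
  shows "\<And>j. j \<in> J \<Longrightarrow> {u \<in> space E\<^sub>k. T u = j} \<in> offdiag_sets \<mu> k"
    and "\<And>x. x \<in> space E\<^sub>k \<Longrightarrow> \<sigma> x = (if T x \<in> J then c (T x) else 0)"
    and "\<sigma> \<in> offdiag_simple \<mu> k"
    and "AE \<omega> in P. I \<sigma> \<omega> = (SUP j\<in>J. c j * Mk {u \<in> space E\<^sub>k. T u = j} \<omega>)"
proof -
  show off: "{u \<in> space E\<^sub>k. T u = j} \<in> offdiag_sets \<mu> k" if j: "j \<in> J" for j
  proof -
    have "{u \<in> space E\<^sub>k. T u = j} \<subseteq> offdiag \<mu> k"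
      unfolding offdiag_def using diag j by blast
    then show ?thesis unfolding offdiag_sets_iff[OF k bs] using T[OF j] by simp
  qed
  show "\<sigma> x = (if T x \<in> J then c (T x) else 0)" if x: "x \<in> space E\<^sub>k" for x
  proof -
    have "\<sigma> x = (\<Sum>j\<in>J. if T x = j then c j else 0)"
      unfolding \<sigma>_def using x by (intro sum.cong) (auto simp: indicator_def)
    also have "\<dots> = (if T x \<in> J then c (T x) else 0)" using J by (simp add: sum.delta')
    finally show ?thesis .
  qed
  have disj: "disjoint_family_on (\<lambda>j. {u \<in> space E\<^sub>k. T u = j}) J" by (auto simp: disjoint_family_on_def)
  show "\<sigma> \<in> offdiag_simple \<mu> k" "AE \<omega> in P. I \<sigma> \<omega> = (SUP j\<in>J. c j * Mk {u \<in> space E\<^sub>k. T u = j} \<omega>)"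
    unfolding \<sigma>_def by (rule I_step[OF J off disj c], assumption+)+
qed

text \<open>Choose increasing simple approximations of the three functions and cut off that of \<open>f\<close> at the sum of the other
  two; since \<open>f \<le> g + h\<close>, the cut does not change the limit. Over the common partition into level sets of the
  triple, \<open>x \<le> y + z\<close> gives \<open>x * Mk A \<le> y * Mk A + z * Mk A\<close> for each piece \<open>A\<close>, and the maxima obey the
  inequality.\<close>

lemma I_subadditive:
  assumes f: "f \<in> offdiag_funs \<mu> k" and g: "g \<in> offdiag_funs \<mu> k" and h: "h \<in> offdiag_funs \<mu> k"
    and le: "\<And>x. f x \<le> g x + h x"
  shows "AE \<omega> in P. I f \<omega> \<le> I g \<omega> + I h \<omega>"
proof -
  have meas: "f \<in> borel_measurable E\<^sub>k" "g \<in> borel_measurable E\<^sub>k" "h \<in> borel_measurable E\<^sub>k"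
    and diag: "\<And>x. x \<in> diagonal \<mu> k \<Longrightarrow> f x = 0 \<and> g x = 0 \<and> h x = 0"
    using f g h unfolding offdiag_funs_def by auto
  obtain s where s: "\<And>n. simple_function E\<^sub>k (s n)" "\<And>n x. s n x < \<infinity>" "\<And>n x. s n x \<le> f x"
    "\<And>m n x. m \<le> n \<Longrightarrow> s m x \<le> s n x" "\<And>x. (\<lambda>n. s n x) \<longlonglongrightarrow> f x"
    by (rule increasing_simple_approximation[OF meas(1)]) (rule that, assumption+)
  obtain t where t: "\<And>n. simple_function E\<^sub>k (t n)" "\<And>n x. t n x < \<infinity>" "\<And>n x. t n x \<le> g x"
    "\<And>m n x. m \<le> n \<Longrightarrow> t m x \<le> t n x" "\<And>x. (\<lambda>n. t n x) \<longlonglongrightarrow> g x"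
    by (rule increasing_simple_approximation[OF meas(2)]) (rule that, assumption+)
  obtain r where r: "\<And>n. simple_function E\<^sub>k (r n)" "\<And>n x. r n x < \<infinity>" "\<And>n x. r n x \<le> h x"
    "\<And>m n x. m \<le> n \<Longrightarrow> r m x \<le> r n x" "\<And>x. (\<lambda>n. r n x) \<longlonglongrightarrow> h x"
    by (rule increasing_simple_approximation[OF meas(3)]) (rule that, assumption+)
  define s' where "s' n x = min (s n x) (t n x + r n x)" for n x
  have s': "simple_function E\<^sub>k (s' n)" for n
    unfolding s'_def using s(1) t(1) r(1)
    by (intro simple_function_compose2[where h=min] simple_function_add)
  have s'lim: "(\<lambda>n. s' n x) \<longlonglongrightarrow> f x" for x
  proof -
    have "(\<lambda>n. s' n x) \<longlonglongrightarrow> min (f x) (g x + h x)"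
      unfolding s'_def by (intro tendsto_min tendsto_add s(5) t(5) r(5))
    then show ?thesis using le[of x] by (simp add: min_absorb1)
  qed
  define T where "T n x = (s' n x, t n x, r n x)" for n x
  \<comment> \<open>The triple of zeros is the value taken on the diagonal.\<close>
  define J where "J n = T n ` space E\<^sub>k - {(0, 0, 0)}" for n
  define fib where "fib n j = {u \<in> space E\<^sub>k. T n u = j}" for n j
  define \<sigma> where "\<sigma> c n x = (\<Sum>j\<in>J n. c j * indicator (fib n j) x)"
    for c :: "ennreal \<times> ennreal \<times> ennreal \<Rightarrow> ennreal" and n x
  have T: "simple_function E\<^sub>k (T n)" for n
    unfolding T_def by (intro simple_function_Pair s' t r)
  have J: "finite (J n)" for n using simple_functionD(1)[OF T] by (simp add: J_def)
  have fibm: "fib n j \<in> sets E\<^sub>k" for n j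
    using simple_functionD(2)[OF T[of n], of "{j}"] by (simp add: fib_def vimage_def Int_def conj_commute)
  have Td: "T n u \<notin> J n" if "u \<in> diagonal \<mu> k" for n u
    using diag[OF that] s(3)[of n u] t(3)[of n u] r(3)[of n u] by (simp add: T_def J_def s'_def)
  have fin: "fst j < \<infinity>" "fst (snd j) < \<infinity>" "snd (snd j) < \<infinity>" if "j \<in> J n" for j n
    using that s(2) t(2) r(2) by (auto simp: J_def T_def s'_def min_less_iff_disj)
  note fin' = fin[unfolded infinity_ennreal_def]
  have jle: "fst j \<le> fst (snd j) + snd (snd j)" if "j \<in> J n" for j n
    using that by (auto simp: J_def T_def s'_def)
  have rep: "\<sigma> c n \<in> offdiag_simple \<mu> k"
    "AE \<omega> in P. I (\<sigma> c n) \<omega> = (SUP j\<in>J n. c j * Mk (fib n j) \<omega>)"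
    "\<And>x. x \<in> space E\<^sub>k \<Longrightarrow> \<sigma> c n x = c (T n x)"
    if c: "\<And>j. j \<in> J n \<Longrightarrow> c j < \<infinity>" "c (0, 0, 0) = 0" for c n
  proof -
    note F = I_fibres[of "J n" "T n" c, folded fib_def, OF J fibm Td c(1), folded \<sigma>_def]
    show "\<sigma> c n \<in> offdiag_simple \<mu> k"
      "AE \<omega> in P. I (\<sigma> c n) \<omega> = (SUP j\<in>J n. c j * Mk (fib n j) \<omega>)" by (rule F(3), assumption+, rule F(4), assumption+)
    show "\<sigma> c n x = c (T n x)" if x: "x \<in> space E\<^sub>k" for x
      using F(2)[OF _ _ x] x c(2) by (auto simp: J_def)
  qed
  let ?f = "fst" and ?g = "\<lambda>j. fst (snd j)" and ?h = "\<lambda>j. snd (snd j)"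
  have lim_f: "AE \<omega> in P. (\<lambda>n. I (\<sigma> ?f n) \<omega>) \<longlonglongrightarrow> I f \<omega>"
  proof (rule I_limit[OF f])
    show "\<sigma> ?f n \<in> offdiag_simple \<mu> k" for n by (rule rep(1)) (simp_all add: fin')
    have eq: "\<sigma> ?f n x = s' n x" if "x \<in> space E\<^sub>k" for n x
      by (subst rep(3)[OF _ _ that]) (simp_all add: fin' T_def)
    show "\<sigma> ?f n x \<le> \<sigma> ?f (Suc n) x" if "x \<in> space E\<^sub>k" for n x
      unfolding eq[OF that] s'_def by (intro min.mono add_mono s(4) t(4) r(4)) auto
    show "(\<lambda>n. \<sigma> ?f n x) \<longlonglongrightarrow> f x" if "x \<in> space E\<^sub>k" for x
      unfolding eq[OF that] by (rule s'lim)
  qed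
  have lim_g: "AE \<omega> in P. (\<lambda>n. I (\<sigma> ?g n) \<omega>) \<longlonglongrightarrow> I g \<omega>"
  proof (rule I_limit[OF g])
    show "\<sigma> ?g n \<in> offdiag_simple \<mu> k" for n by (rule rep(1)) (simp_all add: fin')
    have eq: "\<sigma> ?g n x = t n x" if "x \<in> space E\<^sub>k" for n x
      by (subst rep(3)[OF _ _ that]) (simp_all add: fin' T_def)
    show "\<sigma> ?g n x \<le> \<sigma> ?g (Suc n) x" if "x \<in> space E\<^sub>k" for n x
      unfolding eq[OF that] by (rule t(4)) simp
    show "(\<lambda>n. \<sigma> ?g n x) \<longlonglongrightarrow> g x" if "x \<in> space E\<^sub>k" for x
      unfolding eq[OF that] by (rule t(5))
  qed
  have lim_h: "AE \<omega> in P. (\<lambda>n. I (\<sigma> ?h n) \<omega>) \<longlonglongrightarrow> I h \<omega>"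
  proof (rule I_limit[OF h])
    show "\<sigma> ?h n \<in> offdiag_simple \<mu> k" for n by (rule rep(1)) (simp_all add: fin')
    have eq: "\<sigma> ?h n x = r n x" if "x \<in> space E\<^sub>k" for n x
      by (subst rep(3)[OF _ _ that]) (simp_all add: fin' T_def)
    show "\<sigma> ?h n x \<le> \<sigma> ?h (Suc n) x" if "x \<in> space E\<^sub>k" for n x
      unfolding eq[OF that] by (rule r(4)) simp
    show "(\<lambda>n. \<sigma> ?h n x) \<longlonglongrightarrow> h x" if "x \<in> space E\<^sub>k" for x
      unfolding eq[OF that] by (rule r(5))
  qed
  have step: "AE \<omega> in P. I (\<sigma> ?f n) \<omega> \<le> I (\<sigma> ?g n) \<omega> + I (\<sigma> ?h n) \<omega>" for n
  proof -
    have "AE \<omega> in P. I (\<sigma> ?f n) \<omega> = (SUP j\<in>J n. ?f j * Mk (fib n j) \<omega>)"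
      "AE \<omega> in P. I (\<sigma> ?g n) \<omega> = (SUP j\<in>J n. ?g j * Mk (fib n j) \<omega>)"
      "AE \<omega> in P. I (\<sigma> ?h n) \<omega> = (SUP j\<in>J n. ?h j * Mk (fib n j) \<omega>)"
      by (rule rep(2); simp add: fin')+
    then show ?thesis
    proof eventually_elim
      case (elim \<omega>)
      show ?case unfolding elim
      proof (rule SUP_least)
        fix j assume j: "j \<in> J n"
        have "?f j * Mk (fib n j) \<omega> \<le> ?g j * Mk (fib n j) \<omega> + ?h j * Mk (fib n j) \<omega>"
          unfolding distrib_right[symmetric] by (rule mult_right_mono[OF jle[OF j]]) simp
        also have "\<dots> \<le> (SUP j\<in>J n. ?g j * Mk (fib n j) \<omega>) + (SUP j\<in>J n. ?h j * Mk (fib n j) \<omega>)"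
          by (intro add_mono SUP_upper j)
        finally show "?f j * Mk (fib n j) \<omega> \<le>
          (SUP j\<in>J n. ?g j * Mk (fib n j) \<omega>) + (SUP j\<in>J n. ?h j * Mk (fib n j) \<omega>)" .
      qed
    qed
  qed
  have "AE \<omega> in P. \<forall>n. I (\<sigma> ?f n) \<omega> \<le> I (\<sigma> ?g n) \<omega> + I (\<sigma> ?h n) \<omega>"
    unfolding AE_all_countable using step by blast
  then show ?thesis
    using lim_f lim_g lim_h
  proof eventually_elim
    case (elim \<omega>)
    have "(\<lambda>n. I (\<sigma> ?g n) \<omega> + I (\<sigma> ?h n) \<omega>) \<longlonglongrightarrow> I g \<omega> + I h \<omega>"
      by (rule tendsto_add[OF elim(3,4)])
    then show ?case using elim(1) by (intro LIMSEQ_le[OF elim(2)]) auto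
  qed
qed

end

section \<open>Tail bound for the multiple extremal integral\<close>

text \<open>Only its independence of the integrand matters.\<close>

definition tail_const :: "real \<Rightarrow> nat \<Rightarrow> real \<Rightarrow> real \<Rightarrow> real" where
  "tail_const \<alpha> k L \<epsilon> = (2 / \<epsilon>) powr \<alpha> *
     (exp 1 * (1 + max 0 (\<alpha> * ln (2 / \<epsilon>) + real k * ln L) + \<alpha>)) ^ (k - 1)"

text \<open>Truncation at \<open>K\<^sub>i = (L * \<kappa>\<^sub>i)\<^sup>1\<^sup>/\<^sup>\<alpha>\<close> makes the logarithm in the factor at most a constant plus
  \<open>\<alpha> * ln\<^sub>+ t\<close>, where \<open>t\<close> is the value \<open>a\<close> of the function times the weight to the power \<open>1 / \<alpha>\<close>. A sum of the form \<open>c + \<alpha> * l\<close> is at most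
  \<open>(c + \<alpha>) * max 1 l\<close>, whose power is absorbed in \<open>1 + l ^ (k - 1)\<close>.\<close>

lemma log_factor_le:
  fixes \<kappa> v :: "nat \<Rightarrow> real"
  assumes \<alpha>: "0 < \<alpha>" and a: "0 < a" and e: "0 < \<epsilon>" and L: "0 < L"
    and \<kappa>: "\<And>i. i < k \<Longrightarrow> 0 < \<kappa> i \<and> \<kappa> i \<le> v i"
  defines "t \<equiv> a * (\<Prod>i<k. v i) powr (1 / \<alpha>)"
  shows "log_factor \<alpha> k (\<lambda>i. (L * \<kappa> i) powr (1 / \<alpha>)) (2 * (a / \<epsilon>)) * (\<Prod>i<k. v i)
    \<le> tail_const \<alpha> k L \<epsilon> * (t powr \<alpha> * (1 + ln (max t 1) ^ (k - 1)))"
proof -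
  define W where "W = (\<Prod>i<k. v i)"
  define D where "D = max 0 (\<alpha> * ln (2 / \<epsilon>) + real k * ln L)"
  define l where "l = ln (max t 1)"
  define Q where "Q = real (nat \<lceil>\<alpha> * ln (2 * (a / \<epsilon>) * (\<Prod>i<k. (L * \<kappa> i) powr (1 / \<alpha>)))\<rceil>)"
  have \<kappa>pos: "0 < \<kappa> i" "0 < v i" if "i < k" for i using \<kappa>[OF that] by auto
  have W: "0 < W" unfolding W_def using \<kappa>pos by (intro prod_pos) auto
  have t: "0 < t" "t = a * W powr (1 / \<alpha>)"
  proof -
    show "t = a * W powr (1 / \<alpha>)" by (simp only: t_def W_def)
    then show "0 < t" using a W by simp
  qed
  have l0: "0 \<le> l" "ln t \<le> l" using t by (auto simp: l_def max_def)
  have D0: "0 \<le> D" by (simp add: D_def)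
  have prodK: "(\<Prod>i<k. (L * \<kappa> i) powr (1 / \<alpha>)) = (L ^ k * (\<Prod>i<k. \<kappa> i)) powr (1 / \<alpha>)"
    using L \<kappa>pos by (subst prod_powr_distrib[symmetric]) (auto simp: prod.distrib less_imp_le)
  have \<kappa>W: "0 < (\<Prod>i<k. \<kappa> i)" "(\<Prod>i<k. \<kappa> i) \<le> W"
    unfolding W_def using \<kappa> by (auto intro!: prod_pos prod_mono simp: less_imp_le)
  have "\<alpha> * ln (2 * (a / \<epsilon>) * (\<Prod>i<k. (L * \<kappa> i) powr (1 / \<alpha>)))
      = \<alpha> * ln (2 / \<epsilon>) + real k * ln L + (\<alpha> * ln a + ln (\<Prod>i<k. \<kappa> i))"
  proof -
    define p where "p = (\<Prod>i<k. \<kappa> i)"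
    have "0 < p" using \<kappa>W(1) by (simp only: p_def)
    then show ?thesis
      unfolding prodK p_def[symmetric] using a e L \<alpha>
      by (simp add: ln_mult ln_div ln_powr ln_realpow field_simps)
  qed
  also have "\<alpha> * ln a + ln (\<Prod>i<k. \<kappa> i) \<le> \<alpha> * ln a + ln W"
    using \<kappa>W W by simp
  also have "\<alpha> * ln a + ln W = \<alpha> * ln t"
    unfolding t(2) using a W \<alpha> by (simp add: ln_mult ln_powr field_simps)
  also have "\<alpha> * ln t \<le> \<alpha> * l" using l0 \<alpha> by simp
  finally have "\<alpha> * ln (2 * (a / \<epsilon>) * (\<Prod>i<k. (L * \<kappa> i) powr (1 / \<alpha>))) \<le> D + \<alpha> * l"
    by (simp add: D_def max_def split: if_splits)
  moreover have "0 \<le> D + \<alpha> * l" using D0 l0 \<alpha> by simp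
  ultimately have "Q \<le> 1 + D + \<alpha> * l" unfolding Q_def by linarith
  also have "\<dots> \<le> (1 + D + \<alpha>) * max 1 l"
  proof -
    have "(1 + D) * 1 \<le> (1 + D) * max 1 l" "\<alpha> * l \<le> \<alpha> * max 1 l"
      using D0 \<alpha> by (auto intro!: mult_left_mono)
    then show ?thesis by (simp add: distrib_right)
  qed
  finally have Q: "Q \<le> (1 + D + \<alpha>) * max 1 l" .
  have "(exp 1 * Q) ^ (k - 1) \<le> (exp 1 * ((1 + D + \<alpha>) * max 1 l)) ^ (k - 1)"
    using Q by (intro power_mono mult_left_mono) (auto simp: Q_def)
  also have "\<dots> = (exp 1 * (1 + D + \<alpha>)) ^ (k - 1) * max 1 l ^ (k - 1)"
    by (simp add: power_mult_distrib)
  also have "\<dots> \<le> (exp 1 * (1 + D + \<alpha>)) ^ (k - 1) * (1 + l ^ (k - 1))"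
    using D0 \<alpha> l0 by (intro mult_left_mono) (auto simp: max_def)
  finally have pw: "(exp 1 * Q) ^ (k - 1) \<le> (exp 1 * (1 + D + \<alpha>)) ^ (k - 1) * (1 + l ^ (k - 1))" .
  have tp: "t powr \<alpha> = a powr \<alpha> * W"
    unfolding t(2) using a W \<alpha> by (simp add: powr_mult powr_powr)
  have ap: "(2 * (a / \<epsilon>)) powr \<alpha> = (2 / \<epsilon>) powr \<alpha> * a powr \<alpha>"
    using a e by (simp flip: powr_mult)
  have "log_factor \<alpha> k (\<lambda>i. (L * \<kappa> i) powr (1 / \<alpha>)) (2 * (a / \<epsilon>)) * W
      = ((2 / \<epsilon>) powr \<alpha> * t powr \<alpha>) * (exp 1 * Q) ^ (k - 1)"
    unfolding log_factor_def Q_def[symmetric] ap tp by (simp add: mult_ac)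
  also have "\<dots> \<le> ((2 / \<epsilon>) powr \<alpha> * t powr \<alpha>) * ((exp 1 * (1 + D + \<alpha>)) ^ (k - 1) * (1 + l ^ (k - 1)))"
    using pw by (intro mult_left_mono) auto
  also have "\<dots> = tail_const \<alpha> k L \<epsilon> * (t powr \<alpha> * (1 + l ^ (k - 1)))"
    unfolding tail_const_def D_def by (simp add: mult_ac)
  finally show ?thesis unfolding W_def l_def .
qed

lemma L_ln_L_integrand_ennreal:
  fixes t :: real
  assumes "0 \<le> t"
  shows "ennreal_powr (ennreal t) \<alpha> * (1 + ln_plus (ennreal t) ^ n) =
    ennreal (t powr \<alpha> * (1 + ln (max t 1) ^ n))"
proof -
  have l: "0 \<le> ln (max t 1)" by simp
  have "ln_plus (ennreal t) ^ n = ennreal (ln (max t 1) ^ n)"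
    using assms l by (simp add: ln_plus_def ennreal_power)
  moreover have "1 + ennreal (ln (max t 1) ^ n) = ennreal (1 + ln (max t 1) ^ n)"
    using l by (simp add: ennreal_plus flip: ennreal_1)
  ultimately show ?thesis using assms l by (simp add: ennreal_powr_def ennreal_mult')
qed

lemma L_ln_L_integrand_mono:
  assumes "0 < \<alpha>" "x \<le> y"
  shows "ennreal_powr x \<alpha> * (1 + ln_plus x ^ n) \<le> ennreal_powr y \<alpha> * (1 + ln_plus y ^ n)"
  using assms by (intro mult_mono add_mono power_mono ennreal_powr_mono ln_plus_mono) auto

text \<open>The density is taken real-valued and positive everywhere; this changes it on a null set only, see
  \<open>density_normalisation\<close> below.\<close>

locale extremal_density = extremal P \<mu> \<alpha> M k Mk I
  for P :: "'w measure" and \<mu> :: "'a measure" and \<alpha> :: real and M :: "'a set \<Rightarrow> 'w \<Rightarrow> ennreal"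
    and k :: nat and Mk :: "(nat \<Rightarrow> 'a) set \<Rightarrow> 'w \<Rightarrow> ennreal"
    and I :: "((nat \<Rightarrow> 'a) \<Rightarrow> ennreal) \<Rightarrow> 'w \<Rightarrow> ennreal" +
  fixes m :: "'a measure" and w :: "'a \<Rightarrow> real"
  assumes m: "prob_space m" and sets_m: "sets m = sets \<mu>"
    and w: "w \<in> borel_measurable m" and w_pos: "\<And>x. 0 < w x"
    and mu: "\<mu> = density m (\<lambda>x. ennreal (w x))"
begin

text \<open>The integer part of \<open>ln w\<close>, encoded as a natural number so that countable unions over the levels are
  indexed by \<^typ>\<open>nat\<close>; on a level \<open>w\<close> is constant up to the factor \<open>e\<close>.\<close>

definition level :: "'a \<Rightarrow> nat" where
  "level x = to_nat \<lfloor>ln (w x)\<rfloor>"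

definition level_val :: "nat \<Rightarrow> real" where
  "level_val n = exp (real_of_int (from_nat n))"

text \<open>The truncation event. It does not depend on the integrand, so its complement is paid for only once.\<close>

definition good :: "real \<Rightarrow> 'w set" where
  "good L = {\<omega>\<in>space P. \<forall>n. M {x\<in>space \<mu>. level x = n} \<omega> \<le> ennreal ((L * level_val n) powr (1 / \<alpha>))}"

lemma level_val_pos: "0 < level_val n"
  by (simp add: level_val_def)

lemma level_val_le: "level_val (level x) \<le> w x"
  and less_level_val: "w x < exp 1 * level_val (level x)"
proof -
  have l: "level_val (level x) = exp (real_of_int \<lfloor>ln (w x)\<rfloor>)"
    by (simp add: level_val_def level_def)
  have "exp (real_of_int \<lfloor>ln (w x)\<rfloor>) \<le> exp (ln (w x))" by simp
  then show "level_val (level x) \<le> w x" using w_pos[of x] by (simp add: l)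
  have "exp (ln (w x)) < exp (1 + real_of_int \<lfloor>ln (w x)\<rfloor>)" unfolding exp_less_cancel_iff by linarith
  then show "w x < exp 1 * level_val (level x)" using w_pos[of x] by (simp add: l exp_add)
qed

lemma w_mu: "w \<in> borel_measurable \<mu>"
  using w by (simp add: measurable_cong_sets[OF sets_m[symmetric] refl])

lemma level_measurable [measurable]: "level \<in> measurable \<mu> (count_space UNIV)"
proof -
  note [measurable] = w_mu
  have "(\<lambda>x. \<lfloor>ln (w x)\<rfloor>) \<in> measurable \<mu> (count_space UNIV)" by measurable
  then show ?thesis unfolding level_def
    by (rule measurable_compose[where g=to_nat]) simp
qed

lemma level_sets: "{x\<in>space \<mu>. level x = n} \<in> sets \<mu>"
  by measurable

lemma emeasure_level: "emeasure \<mu> {x\<in>space \<mu>. level x = n}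
    \<le> ennreal (exp 1 * level_val n) * emeasure m {x\<in>space \<mu>. level x = n}"
proof -
  have A: "{x\<in>space \<mu>. level x = n} \<in> sets m" unfolding sets_m by (rule level_sets)
  have "emeasure \<mu> {x\<in>space \<mu>. level x = n} = (\<integral>\<^sup>+x. ennreal (w x) * indicator {x\<in>space \<mu>. level x = n} x \<partial>m)"
    by (subst mu, rule emeasure_density) (use w A in auto)
  also have "\<dots> \<le> (\<integral>\<^sup>+x. ennreal (exp 1 * level_val n) * indicator {x\<in>space \<mu>. level x = n} x \<partial>m)"
    using less_level_val by (intro nn_integral_mono) (auto simp: indicator_def less_imp_le intro!: ennreal_leI)
  also have "\<dots> = ennreal (exp 1 * level_val n) * emeasure m {x\<in>space \<mu>. level x = n}"
    using A by (rule nn_integral_cmult_indicator)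
  finally show ?thesis .
qed

lemma good_measurable: "good L \<in> sets P"
proof -
  note [measurable] = M_measurable[OF level_sets]
  show ?thesis unfolding good_def by measurable
qed

text \<open>A level with value \<open>p\<close> violates the truncation with probability at most \<open>\<mu> (level) / (L * p)\<close>, hence at most
  \<open>e / L * m (level)\<close>, and \<open>m\<close> has total mass \<open>1\<close>.\<close>

lemma prob_not_good:
  assumes L: "0 < L"
  shows "emeasure P (space P - good L) \<le> ennreal (exp 1 / L)"
proof -
  interpret m: prob_space m by (rule m)
  let ?E = "\<lambda>n. {x\<in>space \<mu>. level x = n}"
  let ?B = "\<lambda>n. {\<omega>\<in>space P. ennreal ((L * level_val n) powr (1 / \<alpha>)) < M (?E n) \<omega>}"
  note [measurable] = M_measurable[OF level_sets]
  have fin: "emeasure \<mu> (?E n) < \<infinity>" for n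
    by (rule le_less_trans[OF emeasure_level]) (simp add: ennreal_mult_less_top m.emeasure_eq_measure)
  have B: "emeasure P (?B n) \<le> ennreal (exp 1 / L) * emeasure m (?E n)" for n
  proof -
    have pos: "0 < L * level_val n" using L level_val_pos by simp
    have "prob (?B n) \<le> measure \<mu> (?E n) * ((L * level_val n) powr (1 / \<alpha>)) powr (- \<alpha>)"
    proof (rule M_tail[OF level_sets fin])
      show "0 < (L * level_val n) powr (1 / \<alpha>)" using pos unfolding powr_gt_zero by linarith
    qed
    also have "((L * level_val n) powr (1 / \<alpha>)) powr (- \<alpha>) = 1 / (L * level_val n)"
      using pos alpha L level_val_pos[of n] by (simp add: powr_powr powr_minus_divide)
    also have "measure \<mu> (?E n) \<le> exp 1 * level_val n * measure m (?E n)"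
    proof -
      have "emeasure \<mu> (?E n) = ennreal (measure \<mu> (?E n))" using fin[of n] by (intro emeasure_eq_ennreal_measure) simp
      then have "ennreal (measure \<mu> (?E n)) \<le> ennreal (exp 1 * level_val n * measure m (?E n))"
        using emeasure_level[of n] level_val_pos[of n] by (simp add: m.emeasure_eq_measure ennreal_mult')
      then show ?thesis using level_val_pos[of n] by (subst (asm) ennreal_le_iff) auto
    qed
    finally have "prob (?B n) \<le> exp 1 / L * measure m (?E n)"
      using pos level_val_pos[of n] L by (simp add: field_simps mult_right_mono)
    then show ?thesis
      using L by (simp add: emeasure_eq_measure m.emeasure_eq_measure ennreal_mult'[symmetric] ennreal_leI)
  qed
  have "space P - good L \<subseteq> (\<Union>n. ?B n)" by (auto simp: good_def not_le)
  then have "emeasure P (space P - good L) \<le> emeasure P (\<Union>n. ?B n)"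
    by (rule emeasure_mono) measurable
  also have "\<dots> \<le> (\<Sum>n. emeasure P (?B n))"
    by (rule emeasure_subadditive_countably) (auto simp: image_subset_iff)
  also have "\<dots> \<le> (\<Sum>n. ennreal (exp 1 / L) * emeasure m (?E n))"
    using B by (intro suminf_le) auto
  also have "\<dots> = ennreal (exp 1 / L) * (\<Sum>n. emeasure m (?E n))" by (rule ennreal_suminf_cmult)
  also have "(\<Sum>n. emeasure m (?E n)) = emeasure m (\<Union>n. ?E n)"
  proof (rule suminf_emeasure)
    show "range ?E \<subseteq> sets m" unfolding sets_m using level_sets by blast
  qed (auto simp: disjoint_family_on_def)
  also have "\<dots> \<le> 1" by (rule m.emeasure_le_1)
  finally show ?thesis by (simp add: mult_left_mono order_trans)
qed

abbreviation "weight u \<equiv> \<Prod>i<k. ennreal (w (u i))"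

abbreviation "\<Phi> x \<equiv> ennreal_powr x \<alpha> * (1 + ln_plus x ^ (k - 1))"

abbreviation "m\<^sub>k \<equiv> power_measure m k"

lemma sets_power_m: "sets m\<^sub>k = sets E\<^sub>k"
  using sets_m by (intro sets_PiM_cong) auto

lemma power_mu: "E\<^sub>k = density m\<^sub>k weight"
proof -
  interpret m: prob_space m by (rule m)
  have "power_measure (density m (\<lambda>x. ennreal (w x))) k = density m\<^sub>k weight"
  proof (rule PiM_density)
    show "sigma_finite_measure m" by (rule m.sigma_finite_measure_axioms)
    show "sigma_finite_measure (density m (\<lambda>x. ennreal (w x)))"
      unfolding mu[symmetric] by (rule sigma_finite_measure_axioms)
  qed (use w in auto)
  then show ?thesis by (simp only: mu[symmetric])
qed

lemma weight_measurable [measurable]: "weight \<in> borel_measurable m\<^sub>k"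
proof -
  note [measurable] = w
  show ?thesis by measurable
qed

text \<open>On a set whose points have prescribed levels, the truncation event bounds \<open>M\<close> on the sides of the surrounding box,
  so the tail bound for \<open>Mk\<close> applies. The factor in it, times the weight, is at most a constant times the integrand
  at each point of the set.\<close>

lemma piece_tail:
  assumes c: "0 < c" "c < \<infinity>" and e: "0 < \<epsilon>" and L: "0 < L"
    and A: "A \<in> offdiag_sets \<mu> k" and lev: "\<And>u i. u \<in> A \<Longrightarrow> i < k \<Longrightarrow> level (u i) = l i"
  shows "emeasure P ({\<omega>\<in>space P. ennreal \<epsilon> < c * Mk A \<omega>} \<inter> good L)
    \<le> ennreal (tail_const \<alpha> k L \<epsilon>) *
      (\<integral>\<^sup>+u. \<Phi> (c * ennreal_powr (weight u) (1 / \<alpha>)) * indicator A u \<partial>m\<^sub>k)"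
proof -
  define a where "a = enn2real c"
  have a: "c = ennreal a" "0 < a" using c by (auto simp: a_def enn2real_positive_iff)
  define K where "K i = (L * level_val (l i)) powr (1 / \<alpha>)" for i
  define E where "E i = {x\<in>space \<mu>. level x = l i}" for i
  let ?c = "log_factor \<alpha> k K (2 * (a / \<epsilon>))"
  have A': "A \<in> sets m\<^sub>k" "A \<subseteq> offdiag \<mu> k"
    using A unfolding sets_power_m offdiag_sets_iff[OF k bs] by simp_all
  have AE: "A \<subseteq> Pi\<^sub>E {..<k} E"
  proof
    fix u assume u: "u \<in> A"
    then have "u \<in> space E\<^sub>k" using A'(2) unfolding offdiag_def by blast
    then show "u \<in> Pi\<^sub>E {..<k} E" using lev[OF u] by (auto simp: space_PiM PiE_iff E_def)
  qed
  have "emeasure P ({\<omega>\<in>space P. ennreal \<epsilon> < c * Mk A \<omega>} \<inter> good L)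
    \<le> emeasure P {\<omega>\<in>space P. 1 < ennreal (a / \<epsilon>) * Mk A \<omega> \<and> (\<forall>i<k. M (E i) \<omega> \<le> ennreal (K i))}"
  proof (rule emeasure_mono)
    show "{\<omega>\<in>space P. ennreal \<epsilon> < c * Mk A \<omega>} \<inter> good L
      \<subseteq> {\<omega>\<in>space P. 1 < ennreal (a / \<epsilon>) * Mk A \<omega> \<and> (\<forall>i<k. M (E i) \<omega> \<le> ennreal (K i))}"
    proof safe
      fix \<omega> assume w: "ennreal \<epsilon> < c * Mk A \<omega>" "\<omega> \<in> good L"
      have "c * Mk A \<omega> = ennreal \<epsilon> * (ennreal (a / \<epsilon>) * Mk A \<omega>)"
        using a e by (simp add: mult.assoc[symmetric] ennreal_mult'[symmetric])
      then show "1 < ennreal (a / \<epsilon>) * Mk A \<omega>"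
        using w(1) mult_left_mono[of "ennreal (a / \<epsilon>) * Mk A \<omega>" 1 "ennreal \<epsilon>"]
        by (auto simp: not_le[symmetric])
      fix i show "M (E i) \<omega> \<le> ennreal (K i)" using w(2) by (simp add: good_def E_def K_def)
    qed
    have [measurable]: "Mk A \<in> borel_measurable P" by (rule Mk_measurable[OF A])
    have [measurable]: "M (E i) \<in> borel_measurable P" for i unfolding E_def by (rule M_measurable[OF level_sets])
    show "{\<omega>\<in>space P. 1 < ennreal (a / \<epsilon>) * Mk A \<omega> \<and> (\<forall>i<k. M (E i) \<omega> \<le> ennreal (K i))} \<in> sets P"
      by measurable
  qed
  also have "\<dots> \<le> ennreal ?c * emeasure E\<^sub>k A"
  proof (rule Mk_tail[OF _ _ _ A AE])
    show "0 < a / \<epsilon>" using a e by simp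
    show "E i \<in> sets \<mu>" for i unfolding E_def by (rule level_sets)
    show "0 < K i" for i using L level_val_pos[of "l i"] by (simp add: K_def)
  qed
  also have "emeasure E\<^sub>k A = (\<integral>\<^sup>+u. weight u * indicator A u \<partial>m\<^sub>k)"
    unfolding power_mu using A' by (intro emeasure_density) auto
  also have "ennreal ?c * \<dots> = (\<integral>\<^sup>+u. ennreal ?c * (weight u * indicator A u) \<partial>m\<^sub>k)"
    using A' by (intro nn_integral_cmult[symmetric]) auto
  also have "\<dots> \<le> (\<integral>\<^sup>+u. ennreal (tail_const \<alpha> k L \<epsilon>) *
      (\<Phi> (c * ennreal_powr (weight u) (1 / \<alpha>)) * indicator A u) \<partial>m\<^sub>k)"
  proof (rule nn_integral_mono)
    fix u
    show "ennreal ?c * (weight u * indicator A u) \<le> ennreal (tail_const \<alpha> k L \<epsilon>) *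
      (\<Phi> (c * ennreal_powr (weight u) (1 / \<alpha>)) * indicator A u)"
    proof (cases "u \<in> A")
      case True
      define t where "t = a * (\<Prod>i<k. w (u i)) powr (1 / \<alpha>)"
      have W: "0 < (\<Prod>i<k. w (u i))" using w_pos by (intro prod_pos) auto
      have wt: "weight u = ennreal (\<Prod>i<k. w (u i))" using w_pos by (intro prod_ennreal) (auto simp: less_imp_le)
      have t: "c * ennreal_powr (weight u) (1 / \<alpha>) = ennreal t" "0 \<le> t"
        using a W by (simp_all add: wt t_def ennreal_powr_def ennreal_mult')
      have "?c * (\<Prod>i<k. w (u i)) \<le> tail_const \<alpha> k L \<epsilon> * (t powr \<alpha> * (1 + ln (max t 1) ^ (k - 1)))"
        unfolding K_def t_def
      proof (rule log_factor_le[OF alpha a(2) e L])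
        fix i assume i: "i < k"
        show "0 < level_val (l i) \<and> level_val (l i) \<le> w (u i)"
          using level_val_pos level_val_le[of "u i"] lev[OF True i] by simp
      qed
      then have "ennreal (?c * (\<Prod>i<k. w (u i))) \<le>
          ennreal (tail_const \<alpha> k L \<epsilon> * (t powr \<alpha> * (1 + ln (max t 1) ^ (k - 1))))"
        by (rule ennreal_leI)
      then show ?thesis
        unfolding t(1) L_ln_L_integrand_ennreal[OF t(2)] unfolding wt
        using True W t(2) by (simp add: ennreal_mult' ennreal_mult'' log_factor_nonneg)
    qed simp
  qed
  also have "\<dots> = ennreal (tail_const \<alpha> k L \<epsilon>) *
      (\<integral>\<^sup>+u. \<Phi> (c * ennreal_powr (weight u) (1 / \<alpha>)) * indicator A u \<partial>m\<^sub>k)"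
    using A' by (intro nn_integral_cmult) auto
  finally show ?thesis .
qed

text \<open>The levels of all coordinates in one number; its fibres are the boxes in \<open>E\<^sup>k\<close> over which the
  simple functions below are cut.\<close>

definition box_code :: "(nat \<Rightarrow> 'a) \<Rightarrow> nat" where
  "box_code u = to_nat (map (\<lambda>i. level (u i)) [0..<k])"

lemma box_code_level: "box_code u = box_code v \<Longrightarrow> i < k \<Longrightarrow> level (u i) = level (v i)"
  by (simp add: box_code_def)

lemma box_code_measurable [measurable]: "box_code \<in> measurable E\<^sub>k (count_space UNIV)"
proof (rule measurable_count_space_eq2_countable[THEN iffD2])
  show "box_code \<in> space E\<^sub>k \<rightarrow> UNIV \<and> (\<forall>a\<in>UNIV. box_code -` {a} \<inter> space E\<^sub>k \<in> sets E\<^sub>k)"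
  proof (intro conjI ballI)
    fix a :: nat
    have "box_code -` {a} \<inter> space E\<^sub>k =
       {u\<in>space E\<^sub>k. a = to_nat (from_nat a :: nat list) \<and> length (from_nat a :: nat list) = k \<and>
          (\<forall>i<k. level (u i) = (from_nat a :: nat list) ! i)}"
    proof (rule set_eqI)
      fix u
      have code: "from_nat (box_code u) = map (\<lambda>i. level (u i)) [0..<k]" by (simp add: box_code_def)
      have "box_code u = a \<longleftrightarrow> a = to_nat (from_nat a :: nat list) \<and> length (from_nat a :: nat list) = k \<and>
          (\<forall>i<k. level (u i) = (from_nat a :: nat list) ! i)"
      proof
        assume "box_code u = a"
        then have "from_nat a = map (\<lambda>i. level (u i)) [0..<k]" "a = to_nat (map (\<lambda>i. level (u i)) [0..<k])"
          using code by (simp_all add: box_code_def)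
        then show "a = to_nat (from_nat a :: nat list) \<and> length (from_nat a :: nat list) = k \<and>
          (\<forall>i<k. level (u i) = (from_nat a :: nat list) ! i)" by simp
      next
        assume a: "a = to_nat (from_nat a :: nat list) \<and> length (from_nat a :: nat list) = k \<and>
          (\<forall>i<k. level (u i) = (from_nat a :: nat list) ! i)"
        then have "map (\<lambda>i. level (u i)) [0..<k] = from_nat a"
          by (intro nth_equalityI) auto
        then show "box_code u = a" using a by (simp add: box_code_def)
      qed
      then show "u \<in> box_code -` {a} \<inter> space E\<^sub>k \<longleftrightarrow>
        u \<in> {u\<in>space E\<^sub>k. a = to_nat (from_nat a :: nat list) \<and> length (from_nat a :: nat list) = k \<and>
          (\<forall>i<k. level (u i) = (from_nat a :: nat list) ! i)}" by blast
    qed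
    also have "\<dots> \<in> sets E\<^sub>k" by measurable
    finally show "box_code -` {a} \<inter> space E\<^sub>k \<in> sets E\<^sub>k" .
  qed simp
qed

text \<open>Approximate \<open>h\<close> from below by simple functions restricted to finitely many boxes. Each piece of
  constant value inside one box is handled by the preceding bound, and the pieces are disjoint, so the integrals add up
  to at most that of \<open>h\<close>. Where \<open>I h > \<epsilon>\<close>, the approximating integrals eventually exceed \<open>\<epsilon>\<close>, so the
  uniform bound passes to the limit.\<close>

lemma I_tail:
  assumes h: "h \<in> offdiag_funs \<mu> k" and e: "0 < \<epsilon>" and L: "0 < L"
  shows "emeasure P {\<omega>\<in>space P. ennreal \<epsilon> < I h \<omega>} \<le> ennreal (exp 1 / L) +
    ennreal (tail_const \<alpha> k L \<epsilon>) * L_ln_L \<alpha> k (\<lambda>u. h u * ennreal_powr (weight u) (1 / \<alpha>)) m"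
proof -
  let ?c = "ennreal (tail_const \<alpha> k L \<epsilon>)"
  let ?R = "L_ln_L \<alpha> k (\<lambda>u. h u * ennreal_powr (weight u) (1 / \<alpha>)) m"
  have hm: "h \<in> borel_measurable E\<^sub>k" and diag: "\<And>x. x \<in> diagonal \<mu> k \<Longrightarrow> h x = 0"
    using h unfolding offdiag_funs_def by auto
  have [measurable]: "h \<in> borel_measurable m\<^sub>k"
    using hm by (simp add: measurable_cong_sets[OF sets_power_m refl])
  obtain s where s: "\<And>n. simple_function E\<^sub>k (s n)" "\<And>n x. s n x < \<infinity>" "\<And>n x. s n x \<le> h x"
    "\<And>m n x. m \<le> n \<Longrightarrow> s m x \<le> s n x" "\<And>x. (\<lambda>n. s n x) \<longlonglongrightarrow> h x"
    by (rule increasing_simple_approximation[OF hm]) (rule that, assumption+)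
  define T where "T n u = (s n u, box_code u)" for n u
  \<comment> \<open>The restriction to the boxes with code below \<open>n\<close> makes the partition finite.\<close>
  define J where "J n = {j \<in> T n ` space E\<^sub>k. 0 < fst j \<and> snd j < n}" for n
  define fib where "fib n j = {u \<in> space E\<^sub>k. T n u = j}" for n j
  define \<sigma> where "\<sigma> n x = (\<Sum>j\<in>J n. fst j * indicator (fib n j) x)" for n x
  have J: "finite (J n)" for n
  proof (rule finite_subset)
    show "J n \<subseteq> s n ` space E\<^sub>k \<times> {..<n}" by (auto simp: J_def T_def)
    show "finite (s n ` space E\<^sub>k \<times> {..<n})" using simple_functionD(1)[OF s(1)] by simp
  qed
  have sm[measurable]: "s n \<in> borel_measurable E\<^sub>k" for n using s(1) by (rule borel_measurable_simple_function)
  have fibm: "fib n j \<in> sets E\<^sub>k" for n j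
  proof -
    have "fib n j = {u \<in> space E\<^sub>k. s n u = fst j \<and> box_code u = snd j}"
      unfolding fib_def T_def by (cases j) auto
    also have "\<dots> \<in> sets E\<^sub>k" by measurable
    finally show ?thesis .
  qed
  have Td: "T n u \<notin> J n" if "u \<in> diagonal \<mu> k" for n u
    using diag[OF that] s(3)[of n u] by (simp add: T_def J_def)
  have fin: "fst j < \<infinity>" if "j \<in> J n" for j n using that s(2) by (auto simp: J_def T_def)
  have rep: "\<And>j. j \<in> J n \<Longrightarrow> fib n j \<in> offdiag_sets \<mu> k"
    "\<And>x. x \<in> space E\<^sub>k \<Longrightarrow> \<sigma> n x = (if T n x \<in> J n then fst (T n x) else 0)"
    "\<sigma> n \<in> offdiag_simple \<mu> k" "AE \<omega> in P. I (\<sigma> n) \<omega> = (SUP j\<in>J n. fst j * Mk (fib n j) \<omega>)" for n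
  proof -
    note F = I_fibres[of "J n" "T n" fst, folded fib_def, OF J fibm Td fin, folded \<sigma>_def]
    show "fib n j \<in> offdiag_sets \<mu> k" if "j \<in> J n" for j by (rule F(1)[OF _ _ that])
    show "\<sigma> n x = (if T n x \<in> J n then fst (T n x) else 0)" if "x \<in> space E\<^sub>k" for x
      by (rule F(2)[OF _ _ that])
    show "\<sigma> n \<in> offdiag_simple \<mu> k" by (rule F(3))
    show "AE \<omega> in P. I (\<sigma> n) \<omega> = (SUP j\<in>J n. fst j * Mk (fib n j) \<omega>)" by (rule F(4))
  qed
  have \<sigma>: "\<sigma> n x = (if box_code x < n then s n x else 0)" if x: "x \<in> space E\<^sub>k" for n x
    unfolding rep(2)[OF x] using x by (auto simp: J_def T_def zero_less_iff_neq_zero)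
  have lim: "AE \<omega> in P. (\<lambda>n. I (\<sigma> n) \<omega>) \<longlonglongrightarrow> I h \<omega>"
  proof (rule I_limit[OF h rep(3)])
    fix x assume x: "x \<in> space E\<^sub>k"
    show "\<sigma> n x \<le> \<sigma> (Suc n) x" for n unfolding \<sigma>[OF x] using s(4)[of n "Suc n" x] by simp
    have "eventually (\<lambda>n. s n x = \<sigma> n x) sequentially"
      using eventually_gt_at_top[of "box_code x"] by eventually_elim (simp add: \<sigma>[OF x])
    then show "(\<lambda>n. \<sigma> n x) \<longlonglongrightarrow> h x" using s(5)[of x] by (rule Lim_transform_eventually[rotated])
  qed
  let ?B = "\<lambda>n. {\<omega>\<in>space P. ennreal \<epsilon> < (SUP j\<in>J n. fst j * Mk (fib n j) \<omega>)} \<inter> good L"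
  have Mkm: "Mk (fib n j) \<in> borel_measurable P" if "j \<in> J n" for n j
    by (rule Mk_measurable[OF rep(1)[OF that]])
  have Bj: "{\<omega>\<in>space P. ennreal \<epsilon> < fst j * Mk (fib n j) \<omega>} \<inter> good L \<in> sets P" if "j \<in> J n" for n j
  proof -
    note [measurable] = Mkm[OF that]
    show ?thesis using good_measurable by (intro sets.Int) measurable
  qed
  have Beq: "?B n = (\<Union>j\<in>J n. {\<omega>\<in>space P. ennreal \<epsilon> < fst j * Mk (fib n j) \<omega>} \<inter> good L)" for n
    by (auto simp: less_SUP_iff)
  have Bm: "?B n \<in> sets P" for n
    unfolding Beq using J Bj by (intro sets.finite_UN)
  have bound: "emeasure P (?B n) \<le> ?c * ?R" for n
  proof -
    let ?\<Phi> = "\<lambda>j u. \<Phi> (fst j * ennreal_powr (weight u) (1 / \<alpha>)) * indicator (fib n j) u"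
    have fm: "fib n j \<in> sets m\<^sub>k" for j unfolding sets_power_m by (rule fibm)
    have "emeasure P (?B n) \<le> (\<Sum>j\<in>J n. emeasure P ({\<omega>\<in>space P. ennreal \<epsilon> < fst j * Mk (fib n j) \<omega>} \<inter> good L))"
      unfolding Beq using J Bj by (intro emeasure_subadditive_finite) auto
    also have "\<dots> \<le> (\<Sum>j\<in>J n. ?c * (\<integral>\<^sup>+u. ?\<Phi> j u \<partial>m\<^sub>k))"
    proof (rule sum_mono)
      fix j assume j: "j \<in> J n"
      then obtain v where v: "snd j = box_code v" by (auto simp: J_def T_def)
      show "emeasure P ({\<omega>\<in>space P. ennreal \<epsilon> < fst j * Mk (fib n j) \<omega>} \<inter> good L) \<le> ?c * (\<integral>\<^sup>+u. ?\<Phi> j u \<partial>m\<^sub>k)"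
      proof (rule piece_tail[OF _ fin[OF j] e L rep(1)[OF j], where l="\<lambda>i. level (v i)"])
        show "0 < fst j" using j by (simp add: J_def)
        fix u i assume u: "u \<in> fib n j" and i: "i < k"
        then have "box_code u = box_code v" using v by (auto simp: fib_def T_def)
        then show "level (u i) = level (v i)" using i by (rule box_code_level)
      qed
    qed
    also have "\<dots> = ?c * (\<integral>\<^sup>+u. (\<Sum>j\<in>J n. ?\<Phi> j u) \<partial>m\<^sub>k)"
      using fm by (simp add: sum_distrib_left[symmetric] nn_integral_sum)
    also have "(\<integral>\<^sup>+u. (\<Sum>j\<in>J n. ?\<Phi> j u) \<partial>m\<^sub>k) \<le> ?R"
      unfolding L_ln_L_def
    proof (rule nn_integral_mono)
      fix u
      have "(\<Sum>j\<in>J n. ?\<Phi> j u) = (\<Sum>j\<in>J n. if j = T n u then ?\<Phi> j u else 0)"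
        by (intro sum.cong) (auto simp: fib_def indicator_def)
      also have "\<dots> \<le> \<Phi> (s n u * ennreal_powr (weight u) (1 / \<alpha>))"
        using J by (auto simp: sum.delta T_def indicator_def)
      also have "\<dots> \<le> \<Phi> (h u * ennreal_powr (weight u) (1 / \<alpha>))"
        by (intro L_ln_L_integrand_mono alpha mult_right_mono s(3)) simp
      finally show "(\<Sum>j\<in>J n. ?\<Phi> j u) \<le> \<Phi> (h u * ennreal_powr (weight u) (1 / \<alpha>))" .
    qed
    finally show ?thesis by (simp add: mult_left_mono)
  qed
  define U where "U N = (\<Inter>n\<in>{N..}. ?B n)" for N
  have U: "U N \<in> sets P" for N unfolding U_def using Bm by (intro sets.countable_INT') auto
  note [measurable] = I_measurable[OF h]
  have "emeasure P ({\<omega>\<in>space P. ennreal \<epsilon> < I h \<omega>} \<inter> good L) \<le> emeasure P (\<Union>N. U N)"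
  proof (rule emeasure_mono_AE)
    have "AE \<omega> in P. \<forall>n. I (\<sigma> n) \<omega> = (SUP j\<in>J n. fst j * Mk (fib n j) \<omega>)"
      unfolding AE_all_countable using rep(4) by blast
    then show "AE \<omega> in P. \<omega> \<in> {\<omega>\<in>space P. ennreal \<epsilon> < I h \<omega>} \<inter> good L \<longrightarrow> \<omega> \<in> (\<Union>N. U N)"
      using lim
    proof eventually_elim
      case (elim \<omega>)
      show ?case
      proof
        assume w: "\<omega> \<in> {\<omega>\<in>space P. ennreal \<epsilon> < I h \<omega>} \<inter> good L"
        then have "eventually (\<lambda>n. ennreal \<epsilon> < I (\<sigma> n) \<omega>) sequentially"
          using order_tendstoD(1)[OF elim(2)] by blast
        then obtain N where N: "\<And>n. N \<le> n \<Longrightarrow> ennreal \<epsilon> < I (\<sigma> n) \<omega>"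
          unfolding eventually_sequentially by blast
        have "\<omega> \<in> U N" unfolding U_def
        proof (rule INT_I)
          fix n assume "n \<in> {N..}"
          then have "ennreal \<epsilon> < (SUP j\<in>J n. fst j * Mk (fib n j) \<omega>)" using N[of n] elim(1) by simp
          then show "\<omega> \<in> ?B n" using w by blast
        qed
        then show "\<omega> \<in> (\<Union>N. U N)" by blast
      qed
    qed
    show "(\<Union>N. U N) \<in> sets P" using U by blast
  qed
  also have "\<dots> = (SUP N. emeasure P (U N))"
    using U by (intro SUP_emeasure_incseq[symmetric]) (auto simp: incseq_def U_def)
  also have "\<dots> \<le> ?c * ?R"
  proof (rule SUP_least)
    fix N
    have "emeasure P (U N) \<le> emeasure P (?B N)" using Bm by (intro emeasure_mono) (auto simp: U_def)
    also have "\<dots> \<le> ?c * ?R" by (rule bound)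
    finally show "emeasure P (U N) \<le> ?c * ?R" .
  qed
  finally have 1: "emeasure P ({\<omega>\<in>space P. ennreal \<epsilon> < I h \<omega>} \<inter> good L) \<le> ?c * ?R" .
  have "emeasure P {\<omega>\<in>space P. ennreal \<epsilon> < I h \<omega>} \<le>
      emeasure P ((space P - good L) \<union> ({\<omega>\<in>space P. ennreal \<epsilon> < I h \<omega>} \<inter> good L))"
    using good_measurable[of L] by (intro emeasure_mono) auto
  also have "\<dots> \<le> emeasure P (space P - good L) + emeasure P ({\<omega>\<in>space P. ennreal \<epsilon> < I h \<omega>} \<inter> good L)"
    using good_measurable[of L] by (intro emeasure_subadditive) auto
  also have "\<dots> \<le> ennreal (exp 1 / L) + ?c * ?R"
    by (intro add_mono prob_not_good L 1)
  finally show ?thesis .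
qed

text \<open>Given a tolerance \<open>d\<close>, fix \<open>L\<close> so that the truncation costs \<open>d / 2\<close>; for this \<open>L\<close> the other term tends to \<open>0\<close>.\<close>

lemma I_tendsto_0:
  assumes h: "\<And>n. h n \<in> offdiag_funs \<mu> k" and e: "0 < \<epsilon>"
    and lim: "(\<lambda>n. L_ln_L \<alpha> k (\<lambda>u. h n u * ennreal_powr (weight u) (1 / \<alpha>)) m) \<longlonglongrightarrow> 0"
  shows "(\<lambda>n. emeasure P {\<omega>\<in>space P. ennreal \<epsilon> < I (h n) \<omega>}) \<longlonglongrightarrow> 0"
proof (rule order_tendstoI)
  fix a :: ennreal assume a: "0 < a"
  define b where "b = min a 1"
  have b: "0 < b" "b < \<infinity>" "b \<le> a" using a by (auto simp: b_def min_less_iff_disj)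
  define d where "d = enn2real b"
  have d: "b = ennreal d" "0 < d" using b by (auto simp: d_def enn2real_positive_iff)
  define L where "L = 2 * exp 1 / d"
  have L: "0 < L" "exp 1 / L = d / 2" using d by (simp_all add: L_def)
  let ?R = "\<lambda>n. L_ln_L \<alpha> k (\<lambda>u. h n u * ennreal_powr (weight u) (1 / \<alpha>)) m"
  have "(\<lambda>n. ennreal (d / 2) + ennreal (tail_const \<alpha> k L \<epsilon>) * ?R n) \<longlonglongrightarrow>
      ennreal (d / 2) + ennreal (tail_const \<alpha> k L \<epsilon>) * 0"
    by (intro tendsto_add tendsto_const ennreal_tendsto_cmult lim) simp
  moreover have "ennreal (d / 2) + ennreal (tail_const \<alpha> k L \<epsilon>) * 0 < ennreal d"
    using d by (simp add: ennreal_less_iff)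
  ultimately have "eventually (\<lambda>n. ennreal (d / 2) + ennreal (tail_const \<alpha> k L \<epsilon>) * ?R n < ennreal d) sequentially"
    by (rule order_tendstoD(2))
  then show "eventually (\<lambda>n. emeasure P {\<omega>\<in>space P. ennreal \<epsilon> < I (h n) \<omega>} < a) sequentially"
  proof eventually_elim
    case (elim n)
    have "emeasure P {\<omega>\<in>space P. ennreal \<epsilon> < I (h n) \<omega>} \<le> ennreal (d / 2) + ennreal (tail_const \<alpha> k L \<epsilon>) * ?R n"
      using I_tail[OF h e L(1), of n] unfolding L(2) .
    also note elim
    also have "ennreal d \<le> a" using b d by simp
    finally show ?case .
  qed
qed simp

text \<open>Where \<open>I f = \<infinity>\<close>, the finiteness of \<open>I (fn n)\<close> and subadditivity force \<open>I (h n) = \<infinity>\<close>, an event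
  whose probability is bounded by a null sequence. Where all integrals are finite, the two subadditivity inequalities
  bound the distance by \<open>I (h n)\<close>.\<close>

lemma I_convergence:
  assumes f: "f \<in> offdiag_funs \<mu> k" and fn: "\<And>n. fn n \<in> offdiag_funs \<mu> k"
    and fin: "\<And>n. AE \<omega> in P. I (fn n) \<omega> < \<infinity>"
    and lim: "(\<lambda>n. L_ln_L \<alpha> k (\<lambda>u. ennreal_dist (fn n u) (f u) * ennreal_powr (weight u) (1 / \<alpha>)) m) \<longlonglongrightarrow> 0"
  shows "AE \<omega> in P. I f \<omega> < \<infinity>" "tendsto_in_prob P (\<lambda>n. I (fn n)) (I f)"
proof -
  define h where "h n u = ennreal_dist (fn n u) (f u)" for n u
  have h: "h n \<in> offdiag_funs \<mu> k" for n
  proof -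
    have [measurable]: "fn n \<in> borel_measurable E\<^sub>k" "f \<in> borel_measurable E\<^sub>k"
      using f fn by (simp_all add: offdiag_funs_def)
    have "h n \<in> borel_measurable E\<^sub>k" unfolding h_def by measurable
    moreover have "h n x = 0" if "x \<in> diagonal \<mu> k" for x
      using f fn[of n] that by (simp add: offdiag_funs_def h_def ennreal_dist_def)
    ultimately show ?thesis by (simp add: offdiag_funs_def)
  qed
  have [measurable]: "I f \<in> borel_measurable P" "I (fn n) \<in> borel_measurable P" "I (h n) \<in> borel_measurable P" for n
    by (rule I_measurable[OF f], rule I_measurable[OF fn], rule I_measurable[OF h])
  have tail: "(\<lambda>n. emeasure P {\<omega>\<in>space P. ennreal \<epsilon> < I (h n) \<omega>}) \<longlonglongrightarrow> 0" if "0 < \<epsilon>" for \<epsilon>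
    using lim by (intro I_tendsto_0 h that) (simp add: h_def)
  have le1: "AE \<omega> in P. I f \<omega> \<le> I (fn n) \<omega> + I (h n) \<omega>" for n
    by (rule I_subadditive[OF f fn h]) (simp add: h_def ennreal_dist_commute[of "fn n _"] le_add_ennreal_dist)
  have le2: "AE \<omega> in P. I (fn n) \<omega> \<le> I f \<omega> + I (h n) \<omega>" for n
    by (rule I_subadditive[OF fn f h]) (simp add: h_def le_add_ennreal_dist)
  show ffin: "AE \<omega> in P. I f \<omega> < \<infinity>"
  proof -
    let ?B = "{\<omega>\<in>space P. I f \<omega> = \<infinity>}"
    have "emeasure P ?B \<le> emeasure P {\<omega>\<in>space P. ennreal 1 < I (h n) \<omega>}" for n
    proof (rule emeasure_mono_AE)
      show "AE \<omega> in P. \<omega> \<in> ?B \<longrightarrow> \<omega> \<in> {\<omega>\<in>space P. ennreal 1 < I (h n) \<omega>}"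
        using le1[of n] fin[of n] by eventually_elim (auto simp: top_unique less_top)
    qed measurable
    then have "emeasure P ?B \<le> 0"
      by (intro tendsto_lowerbound[OF tail[of 1]]) auto
    then have "AE \<omega> in P. \<not> I f \<omega> = \<infinity>" by (intro AE_I[of _ _ ?B]) auto
    then show ?thesis by eventually_elim (simp add: less_top)
  qed
  show "tendsto_in_prob P (\<lambda>n. I (fn n)) (I f)"
    unfolding tendsto_in_prob_def
  proof (intro allI impI)
    fix \<epsilon> :: real assume e: "0 < \<epsilon>"
    let ?D = "\<lambda>n. {\<omega>\<in>space P. ennreal \<epsilon> < ennreal_dist (I (fn n) \<omega>) (I f \<omega>)}"
    have "emeasure P (?D n) \<le> emeasure P {\<omega>\<in>space P. ennreal \<epsilon> < I (h n) \<omega>}" for n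
    proof (rule emeasure_mono_AE)
      show "AE \<omega> in P. \<omega> \<in> ?D n \<longrightarrow> \<omega> \<in> {\<omega>\<in>space P. ennreal \<epsilon> < I (h n) \<omega>}"
        using le1[of n] le2[of n] fin[of n] ffin
      proof eventually_elim
        case (elim \<omega>)
        have "ennreal_dist (I (fn n) \<omega>) (I f \<omega>) \<le> I (h n) \<omega>"
          by (rule ennreal_dist_le[OF elim(2,1,3,4)])
        then show ?case by auto
      qed
    qed measurable
    then have "(\<lambda>n. emeasure P (?D n)) \<longlonglongrightarrow> 0"
      by (intro tendsto_sandwich[OF always_eventually always_eventually tendsto_const tail[OF e]]) auto
    then show "(\<lambda>n. prob (?D n)) \<longlonglongrightarrow> 0"
      unfolding emeasure_eq_measure by (subst (asm) ennreal_tendsto_0_iff) auto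
  qed
qed

end

lemma density_normalisation:
  fixes \<psi> :: "'a \<Rightarrow> ennreal"
  assumes m: "prob_space m" and \<psi>: "\<psi> \<in> borel_measurable m" and pos: "AE x in m. 0 < \<psi> x \<and> \<psi> x < \<infinity>"
  obtains w :: "'a \<Rightarrow> real" where "w \<in> borel_measurable m" "\<And>x. 0 < w x"
    "density m \<psi> = density m (\<lambda>x. ennreal (w x))"
    "AE u in power_measure m k. \<forall>i<k. \<psi> (u i) = ennreal (w (u i))"
proof -
  define w where "w x = (if 0 < \<psi> x \<and> \<psi> x < \<infinity> then enn2real (\<psi> x) else 1)" for x
  note [measurable] = \<psi>
  have w: "w \<in> borel_measurable m" unfolding w_def by measurable
  have ae: "AE x in m. \<psi> x = ennreal (w x)" using pos by eventually_elim (simp add: w_def)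
  show thesis
  proof (rule that[OF w])
    show "0 < w x" for x by (auto simp: w_def enn2real_positive_iff)
    show "density m \<psi> = density m (\<lambda>x. ennreal (w x))"
      using ae w by (intro density_cong) auto
    have "AE u in power_measure m k. \<forall>i\<in>{..<k}. \<psi> (u i) = ennreal (w (u i))"
      using m ae by (intro AE_finite_allI AE_PiM_component) auto
    then show "AE u in power_measure m k. \<forall>i<k. \<psi> (u i) = ennreal (w (u i))"
      by (simp only: Ball_def lessThan_iff)
  qed
qed

theorem proposition4p1:
  fixes P :: "'w measure" and \<mu> :: "'a measure" and \<alpha> :: real and k :: nat
    and M :: "'a set \<Rightarrow> 'w \<Rightarrow> ennreal"
    and Mk :: "(nat \<Rightarrow> 'a) set \<Rightarrow> 'w \<Rightarrow> ennreal"
    and I :: "((nat \<Rightarrow> 'a) \<Rightarrow> ennreal) \<Rightarrow> 'w \<Rightarrow> ennreal"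
    and f :: "(nat \<Rightarrow> 'a) \<Rightarrow> ennreal"
    and fn :: "nat \<Rightarrow> (nat \<Rightarrow> 'a) \<Rightarrow> ennreal"
  assumes "prob_space P"
    and "is_borel_space \<mu>" and "sigma_finite_measure \<mu>" and "emeasure \<mu> (space \<mu>) \<noteq> 0"
    and "\<alpha> > 0" and "k \<ge> 2"
    and "frechet_sup_measure P \<mu> \<alpha> M"
    and "product_sup_measure P \<mu> \<alpha> M k Mk"
    and "extremal_integral P \<mu> k Mk I"
    and "f \<in> offdiag_funs \<mu> k" and "\<And>n. fn n \<in> offdiag_funs \<mu> k"
    and "\<And>n. AE \<omega> in P. I (fn n) \<omega> < \<infinity>"
    and "\<exists>(m :: 'a measure) (\<psi> :: 'a \<Rightarrow> ennreal).
           prob_space m \<and> sets m = sets \<mu> \<and>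
           absolutely_continuous m \<mu> \<and> absolutely_continuous \<mu> m \<and>
           \<psi> \<in> borel_measurable m \<and> density m \<psi> = \<mu> \<and> (AE x in m. 0 < \<psi> x \<and> \<psi> x < \<infinity>) \<and>
           (\<lambda>n. L_ln_L \<alpha> k (\<lambda>u. ennreal_dist (fn n u) (f u) *
                   ennreal_powr (\<Prod>i<k. \<psi> (u i)) (1 / \<alpha>)) m) \<longlonglongrightarrow> 0"
  shows "(AE \<omega> in P. I f \<omega> < \<infinity>) \<and> tendsto_in_prob P (\<lambda>n. I (fn n)) (I f)"
proof -
  obtain m \<psi> where m: "prob_space m" "sets m = sets \<mu>"
    and \<psi>: "\<psi> \<in> borel_measurable m" "density m \<psi> = \<mu>" "AE x in m. 0 < \<psi> x \<and> \<psi> x < \<infinity>"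
    and lim: "(\<lambda>n. L_ln_L \<alpha> k (\<lambda>u. ennreal_dist (fn n u) (f u) *
                   ennreal_powr (\<Prod>i<k. \<psi> (u i)) (1 / \<alpha>)) m) \<longlonglongrightarrow> 0"
    using assms(13) by (elim exE conjE)
  obtain w where dens: "w \<in> borel_measurable m" "\<And>x. 0 < w x"
    "density m \<psi> = density m (\<lambda>x. ennreal (w x))"
    "AE u in power_measure m k. \<forall>i<k. \<psi> (u i) = ennreal (w (u i))"
    by (rule density_normalisation[OF m(1) \<psi>(1,3), of k]) (rule that, assumption+)
  have "0 < k" using assms(6) by simp
  interpret extremal_density P \<mu> \<alpha> M k Mk I m w
    by (intro extremal_density.intro extremal.intro product_field.intro frechet_field.intro
        frechet_field_axioms.intro product_field_axioms.intro extremal_axioms.intro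
        extremal_density_axioms.intro assms m dens(1,2) \<open>0 < k\<close> dens(3)[unfolded \<psi>(2)])
  have "L_ln_L \<alpha> k (\<lambda>u. ennreal_dist (fn n u) (f u) * ennreal_powr (\<Prod>i<k. \<psi> (u i)) (1 / \<alpha>)) m =
      L_ln_L \<alpha> k (\<lambda>u. ennreal_dist (fn n u) (f u) * ennreal_powr (weight u) (1 / \<alpha>)) m" for n
    unfolding L_ln_L_def
  proof (rule nn_integral_cong_AE)
    show "AE u in m\<^sub>k. \<Phi> (ennreal_dist (fn n u) (f u) * ennreal_powr (\<Prod>i<k. \<psi> (u i)) (1 / \<alpha>)) =
        \<Phi> (ennreal_dist (fn n u) (f u) * ennreal_powr (weight u) (1 / \<alpha>))"
      using dens(4)
    proof eventually_elim
      case (elim u)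
      then have "(\<Prod>i<k. \<psi> (u i)) = weight u" by (intro prod.cong) auto
      then show ?case by simp
    qed
  qed
  with lim have "(\<lambda>n. L_ln_L \<alpha> k (\<lambda>u. ennreal_dist (fn n u) (f u) *
      ennreal_powr (weight u) (1 / \<alpha>)) m) \<longlonglongrightarrow> 0" by simp
  then show ?thesis by (intro conjI I_convergence[OF assms(10-12)])
qed

end
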